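(* Let $a\in(0,\infty)$, $\beta\in(0,1)$, $1<p<q<\infty$ and $1/q=1/p-\beta$. Then there exists a positive constant $C$, depending on $a$, $p$ and $q$, such that the following hold. (i) If $b\in\mathrm{BMO}(\gamma)$, then for all $f\in L_c^\infty(\gamma)$, $$\left\|\widetilde{[b,\mathcal M_a^\beta]}(f)\right\|_{L^q(\gamma)}\le C\|b\|_\ast\|f\|_{L^p(\gamma)}.$$ Moreover, the sublinear operator $\widetilde{[b,\mathcal M_a^\beta]}$ admits a unique bounded extension from $L^p(\gamma)$ to $L^q(\gamma)$ with norm at most a constant multiple of $\|b\|_\ast$. (ii) If $b\in L^1(\gamma)$ and $\widetilde{[b,\mathcal M_a^\beta]}$ is bounded from $L^p(\gamma)\cap L_c^\infty(\gamma)$ to $L^q(\gamma)$, then $b\in\mathrm{BMO}(\gamma)$ and $$\|b\|_{\mathrm{BMO}(\gamma)}\le\|b\|_{L^1(\gamma)}+C\left\|\widetilde{[b,\mathcal M_a^\beta]}\right\|_{L^p(\gamma)\to L^q(\gamma)}.$$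
   Context: Fix $n\in\{1,2,\dots\}$; constants may depend on $n$. Let $d\gamma(x)=\pi^{-n/2}e^{-|x|^2}dx$ be the Gauss measure on $\mathbb R^n$, where $|\cdot|$ is the Euclidean norm. For a ball $B\subset\mathbb R^n$, $c_B$ and $r_B$ denote its center and radius. Let $m(x)=\min\{1,1/|x|\}$ for $x\in\mathbb R^n$ (with $m(0)=1$). For $a\in(0,\infty)$, $\mathcal B_a$ is the set of all balls $B\subset\mathbb R^n$ with $r_B\le a\,m(c_B)$, and $\mathcal B_a(x)$ is the collection of all balls in $\mathcal B_a$ containing $x$. For $b$ locally integrable and $B$ a ball, $b_B=\frac1{\gamma(B)}\int_B b\,d\gamma$. For $b\in L^1(\gamma)$ set $$\|b\|_\ast=\sup_{B\in\mathcal B_1}\frac1{\gamma(B)}\int_B|b(x)-b_B|\,d\gamma(x);$$ $\mathrm{BMO}(\gamma)$ is the set of $b\in L^1(\gamma)$ with $\|b\|_\ast<\infty$, with norm $\|b\|_{\mathrm{BMO}(\gamma)}=\|b\|_\ast+\|b\|_{L^1(\gamma)}$. $L_c^\infty(\gamma)$ is the set of functions in $L^\infty(\gamma)$ with compact support. For $a\in(0,\infty)$, $\beta\in(0,1)$, $b\in L^1(\gamma)$ (in particular $b\in\mathrm{BMO}(\gamma)$), $f\in L_c^\infty(\gamma)$ and $x\in\mathbb R^n$ define $$\widetilde{[b,\mathcal M_a^\beta]}(f)(x)=\sup_{B\in\mathcal B_a(x)}\frac1{[\gamma(B)]^{1-\beta}}\int_B|b(x)-b(y)||f(y)|\,d\gamma(y).$$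 An operator $T$ is bounded from a normed space $\mathcal X$ to a normed space $\mathcal Y$ if there is a constant $C\ge0$ with $\|T(f)\|_{\mathcal Y}\le C\|f\|_{\mathcal X}$ for all $f\in\mathcal X$; $\|T\|_{\mathcal X\to\mathcal Y}$ denotes its operator norm. Here $L^p(\gamma)\cap L_c^\infty(\gamma)$ carries the $L^p(\gamma)$ norm, and $\|\widetilde{[b,\mathcal M_a^\beta]}\|_{L^p(\gamma)\to L^q(\gamma)}$ is the corresponding operator norm (supremum over $f\in L_c^\infty(\gamma)$ with $\|f\|_{L^p(\gamma)}=1$). *)

theory Defs
  imports "HOL-Analysis.Analysis"
begin

definition gauss_measure :: "(real ^ 'n::finite) measure" where
  "gauss_measure =
     density lborel (\<lambda>x. ennreal (pi powr (- real CARD('n) / 2) * exp (- (norm x)\<^sup>2)))"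

text \<open>The Lebesgue quasi-norms are taken in \<open>[0, \<infinity>]\<close>, for \<open>[0, \<infinity>]\<close>-valued functions, because
  the maximal operator below is a supremum that may be infinite at some points.  The power
  function \<open>t \<mapsto> t\<^sup>s\<close> is only used with \<open>s > 0\<close>.\<close>

definition ennreal_powr :: "ennreal \<Rightarrow> real \<Rightarrow> ennreal" where
  "ennreal_powr t s = (if t = \<infinity> then \<infinity> else ennreal (enn2real t powr s))"

definition ennnorm :: "real \<Rightarrow> (real ^ 'n::finite \<Rightarrow> ennreal) \<Rightarrow> ennreal" where
  "ennnorm p g = ennreal_powr (\<integral>\<^sup>+x. ennreal_powr (g x) p \<partial>gauss_measure) (1 / p)"

definition Lp_norm :: "real \<Rightarrow> (real ^ 'n::finite \<Rightarrow> real) \<Rightarrow> ennreal" where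
  "Lp_norm p f = ennnorm p (\<lambda>x. ennreal \<bar>f x\<bar>)"

definition Lp_space :: "real \<Rightarrow> (real ^ 'n::finite \<Rightarrow> real) set" where
  "Lp_space p = {f \<in> borel_measurable gauss_measure. Lp_norm p f < \<infinity>}"

lemma Lp_space_1_eq: "Lp_space 1 = {f. integrable gauss_measure f}"
proof -
  have "ennreal_powr t 1 = t" for t
    by (cases t) (auto simp: ennreal_powr_def)
  then show ?thesis
    by (auto simp: Lp_space_def Lp_norm_def ennnorm_def integrable_iff_bounded)
qed

text \<open>Essentially bounded functions with (essentially) compact support.\<close>

definition Linf_c :: "(real ^ 'n::finite \<Rightarrow> real) set" where
  "Linf_c = {f \<in> borel_measurable gauss_measure.
     (\<exists>M. AE x in gauss_measure. \<bar>f x\<bar> \<le> M) \<and>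
     (\<exists>K. compact K \<and> (AE x in gauss_measure. x \<notin> K \<longrightarrow> f x = 0))}"

text \<open>In HOL \<open>1 / 0 = 0\<close>, so the value at the origin has to be given separately.\<close>

definition admissible_fun :: "real ^ 'n::finite \<Rightarrow> real" where
  "admissible_fun x = (if x = 0 then 1 else min 1 (1 / norm x))"

definition admissible_balls :: "real \<Rightarrow> (real ^ 'n::finite) set set" where
  "admissible_balls a = {ball c r |c r. 0 < r \<and> r \<le> a * admissible_fun c}"

definition ball_average :: "(real ^ 'n::finite \<Rightarrow> real) \<Rightarrow> (real ^ 'n) set \<Rightarrow> real" where
  "ball_average b B = (LINT x:B|gauss_measure. b x) / measure gauss_measure B"

definition bmo_seminorm :: "(real ^ 'n::finite \<Rightarrow> real) \<Rightarrow> ennreal" where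
  "bmo_seminorm b = (SUP B\<in>admissible_balls 1.
     (\<integral>\<^sup>+x\<in>B. ennreal \<bar>b x - ball_average b B\<bar> \<partial>gauss_measure)
       / ennreal (measure gauss_measure B))"

definition BMO :: "(real ^ 'n::finite \<Rightarrow> real) set" where
  "BMO = {b \<in> Lp_space 1. bmo_seminorm b < \<infinity>}"

definition BMO_norm :: "(real ^ 'n::finite \<Rightarrow> real) \<Rightarrow> ennreal" where
  "BMO_norm b = bmo_seminorm b + Lp_norm 1 b"

definition max_commutator ::
    "(real ^ 'n::finite \<Rightarrow> real) \<Rightarrow> real \<Rightarrow> real \<Rightarrow> (real ^ 'n \<Rightarrow> real) \<Rightarrow> real ^ 'n \<Rightarrow> ennreal" where
  "max_commutator b a \<beta> f x = (SUP B\<in>{B \<in> admissible_balls a. x \<in> B}.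
     (\<integral>\<^sup>+y\<in>B. ennreal (\<bar>b x - b y\<bar> * \<bar>f y\<bar>) \<partial>gauss_measure)
       / ennreal (measure gauss_measure B powr (1 - \<beta>)))"

text \<open>Operators act on functions rather than on classes modulo null sets, and take values in
  the \<open>[0, \<infinity>]\<close>-valued functions.  Below, \<open>D\<close> is the domain, normed by the \<open>L\<^sup>p\<close> norm, and the
  target is the nonnegative part of \<open>L\<^sup>q\<close>.\<close>

definition bounded_op_on ::
    "(real ^ 'n::finite \<Rightarrow> real) set \<Rightarrow> real \<Rightarrow> real \<Rightarrow>
     ((real ^ 'n \<Rightarrow> real) \<Rightarrow> real ^ 'n \<Rightarrow> ennreal) \<Rightarrow> bool" where
  "bounded_op_on D p q T \<longleftrightarrow>
     (\<exists>C\<ge>0. \<forall>f\<in>D. T f \<in> borel_measurable gauss_measure \<and>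
        ennnorm q (T f) \<le> ennreal C * Lp_norm p f)"

definition op_norm_on ::
    "(real ^ 'n::finite \<Rightarrow> real) set \<Rightarrow> real \<Rightarrow> real \<Rightarrow>
     ((real ^ 'n \<Rightarrow> real) \<Rightarrow> real ^ 'n \<Rightarrow> ennreal) \<Rightarrow> ennreal" where
  "op_norm_on D p q T = (SUP f\<in>{f \<in> D. Lp_norm p f = 1}. ennnorm q (T f))"

definition sublinear_op_on ::
    "(real ^ 'n::finite \<Rightarrow> real) set \<Rightarrow>
     ((real ^ 'n \<Rightarrow> real) \<Rightarrow> real ^ 'n \<Rightarrow> ennreal) \<Rightarrow> bool" where
  "sublinear_op_on D T \<longleftrightarrow>
     (\<forall>f\<in>D. \<forall>g\<in>D. (AE x in gauss_measure. f x = g x) \<longrightarrow>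
        (AE x in gauss_measure. T f x = T g x)) \<and>
     (\<forall>f\<in>D. \<forall>g\<in>D. AE x in gauss_measure. T (\<lambda>y. f y + g y) x \<le> T f x + T g x) \<and>
     (\<forall>f\<in>D. \<forall>c. AE x in gauss_measure. T (\<lambda>y. c * f y) x = ennreal \<bar>c\<bar> * T f x)"

text \<open>Boundedness alone does not determine an extension of a nonlinear operator from a dense
  subspace; the extension of a sublinear operator is understood to be sublinear again.\<close>

definition bounded_extension ::
    "real \<Rightarrow> real \<Rightarrow> ((real ^ 'n::finite \<Rightarrow> real) \<Rightarrow> real ^ 'n \<Rightarrow> ennreal) \<Rightarrow>
     ((real ^ 'n \<Rightarrow> real) \<Rightarrow> real ^ 'n \<Rightarrow> ennreal) \<Rightarrow> bool" where
  "bounded_extension p q T S \<longleftrightarrow>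
     sublinear_op_on (Lp_space p) S \<and> bounded_op_on (Lp_space p) p q S \<and>
     (\<forall>f\<in>Linf_c. AE x in gauss_measure. S f x = T f x)"

end

theory Submission
  imports Defs
begin

text \<open>The hinge is the condition that the double integral of \<open>\<bar>b x - b y\<bar>\<close> over \<open>B \<times> B\<close>,
  called \<open>pair_osc\<close> here, is at most \<open>\<kappa> \<gamma>(B)\<^sup>2\<close> for every admissible ball \<open>B\<close>.  For aperture 1
  the least such \<open>\<kappa>\<close> is comparable to the seminorm of \<open>b\<close>.

  On an admissible ball the Gauss density is comparable to a constant, so that locally the
  problem is one about Lebesgue measure on cubes.  There, inserting the midpoint of \<open>x\<close> and
  \<open>y\<close> between them bounds the oscillation over a cube by the oscillations over subcubes of three
  quarters of the side (\<open>pair_osc_three_quarter\<close>).  Iterating this, the condition for one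
  aperture implies that for every other one (\<open>pair_osc_change_aperture\<close>).

  Necessity is then a test on indicator functions.  For \<open>f\<close> the indicator of \<open>B\<close>, the commutator
  at \<open>x \<in> B\<close> dominates \<open>\<gamma>(B)\<close> to the power \<open>\<beta> - 1\<close> times the integral of \<open>\<bar>b x - b y\<bar>\<close> over
  \<open>y \<in> B\<close>.  Integrating in \<open>x\<close> and using Hoelder's inequality, the hinge condition holds for
  aperture \<open>a\<close> with \<open>\<kappa>\<close> the operator norm, because the exponents of \<open>\<gamma>(B)\<close> add up to 2
  (\<open>pair_osc_le_op_norm\<close>).

  For sufficiency, the John--Nirenberg inequality turns the hinge condition into bounds for all
  power means of \<open>\<bar>b x - b y\<bar>\<close> over local cubes (\<open>gauss_power_oscillation\<close>).  Every admissible
  ball lies in a cube of comparable mass from a countable lattice, so the \<open>q\<close>-th power of the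
  supremum is at most the sum of the \<open>q\<close>-th powers over the lattice cubes containing the point.
  Because \<open>p < q\<close>, this sum still satisfies the desired bound.  On one cube \<open>Q\<close>, Hoelder's inequality with
  exponents \<open>s\<close> and \<open>\<sigma>\<close>, where \<open>1 < s < p\<close> and \<open>q < \<sigma>\<close>, separates \<open>b\<close> from \<open>f\<close>
  (\<open>commutator_on_set\<close>).  What remains is to sum \<open>\<gamma>(Q)\<close> to the power \<open>q/p - q/s\<close> times the
  \<open>q/s\<close>-th power of the integral of \<open>\<bar>f\<bar>\<close> to the power \<open>s\<close>.  Splitting that integrand at a
  height depending on \<open>\<gamma>(Q)\<close> makes both halves geometric series at each point, because the cubes
  through a point have geometrically decreasing masses and bounded overlap
  (\<open>fractional_embedding\<close>, \<open>lattice_power_sum\<close>); no maximal inequality enters.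

  These bounds hold for every \<open>f\<close> in \<open>L\<^sup>p\<close>, so the formula for the commutator is itself the
  extension.  It is the only one because a bounded sublinear operator is continuous and
  truncations are dense (\<open>bounded_extension_le\<close>).\<close>

section \<open>Powers and integral inequalities in \<open>[0, \<infinity>]\<close>\<close>

lemma ennreal_powr_ennreal: "0 \<le> r \<Longrightarrow> ennreal_powr (ennreal r) s = ennreal (r powr s)"
  by (simp add: ennreal_powr_def)

lemma ennreal_powr_top [simp]: "ennreal_powr \<infinity> s = \<infinity>" "ennreal_powr top s = top"
  by (auto simp: ennreal_powr_def)

lemma ennreal_powr_zero [simp]: "ennreal_powr 0 s = 0"
  by (simp add: ennreal_powr_def)

lemma ennreal_powr_one_left [simp]: "ennreal_powr 1 s = 1"
  by (simp add: ennreal_powr_def)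

lemma ennreal_powr_one [simp]: "ennreal_powr t 1 = t"
  by (cases t) (auto simp: ennreal_powr_def)

lemma ennreal_powr_eq_0_iff [simp]: "ennreal_powr t s = 0 \<longleftrightarrow> t = 0"
  by (cases t) (auto simp: ennreal_powr_def ennreal_eq_0_iff)

lemma ennreal_powr_eq_top_iff [simp]: "ennreal_powr t s = top \<longleftrightarrow> t = top"
  by (cases t) (auto simp: ennreal_powr_def)

lemma ennreal_powr_mono: "0 < s \<Longrightarrow> x \<le> y \<Longrightarrow> ennreal_powr x s \<le> ennreal_powr y s"
  by (cases x; cases y) (auto simp: ennreal_powr_def top_unique powr_mono2 ennreal_leI)

lemma ennreal_powr_mult: "0 < s \<Longrightarrow> ennreal_powr (x * y) s = ennreal_powr x s * ennreal_powr y s"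
  by (cases x; cases y)
    (auto simp: ennreal_powr_def ennreal_mult[symmetric] powr_mult ennreal_mult_top ennreal_top_mult ennreal_mult_eq_top_iff)

lemma ennreal_powr_powr: "ennreal_powr (ennreal_powr x s) t = ennreal_powr x (s * t)"
  by (cases x) (auto simp: ennreal_powr_def powr_powr)

lemma ennreal_powr_add: "0 < s \<Longrightarrow> 0 < t \<Longrightarrow> ennreal_powr x s * ennreal_powr x t = ennreal_powr x (s + t)"
  by (cases x) (auto simp: ennreal_powr_def powr_add ennreal_mult)

lemma measurable_ennreal_powr [measurable]:
  assumes [measurable]: "f \<in> borel_measurable M"
  shows "(\<lambda>x. ennreal_powr (f x) s) \<in> borel_measurable M"
  unfolding ennreal_powr_def by measurable

lemma ennreal_powr_sum_le:
  assumes "0 < s"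
  shows "ennreal_powr (x + y) s \<le> ennreal (2 powr s) * (ennreal_powr x s + ennreal_powr y s)"
proof -
  have "ennreal_powr (x + y) s \<le> ennreal_powr (2 * max x y) s"
    using assms by (intro ennreal_powr_mono)
      (auto simp: max_def mult_2 intro: add_mono)
  also have "\<dots> = ennreal (2 powr s) * ennreal_powr (max x y) s"
    using assms ennreal_powr_ennreal[of 2 s] by (simp add: ennreal_powr_mult)
  also have "\<dots> \<le> ennreal (2 powr s) * (ennreal_powr x s + ennreal_powr y s)"
    by (intro mult_left_mono) (auto simp: max_def)
  finally show ?thesis .
qed

text \<open>Young's inequality, applied pointwise to the functions divided by their norms and then
  integrated. The cases of norm \<open>0\<close> or \<open>\<infinity>\<close> are separate.\<close>

lemma nn_integral_Hoelder:
  fixes f g :: "'a \<Rightarrow> ennreal"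
  assumes [measurable]: "f \<in> borel_measurable M" "g \<in> borel_measurable M"
    and pq: "1 < p" "1 < q" "1 / p + 1 / q = 1"
  shows "(\<integral>\<^sup>+x. f x * g x \<partial>M) \<le>
    ennreal_powr (\<integral>\<^sup>+x. ennreal_powr (f x) p \<partial>M) (1 / p) *
    ennreal_powr (\<integral>\<^sup>+x. ennreal_powr (g x) q \<partial>M) (1 / q)"
proof -
  define F where "F = (\<integral>\<^sup>+x. ennreal_powr (f x) p \<partial>M)"
  define G where "G = (\<integral>\<^sup>+x. ennreal_powr (g x) q \<partial>M)"
  have p0: "0 < p" "0 < q" using pq by auto
  consider "F = 0 \<or> G = 0" | "F \<noteq> 0" "G \<noteq> 0" "F = top \<or> G = top" | "F \<noteq> 0" "G \<noteq> 0" "F \<noteq> top" "G \<noteq> top"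
    by blast
  then show ?thesis
  proof cases
    case 1
    then have "AE x in M. f x * g x = 0"
    proof
      assume "F = 0"
      then have "AE x in M. f x = 0" unfolding F_def by (simp add: nn_integral_0_iff_AE)
      then show ?thesis by eventually_elim simp
    next
      assume "G = 0"
      then have "AE x in M. g x = 0" unfolding G_def by (simp add: nn_integral_0_iff_AE)
      then show ?thesis by eventually_elim simp
    qed
    then have "(\<integral>\<^sup>+x. f x * g x \<partial>M) = 0" by (simp add: nn_integral_0_iff_AE)
    then show ?thesis by simp
  next
    case 2
    then have "ennreal_powr F (1 / p) * ennreal_powr G (1 / q) = top"
      by (auto simp: ennreal_mult_eq_top_iff)
    then show ?thesis unfolding F_def G_def by (simp only: top_greatest)
  next
    case 3
    obtain F' where F': "F = ennreal F'" "0 < F'"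
      using 3 by (cases F) (auto simp: less_le)
    obtain G' where G': "G = ennreal G'" "0 < G'"
      using 3 by (cases G) (auto simp: less_le)
    define \<alpha> where "\<alpha> = F' powr (1 / p)"
    define \<delta> where "\<delta> = G' powr (1 / q)"
    have ad: "0 < \<alpha>" "0 < \<delta>" using F' G' by (auto simp: \<alpha>_def \<delta>_def)
    have ap: "\<alpha> powr p = F'" "\<delta> powr q = G'"
      using F' G' p0 by (auto simp: \<alpha>_def \<delta>_def powr_powr)
    have young: "x * y \<le> ennreal (\<alpha> * \<delta> / (p * F')) * ennreal_powr x p
        + ennreal (\<alpha> * \<delta> / (q * G')) * ennreal_powr y q" for x y :: ennreal
    proof (cases "x = top \<or> y = top")
      case True
      then have "ennreal (\<alpha> * \<delta> / (p * F')) * ennreal_powr x p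
        + ennreal (\<alpha> * \<delta> / (q * G')) * ennreal_powr y q = top"
        using ad F' G' p0 by (auto simp: ennreal_mult_eq_top_iff)
      then show ?thesis by (simp only: top_greatest)
    next
      case False
      then obtain x' y' where xy: "x = ennreal x'" "0 \<le> x'" "y = ennreal y'" "0 \<le> y'"
        by (cases x; cases y) auto
      have "(x' / \<alpha>) * (y' / \<delta>) \<le> (x' / \<alpha>) powr p / p + (y' / \<delta>) powr q / q"
        using Youngs_inequality[of p q "x' / \<alpha>" "y' / \<delta>"] pq xy ad by auto
      then have "(\<alpha> * \<delta>) * ((x' / \<alpha>) * (y' / \<delta>)) \<le>
          (\<alpha> * \<delta>) * ((x' / \<alpha>) powr p / p + (y' / \<delta>) powr q / q)"
        using ad by (intro mult_left_mono) auto
      then have "x' * y' \<le> \<alpha> * \<delta> / (p * F') * x' powr p + \<alpha> * \<delta> / (q * G') * y' powr q"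
        using ad xy by (simp add: powr_divide ap field_simps)
      then show ?thesis
        using xy ad F' G' p0
        by (simp add: ennreal_powr_ennreal ennreal_mult[symmetric] ennreal_plus[symmetric]
            ennreal_leI del: ennreal_plus)
    qed
    have "(\<integral>\<^sup>+x. f x * g x \<partial>M) \<le> (\<integral>\<^sup>+x. ennreal (\<alpha> * \<delta> / (p * F')) * ennreal_powr (f x) p
        + ennreal (\<alpha> * \<delta> / (q * G')) * ennreal_powr (g x) q \<partial>M)"
      by (intro nn_integral_mono young)
    also have "\<dots> = ennreal (\<alpha> * \<delta> / (p * F')) * F + ennreal (\<alpha> * \<delta> / (q * G')) * G"
      unfolding F_def G_def by (simp add: nn_integral_add nn_integral_cmult)
    also have "\<dots> = ennreal (\<alpha> * \<delta> / (p * F') * F' + \<alpha> * \<delta> / (q * G') * G')"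
      using F' G' ad p0 by (simp add: ennreal_mult[symmetric])
    also have "\<alpha> * \<delta> / (p * F') * F' + \<alpha> * \<delta> / (q * G') * G' = \<alpha> * \<delta> * (1 / p + 1 / q)"
      using F' G' by (simp add: field_simps)
    also have "ennreal \<dots> = ennreal_powr F (1 / p) * ennreal_powr G (1 / q)"
      using F' G' pq by (simp add: ennreal_powr_ennreal \<alpha>_def \<delta>_def ennreal_mult)
    finally show ?thesis unfolding F_def G_def .
  qed
qed

text \<open>Jensen's inequality for the mean over \<open>A\<close>, with the denominators cleared; it is
  Hoelder's inequality against the indicator of \<open>A\<close>.\<close>

lemma nn_integral_power_set_le:
  fixes f :: "'a \<Rightarrow> ennreal"
  assumes [measurable]: "f \<in> borel_measurable M" "A \<in> sets M" and q: "1 < q"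
  shows "ennreal_powr (\<integral>\<^sup>+x\<in>A. f x \<partial>M) q \<le>
    ennreal_powr (emeasure M A) (q - 1) * (\<integral>\<^sup>+x\<in>A. ennreal_powr (f x) q \<partial>M)"
proof -
  define r where "r = q / (q - 1)"
  have r: "1 < r" "1 / q + 1 / r = 1" "q / r = q - 1" using q by (auto simp: r_def field_simps)
  have i1: "(\<integral>\<^sup>+x\<in>A. f x \<partial>M) = (\<integral>\<^sup>+x. (f x * indicator A x) * indicator A x \<partial>M)"
    by (intro nn_integral_cong) (auto simp: indicator_def)
  have i2: "(\<integral>\<^sup>+x. ennreal_powr (f x * indicator A x) q \<partial>M) = (\<integral>\<^sup>+x\<in>A. ennreal_powr (f x) q \<partial>M)"
    by (intro nn_integral_cong) (auto simp: indicator_def)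
  have i3: "(\<integral>\<^sup>+x. ennreal_powr (indicator A x) r \<partial>M) = emeasure M A"
  proof -
    have "(\<integral>\<^sup>+x. ennreal_powr (indicator A x) r \<partial>M) = (\<integral>\<^sup>+x. indicator A x \<partial>M)"
      by (intro nn_integral_cong) (auto simp: indicator_def)
    then show ?thesis by simp
  qed
  have "(\<integral>\<^sup>+x\<in>A. f x \<partial>M) \<le> ennreal_powr (\<integral>\<^sup>+x\<in>A. ennreal_powr (f x) q \<partial>M) (1 / q)
      * ennreal_powr (emeasure M A) (1 / r)"
    unfolding i1
    using nn_integral_Hoelder[of "\<lambda>x. f x * indicator A x" M "indicator A" q r] q r
    by (simp add: i2 i3)
  then have "ennreal_powr (\<integral>\<^sup>+x\<in>A. f x \<partial>M) q \<le>
      ennreal_powr (ennreal_powr (\<integral>\<^sup>+x\<in>A. ennreal_powr (f x) q \<partial>M) (1 / q)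
      * ennreal_powr (emeasure M A) (1 / r)) q"
    using q by (intro ennreal_powr_mono) auto
  also have "\<dots> = (\<integral>\<^sup>+x\<in>A. ennreal_powr (f x) q \<partial>M) * ennreal_powr (emeasure M A) (q - 1)"
    using q r by (simp add: ennreal_powr_mult ennreal_powr_powr)
  finally show ?thesis by (simp add: mult.commute)
qed

section \<open>Half-open cubes and oscillation over pairs of points\<close>

text \<open>Half-open, so that the dyadic children of a cube partition it exactly.\<close>

definition cube :: "real ^ 'n::finite \<Rightarrow> real \<Rightarrow> (real ^ 'n) set" where
  "cube u s = {x. \<forall>i. u $ i \<le> x $ i \<and> x $ i < u $ i + s}"

text \<open>Subcubes are indexed by the set \<open>S\<close> of coordinates in which their lower corner is
  shifted; the type of such sets is finite and has \<open>2\<^sup>n\<close> elements.\<close>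

definition corner :: "real ^ 'n::finite \<Rightarrow> real \<Rightarrow> 'n set \<Rightarrow> real ^ 'n" where
  "corner u t S = (\<chi> i. u $ i + (if i \<in> S then t else 0))"

lemma cube_borel [measurable]: "cube u s \<in> sets borel"
proof -
  have "cube u s = (\<Inter>i. {x. u $ i \<le> x $ i} \<inter> {x. x $ i < u $ i + s})"
    by (auto simp: cube_def)
  also have "\<dots> \<in> sets borel"
    by (intro sets.finite_INT sets.Int borel_closed borel_open closed_halfspace_component_ge_cart
        open_halfspace_component_lt_cart) (auto simp: closed_halfspace_component_ge_cart)
  finally show ?thesis .
qed

lemma emeasure_cube:
  fixes u :: "real ^ 'n::finite"
  assumes "0 \<le> s"
  shows "emeasure lborel (cube u s) = ennreal (s ^ CARD('n))"
proof -
  define v where "v = (\<chi> i. u $ i + s)"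
  have m: "emeasure lborel (cbox u v) = ennreal (s ^ CARD('n))"
  proof -
    have "cbox u v \<noteq> {}"
      using assms by (auto simp: v_def mem_box_cart intro!: exI[of _ u] simp: interval_ne_empty_cart)
    then have "measure lborel (cbox u v) = s ^ CARD('n)"
      by (simp add: content_cbox_cart v_def)
    moreover have "emeasure lborel (cbox u v) = ennreal (measure lborel (cbox u v))"
      by (intro emeasure_eq_ennreal_measure) (simp add: emeasure_lborel_cbox_eq)
    ultimately show ?thesis by simp
  qed
  have b: "emeasure lborel (box u v) = emeasure lborel (cbox u v)"
    by (simp add: emeasure_lborel_box_eq emeasure_lborel_cbox_eq)
  have "box u v \<subseteq> cube u s" "cube u s \<subseteq> cbox u v"
    by (auto simp: mem_box_cart cube_def v_def less_imp_le)
  then have "emeasure lborel (box u v) \<le> emeasure lborel (cube u s)"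
     "emeasure lborel (cube u s) \<le> emeasure lborel (cbox u v)"
    by (auto intro!: emeasure_mono)
  then show ?thesis using b m by simp
qed

lemma measure_cube:
  fixes u :: "real ^ 'n::finite"
  assumes "0 \<le> s"
  shows "measure lborel (cube u s) = s ^ CARD('n)"
  using emeasure_cube[OF assms, of u] assms by (simp add: measure_def)

lemma mem_cube_corner: "0 < s \<Longrightarrow> u \<in> cube u s"
  by (simp add: cube_def)

lemma norm_diff_cube_le:
  fixes u :: "real ^ 'n::finite"
  assumes "x \<in> cube u s"
  shows "norm (x - u) \<le> real CARD('n) * s"
proof -
  have "norm (x - u) \<le> (\<Sum>i\<in>UNIV. \<bar>(x - u) $ i\<bar>)" by (rule norm_le_l1_cart)
  also have "\<dots> \<le> (\<Sum>i\<in>(UNIV::'n set). s)"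
  proof (intro sum_mono)
    fix i
    have "u $ i \<le> x $ i" "x $ i < u $ i + s" using assms by (auto simp: cube_def)
    then show "\<bar>(x - u) $ i\<bar> \<le> s" by simp
  qed
  finally show ?thesis by simp
qed

lemma cube_corner_subset:
  "0 \<le> t \<Longrightarrow> t + s' \<le> s \<Longrightarrow> cube (corner u t S) s' \<subseteq> cube u s"
proof
  fix x assume t: "0 \<le> t" "t + s' \<le> s" and x: "x \<in> cube (corner u t S) s'"
  have "u $ i \<le> x $ i \<and> x $ i < u $ i + s" for i
  proof -
    have "u $ i + (if i \<in> S then t else 0) \<le> x $ i \<and> x $ i < u $ i + (if i \<in> S then t else 0) + s'"
      using x by (simp add: cube_def corner_def)
    then show ?thesis using t by (simp split: if_splits)
  qed
  then show "x \<in> cube u s" by (simp add: cube_def)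
qed

text \<open>The child containing a point is read off from the coordinates lying in the upper half,
  which gives the partition into children.\<close>

lemma mem_dyadic_child_iff:
  assumes "0 < s"
  shows "x \<in> cube (corner u (s / 2) S) (s / 2) \<longleftrightarrow>
    x \<in> cube u s \<and> S = {i. u $ i + s / 2 \<le> x $ i}"
proof -
  have "u $ i + (if i \<in> S then s / 2 else 0) \<le> x $ i \<and>
      x $ i < u $ i + (if i \<in> S then s / 2 else 0) + s / 2 \<longleftrightarrow>
      u $ i \<le> x $ i \<and> x $ i < u $ i + s \<and> (i \<in> S \<longleftrightarrow> u $ i + s / 2 \<le> x $ i)" for i
    using assms by (auto simp: not_le)
  then show ?thesis unfolding cube_def corner_def by auto
qed

lemma indicator_cube_children:
  fixes u :: "real ^ 'n::finite"
  assumes "0 < s"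
  shows "(indicator (cube u s) x :: 'a::semiring_1) =
    (\<Sum>S\<in>UNIV. indicator (cube (corner u (s / 2) S) (s / 2)) x)"
proof -
  have "(\<Sum>S\<in>UNIV. indicator (cube (corner u (s / 2) S) (s / 2)) x :: 'a) =
      (\<Sum>S\<in>UNIV. if S = {i. u $ i + s / 2 \<le> x $ i} then indicator (cube u s) x else 0)"
    by (intro sum.cong refl) (auto simp: indicator_def mem_dyadic_child_iff[OF assms])
  also have "\<dots> = indicator (cube u s) x" by simp
  finally show ?thesis ..
qed

lemma card_set_UNIV: "CARD('n::finite set) = 2 ^ CARD('n)"
  by (simp add: card_UNIV_set)

text \<open>Unlike the oscillation around a mean value, this quantity is monotone in \<open>A\<close> and passes
  between comparable measures without a change of centre.\<close>

definition pair_osc :: "(real ^ 'n::finite) measure \<Rightarrow> (real ^ 'n \<Rightarrow> real) \<Rightarrow> (real ^ 'n) set \<Rightarrow> ennreal" where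
  "pair_osc M b A = (\<integral>\<^sup>+x\<in>A. (\<integral>\<^sup>+y\<in>A. ennreal \<bar>b x - b y\<bar> \<partial>M) \<partial>M)"

text \<open>On an interval of length \<open>s\<close>, two points at distance less than \<open>s/2\<close> lie together in
  the lower or in the upper three quarters; this is applied to each coordinate.\<close>

lemma pair_in_three_quarter_cube:
  assumes "0 < s" "x \<in> cube u s" "z \<in> cube u s" "\<And>i. \<bar>x $ i - z $ i\<bar> < s / 2"
  shows "\<exists>S. x \<in> cube (corner u (s / 4) S) (3 * s / 4) \<and> z \<in> cube (corner u (s / 4) S) (3 * s / 4)"
proof -
  define S where "S = {i. u $ i + s / 4 \<le> min (x $ i) (z $ i)}"
  have *: "\<bar>x $ i - z $ i\<bar> < s / 2" "u $ i \<le> x $ i" "x $ i < u $ i + s" "u $ i \<le> z $ i" "z $ i < u $ i + s" for i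
    using assms by (auto simp: cube_def)
  have "u $ i + (if i \<in> S then s / 4 else 0) \<le> x $ i \<and>
      x $ i < u $ i + (if i \<in> S then s / 4 else 0) + 3 * s / 4 \<and>
      u $ i + (if i \<in> S then s / 4 else 0) \<le> z $ i \<and>
      z $ i < u $ i + (if i \<in> S then s / 4 else 0) + 3 * s / 4" for i
    using *[of i] assms(1) by (auto simp: S_def min_def abs_if split: if_splits)
  then show ?thesis by (intro exI[of _ S]) (auto simp: cube_def corner_def)
qed

lemma nn_integral_midpoint:
  fixes h :: "real ^ 'n::finite \<Rightarrow> ennreal"
  assumes [measurable]: "h \<in> borel_measurable borel"
  shows "(\<integral>\<^sup>+y. h y \<partial>lborel) = 2 ^ CARD('n) * (\<integral>\<^sup>+z. h (2 *\<^sub>R z - x) \<partial>lborel)"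
proof -
  have L: "(lborel :: (real ^ 'n) measure) =
      density (distr lborel borel (\<lambda>z. - x + 2 *\<^sub>R z)) (\<lambda>_. \<bar>2::real\<bar> ^ DIM(real ^ 'n))"
    by (rule lborel_affine) simp
  have "(\<integral>\<^sup>+y. h y \<partial>lborel) =
      (\<integral>\<^sup>+z. ennreal (2 ^ DIM(real ^ 'n)) * h (2 *\<^sub>R z - x) \<partial>lborel)"
    by (subst L) (simp add: nn_integral_density nn_integral_distr)
  also have "\<dots> = 2 ^ CARD('n) * (\<integral>\<^sup>+z. h (2 *\<^sub>R z - x) \<partial>lborel)"
    by (subst nn_integral_cmult) (auto simp: ennreal_power[symmetric])
  finally show ?thesis .
qed

text \<open>With \<open>m\<close> the midpoint of \<open>x\<close> and \<open>y\<close>, \<open>\<bar>b x - b y\<bar> \<le> \<bar>b x - b m\<bar> + \<bar>b m - b y\<bar>\<close>. For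
  fixed \<open>x\<close>, the change of variables from \<open>y\<close> to \<open>m\<close> costs a factor \<open>2\<^sup>n\<close> and makes every
  coordinate of \<open>x - m\<close> smaller than \<open>s/2\<close>, so that the pair lies in one of the \<open>2\<^sup>n\<close>
  subcubes.\<close>

lemma pair_osc_three_quarter:
  fixes b :: "real ^ 'n::finite \<Rightarrow> real"
  assumes [measurable]: "b \<in> borel_measurable borel" and s: "0 < s"
  shows "pair_osc lborel b (cube u s) \<le>
    2 ^ Suc CARD('n) * (\<Sum>S\<in>UNIV. pair_osc lborel b (cube (corner u (s / 4) S) (3 * s / 4)))"
proof -
  let ?P = "cube u s"
  let ?Q = "\<lambda>S. cube (corner u (s / 4) S) (3 * s / 4)"
  let ?m = "\<lambda>x y :: real ^ 'n. (1 / 2) *\<^sub>R (x + y)"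
  let ?K = "\<lambda>x y. ennreal \<bar>b x - b (?m x y)\<bar> * indicator ?P x * indicator ?P y"
  have half: "(\<integral>\<^sup>+x. (\<integral>\<^sup>+y. ?K x y \<partial>lborel) \<partial>lborel) \<le>
      2 ^ CARD('n) * (\<Sum>S\<in>UNIV. pair_osc lborel b (?Q S))"
  proof -
    have inner: "(\<integral>\<^sup>+y. ?K x y \<partial>lborel) \<le> 2 ^ CARD('n) * (\<Sum>S\<in>UNIV. (\<integral>\<^sup>+z\<in>?Q S. ennreal \<bar>b x - b z\<bar> \<partial>lborel) * indicator (?Q S) x)" for x
    proof -
      have pt: "?K x (2 *\<^sub>R z - x) \<le> (\<Sum>S\<in>UNIV. ennreal \<bar>b x - b z\<bar> * indicator (?Q S) z * indicator (?Q S) x)" for z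
      proof (cases "x \<in> ?P \<and> 2 *\<^sub>R z - x \<in> ?P")
        case True
        have "u $ i \<le> x $ i \<and> x $ i < u $ i + s \<and> u $ i \<le> 2 * z $ i - x $ i \<and> 2 * z $ i - x $ i < u $ i + s" for i
          using True by (auto simp: cube_def)
        then have "u $ i \<le> z $ i \<and> z $ i < u $ i + s \<and> \<bar>x $ i - z $ i\<bar> < s / 2" for i
          by (smt (verit) field_sum_of_halves)
        then obtain S0 where S0: "x \<in> ?Q S0" "z \<in> ?Q S0"
          using pair_in_three_quarter_cube[OF s, of x u z] True by (auto simp: cube_def)
        have "?m x (2 *\<^sub>R z - x) = z" by (simp add: algebra_simps)
        then have "?K x (2 *\<^sub>R z - x) = ennreal \<bar>b x - b z\<bar> * indicator (?Q S0) z * indicator (?Q S0) x"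
          using True S0 by simp
        also have "\<dots> \<le> (\<Sum>S\<in>UNIV. ennreal \<bar>b x - b z\<bar> * indicator (?Q S) z * indicator (?Q S) x)"
          by (rule member_le_sum) auto
        finally show ?thesis .
      next
        case False
        then show ?thesis by (auto simp: indicator_def)
      qed
      have "(\<integral>\<^sup>+y. ?K x y \<partial>lborel) = 2 ^ CARD('n) * (\<integral>\<^sup>+z. ?K x (2 *\<^sub>R z - x) \<partial>lborel)"
        by (rule nn_integral_midpoint) simp
      also have "\<dots> \<le> 2 ^ CARD('n) * (\<integral>\<^sup>+z. (\<Sum>S\<in>UNIV. ennreal \<bar>b x - b z\<bar> * indicator (?Q S) z * indicator (?Q S) x) \<partial>lborel)"
        by (intro mult_left_mono nn_integral_mono pt) auto
      also have "\<dots> = 2 ^ CARD('n) * (\<Sum>S\<in>UNIV. (\<integral>\<^sup>+z\<in>?Q S. ennreal \<bar>b x - b z\<bar> \<partial>lborel) * indicator (?Q S) x)"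
        by (subst nn_integral_sum) (auto simp: nn_integral_multc)
      finally show ?thesis .
    qed
    have "(\<integral>\<^sup>+x. (\<integral>\<^sup>+y. ?K x y \<partial>lborel) \<partial>lborel) \<le>
       (\<integral>\<^sup>+x. 2 ^ CARD('n) * (\<Sum>S\<in>UNIV. (\<integral>\<^sup>+z\<in>?Q S. ennreal \<bar>b x - b z\<bar> \<partial>lborel) * indicator (?Q S) x) \<partial>lborel)"
      by (intro nn_integral_mono inner)
    also have "\<dots> = 2 ^ CARD('n) * (\<Sum>S\<in>UNIV. pair_osc lborel b (?Q S))"
      unfolding pair_osc_def
      by (simp add: nn_integral_cmult nn_integral_sum del: sum_mult_indicator)
    finally show ?thesis .
  qed
  have "pair_osc lborel b ?P = (\<integral>\<^sup>+x. (\<integral>\<^sup>+y. ennreal \<bar>b x - b y\<bar> * indicator ?P x * indicator ?P y \<partial>lborel) \<partial>lborel)"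
    unfolding pair_osc_def by (subst nn_integral_multc[symmetric]; simp add: mult_ac)
  also have "\<dots> \<le> (\<integral>\<^sup>+x. (\<integral>\<^sup>+y. ?K x y + ?K y x \<partial>lborel) \<partial>lborel)"
  proof (intro nn_integral_mono)
    fix x y
    have "\<bar>b x - b y\<bar> \<le> \<bar>b x - b (?m x y)\<bar> + \<bar>b y - b (?m y x)\<bar>" by (simp add: add.commute)
    then have "ennreal \<bar>b x - b y\<bar> \<le> ennreal \<bar>b x - b (?m x y)\<bar> + ennreal \<bar>b y - b (?m y x)\<bar>"
      by (simp add: ennreal_plus[symmetric] ennreal_leI del: ennreal_plus)
    then show "ennreal \<bar>b x - b y\<bar> * indicator ?P x * indicator ?P y \<le> ?K x y + ?K y x"
      by (auto simp: indicator_def)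
  qed
  also have "\<dots> = (\<integral>\<^sup>+x. (\<integral>\<^sup>+y. ?K x y \<partial>lborel) \<partial>lborel) + (\<integral>\<^sup>+x. (\<integral>\<^sup>+y. ?K y x \<partial>lborel) \<partial>lborel)"
    by (simp add: nn_integral_add)
  also have "(\<integral>\<^sup>+x. (\<integral>\<^sup>+y. ?K y x \<partial>lborel) \<partial>lborel) = (\<integral>\<^sup>+y. (\<integral>\<^sup>+x. ?K y x \<partial>lborel) \<partial>lborel)"
    by (rule lborel_pair.Fubini') measurable
  also have "(\<integral>\<^sup>+x. (\<integral>\<^sup>+y. ?K x y \<partial>lborel) \<partial>lborel) + (\<integral>\<^sup>+y. (\<integral>\<^sup>+x. ?K y x \<partial>lborel) \<partial>lborel)
      \<le> 2 ^ CARD('n) * (\<Sum>S\<in>UNIV. pair_osc lborel b (?Q S)) + 2 ^ CARD('n) * (\<Sum>S\<in>UNIV. pair_osc lborel b (?Q S))"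
    by (intro add_mono half)
  finally show ?thesis by (simp add: mult_2 [symmetric] mult.assoc)
qed

text \<open>Each of the \<open>m\<close> steps multiplies by \<open>2\<^bsup>n+1\<^esup>\<close> from the midpoint argument and by the
  number \<open>2\<^sup>n\<close> of subcubes.\<close>

lemma pair_osc_descent:
  fixes b :: "real ^ 'n::finite \<Rightarrow> real"
  assumes [measurable]: "b \<in> borel_measurable borel" and "0 < s"
    and "\<And>v. cube v ((3 / 4) ^ m * s) \<subseteq> cube u s \<Longrightarrow>
      pair_osc lborel b (cube v ((3 / 4) ^ m * s)) \<le> X"
  shows "pair_osc lborel b (cube u s) \<le> (2 ^ Suc (2 * CARD('n))) ^ m * X"
  using assms(2,3)
proof (induction m arbitrary: u s)
  case 0
  then show ?case by simp
next
  case (Suc m)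
  have "pair_osc lborel b (cube (corner u (s / 4) S) (3 * s / 4)) \<le> (2 ^ Suc (2 * CARD('n))) ^ m * X" for S
  proof (rule Suc.IH)
    show "0 < 3 * s / 4" using Suc by simp
    fix v assume "cube v ((3 / 4) ^ m * (3 * s / 4)) \<subseteq> cube (corner u (s / 4) S) (3 * s / 4)"
    moreover have "cube (corner u (s / 4) S) (3 * s / 4) \<subseteq> cube u s"
      using Suc.prems(1) by (intro cube_corner_subset) auto
    moreover have "(3 / 4) ^ m * (3 * s / 4) = (3 / 4) ^ Suc m * s" by simp
    ultimately show "pair_osc lborel b (cube v ((3 / 4) ^ m * (3 * s / 4))) \<le> X"
      using Suc.prems(2) by (metis subset_trans)
  qed
  then have "(\<Sum>S\<in>UNIV. pair_osc lborel b (cube (corner u (s / 4) S) (3 * s / 4))) \<le>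
      (\<Sum>S\<in>(UNIV::'n set set). (2 ^ Suc (2 * CARD('n))) ^ m * X)"
    by (intro sum_mono)
  also have "\<dots> = 2 ^ CARD('n) * ((2 ^ Suc (2 * CARD('n))) ^ m * X)"
    by (simp add: card_set_UNIV)
  finally have "2 ^ Suc CARD('n) * (\<Sum>S\<in>UNIV. pair_osc lborel b (cube (corner u (s / 4) S) (3 * s / 4))) \<le>
      2 ^ Suc CARD('n) * (2 ^ CARD('n) * ((2 ^ Suc (2 * CARD('n))) ^ m * X))"
    by (intro mult_left_mono) auto
  also have "\<dots> = (2 ^ Suc CARD('n) * 2 ^ CARD('n)) * (2 ^ Suc (2 * CARD('n))) ^ m * X"
    by (simp only: mult.assoc)
  also have "2 ^ Suc CARD('n) * 2 ^ CARD('n) = (2 ^ Suc (2 * CARD('n)) :: ennreal)"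
    by (simp only: power_add[symmetric]) (simp add: mult_2)
  also have "2 ^ Suc (2 * CARD('n)) * (2 ^ Suc (2 * CARD('n))) ^ m = ((2 ^ Suc (2 * CARD('n))) ^ Suc m :: ennreal)"
    by (simp only: power_Suc)
  finally show ?case using pair_osc_three_quarter[OF assms(1) Suc.prems(1), of u] by (rule order_trans[rotated])
qed

section \<open>The Gauss measure at the admissible scale\<close>

definition gauss_density :: "real ^ 'n::finite \<Rightarrow> real" where
  "gauss_density x = pi powr (- real CARD('n) / 2) * exp (- (norm x)\<^sup>2)"

lemma gauss_density_pos: "0 < gauss_density x"
  by (simp add: gauss_density_def)

lemma gauss_density_borel [measurable]: "gauss_density \<in> borel_measurable borel"
  unfolding gauss_density_def by measurable

lemma gauss_measure_eq: "gauss_measure = density lborel (\<lambda>x. ennreal (gauss_density x))"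
  by (simp add: gauss_measure_def gauss_density_def)

lemma sets_gauss [simp, measurable_cong]: "sets gauss_measure = sets borel"
  by (simp add: gauss_measure_def)

lemma space_gauss [simp]: "space gauss_measure = UNIV"
  by (simp add: gauss_measure_def)

lemma borel_measurable_gauss [simp]: "borel_measurable gauss_measure = borel_measurable borel"
  by (rule measurable_cong_sets) auto

lemma sigma_finite_gauss: "sigma_finite_measure (gauss_measure :: (real ^ 'n::finite) measure)"
  unfolding gauss_measure_eq
  by (subst sigma_finite_measure.sigma_finite_iff_density_finite[OF sigma_finite_lborel]) auto

interpretation gauss: sigma_finite_measure "gauss_measure :: (real ^ 'n::finite) measure"
  by (rule sigma_finite_gauss)

lemma nn_integral_gauss:
  assumes [measurable]: "f \<in> borel_measurable borel"
  shows "(\<integral>\<^sup>+x. f x \<partial>gauss_measure) = (\<integral>\<^sup>+x. ennreal (gauss_density x) * f x \<partial>lborel)"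
  unfolding gauss_measure_eq by (subst nn_integral_density) auto

lemma AE_gauss_iff: "(AE x in gauss_measure. P x) \<longleftrightarrow> (AE x in lborel. P x)"
  unfolding gauss_measure_eq
  by (subst AE_density) (auto simp: gauss_density_pos intro!: AE_cong)

lemma emeasure_gauss_le:
  assumes "A \<in> sets borel" "\<And>x. x \<in> A \<Longrightarrow> gauss_density x \<le> h" "0 \<le> h"
  shows "emeasure gauss_measure A \<le> ennreal h * emeasure lborel A"
  using assms unfolding gauss_measure_eq
  by (subst emeasure_density) (auto simp flip: nn_integral_cmult_indicator
      intro!: nn_integral_mono ennreal_leI simp: indicator_def)

lemma emeasure_gauss_ge:
  assumes "A \<in> sets borel" "\<And>x. x \<in> A \<Longrightarrow> l \<le> gauss_density x"
  shows "ennreal l * emeasure lborel A \<le> emeasure gauss_measure A"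
  using assms unfolding gauss_measure_eq
  by (subst emeasure_density) (auto simp flip: nn_integral_cmult_indicator
      intro!: nn_integral_mono ennreal_leI simp: indicator_def)

lemma nn_integral_gauss_le:
  assumes [measurable]: "f \<in> borel_measurable borel" "A \<in> sets borel"
    and h: "\<And>x. x \<in> A \<Longrightarrow> gauss_density x \<le> h"
  shows "(\<integral>\<^sup>+x\<in>A. f x \<partial>gauss_measure) \<le> ennreal h * (\<integral>\<^sup>+x\<in>A. f x \<partial>lborel)"
proof -
  have "ennreal (gauss_density x) * (f x * indicator A x) \<le> ennreal h * (f x * indicator A x)" for x
    using h[of x] by (cases "x \<in> A") (auto intro!: mult_right_mono ennreal_leI)
  then have "(\<integral>\<^sup>+x\<in>A. f x \<partial>gauss_measure) \<le> (\<integral>\<^sup>+x. ennreal h * (f x * indicator A x) \<partial>lborel)"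
    by (simp add: nn_integral_gauss nn_integral_mono)
  then show ?thesis by (simp add: nn_integral_cmult)
qed

lemma nn_integral_lborel_le_gauss:
  assumes [measurable]: "f \<in> borel_measurable borel" "A \<in> sets borel"
    and l: "0 < l" "\<And>x. x \<in> A \<Longrightarrow> l \<le> gauss_density x"
  shows "(\<integral>\<^sup>+x\<in>A. f x \<partial>lborel) \<le> ennreal (1 / l) * (\<integral>\<^sup>+x\<in>A. f x \<partial>gauss_measure)"
proof -
  have "f x * indicator A x \<le> ennreal (1 / l) * (ennreal (gauss_density x) * (f x * indicator A x))" for x
  proof (cases "x \<in> A")
    case True
    have "1 \<le> 1 / l * gauss_density x" using l(1) l(2)[OF True] by (simp add: field_simps)
    then have "1 \<le> ennreal (1 / l) * ennreal (gauss_density x)"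
      using l(1) gauss_density_pos[of x]
      by (simp add: ennreal_mult[symmetric] less_imp_le)
    then have "1 * f x \<le> (ennreal (1 / l) * ennreal (gauss_density x)) * f x"
      by (rule mult_right_mono) simp
    then show ?thesis using True by (simp add: mult_ac)
  qed simp
  then have "(\<integral>\<^sup>+x\<in>A. f x \<partial>lborel) \<le>
      (\<integral>\<^sup>+x. ennreal (1 / l) * (ennreal (gauss_density x) * (f x * indicator A x)) \<partial>lborel)"
    by (intro nn_integral_mono)
  then show ?thesis by (simp add: nn_integral_cmult nn_integral_gauss)
qed

lemma pair_osc_mono:
  "A \<subseteq> B \<Longrightarrow> pair_osc M b A \<le> pair_osc M b B"
  unfolding pair_osc_def by (intro nn_integral_mono mult_mono) (auto simp: indicator_def)

lemma borel_inner_integral_gauss [measurable]: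
  fixes b :: "real ^ 'n::finite \<Rightarrow> real"
  assumes [measurable]: "b \<in> borel_measurable borel" "f \<in> borel_measurable borel" "A \<in> sets borel"
  shows "(\<lambda>x. \<integral>\<^sup>+y\<in>A. ennreal (\<bar>b x - b y\<bar> * f y) \<partial>gauss_measure) \<in> borel_measurable borel"
    "(\<lambda>x. \<integral>\<^sup>+y\<in>A. ennreal \<bar>b x - b y\<bar> \<partial>gauss_measure) \<in> borel_measurable borel"
  by (rule gauss.borel_measurable_nn_integral; measurable)+

lemma double_integral_gauss_le:
  fixes F :: "real ^ 'n::finite \<Rightarrow> real ^ 'n \<Rightarrow> ennreal"
  assumes F [measurable]: "case_prod F \<in> borel_measurable (borel \<Otimes>\<^sub>M borel)" "A \<in> sets borel"
    and h: "\<And>x. x \<in> A \<Longrightarrow> gauss_density x \<le> h" "0 \<le> h"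
  shows "(\<integral>\<^sup>+x\<in>A. (\<integral>\<^sup>+y\<in>A. F x y \<partial>gauss_measure) \<partial>gauss_measure) \<le>
    ennreal (h\<^sup>2) * (\<integral>\<^sup>+x\<in>A. (\<integral>\<^sup>+y\<in>A. F x y \<partial>lborel) \<partial>lborel)"
proof -
  have [measurable]: "(\<lambda>x. \<integral>\<^sup>+y\<in>A. F x y \<partial>gauss_measure) \<in> borel_measurable borel"
    by (rule gauss.borel_measurable_nn_integral) measurable
  have [measurable]: "(\<lambda>x. \<integral>\<^sup>+y\<in>A. F x y \<partial>lborel) \<in> borel_measurable borel"
    by (rule lborel.borel_measurable_nn_integral) measurable
  have [measurable]: "F x \<in> borel_measurable borel" for x
    using measurable_Pair2[OF F(1), of x] by simp
  have "(\<integral>\<^sup>+x\<in>A. (\<integral>\<^sup>+y\<in>A. F x y \<partial>gauss_measure) \<partial>gauss_measure)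
      \<le> ennreal h * (\<integral>\<^sup>+x\<in>A. (\<integral>\<^sup>+y\<in>A. F x y \<partial>gauss_measure) \<partial>lborel)"
    by (rule nn_integral_gauss_le) (auto intro: h)
  also have "\<dots> \<le> ennreal h * (\<integral>\<^sup>+x\<in>A. (ennreal h * (\<integral>\<^sup>+y\<in>A. F x y \<partial>lborel)) \<partial>lborel)"
    by (intro mult_left_mono nn_integral_mono mult_right_mono nn_integral_gauss_le) (auto intro: h)
  also have "\<dots> = ennreal (h\<^sup>2) * (\<integral>\<^sup>+x\<in>A. (\<integral>\<^sup>+y\<in>A. F x y \<partial>lborel) \<partial>lborel)"
    using h(2) by (simp add: nn_integral_cmult mult.assoc power2_eq_square ennreal_mult)
  finally show ?thesis .
qed

lemma pair_osc_gauss_le: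
  fixes b :: "real ^ 'n::finite \<Rightarrow> real"
  assumes [measurable]: "b \<in> borel_measurable borel" "A \<in> sets borel"
    and h: "\<And>x. x \<in> A \<Longrightarrow> gauss_density x \<le> h" "0 \<le> h"
  shows "pair_osc gauss_measure b A \<le> ennreal (h\<^sup>2) * pair_osc lborel b A"
  unfolding pair_osc_def by (rule double_integral_gauss_le[OF _ _ h]) auto

lemma pair_osc_lborel_le:
  fixes b :: "real ^ 'n::finite \<Rightarrow> real"
  assumes [measurable]: "b \<in> borel_measurable borel" "A \<in> sets borel"
    and l: "0 < l" "\<And>x. x \<in> A \<Longrightarrow> l \<le> gauss_density x"
  shows "pair_osc lborel b A \<le> ennreal ((1 / l)\<^sup>2) * pair_osc gauss_measure b A"
proof -
  have "pair_osc lborel b A \<le> (\<integral>\<^sup>+x\<in>A. (ennreal (1 / l) * (\<integral>\<^sup>+y\<in>A. ennreal \<bar>b x - b y\<bar> \<partial>gauss_measure)) \<partial>lborel)"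
    unfolding pair_osc_def
    by (intro nn_integral_mono mult_right_mono nn_integral_lborel_le_gauss) (auto intro: l)
  also have "\<dots> = ennreal (1 / l) * (\<integral>\<^sup>+x\<in>A. (\<integral>\<^sup>+y\<in>A. ennreal \<bar>b x - b y\<bar> \<partial>gauss_measure) \<partial>lborel)"
    by (simp add: nn_integral_cmult mult.assoc)
  also have "\<dots> \<le> ennreal (1 / l) * (ennreal (1 / l) * pair_osc gauss_measure b A)"
    unfolding pair_osc_def
    by (intro mult_left_mono nn_integral_lborel_le_gauss) (auto intro: l)
  also have "\<dots> = ennreal ((1 / l)\<^sup>2) * pair_osc gauss_measure b A"
    using l(1) by (simp add: mult.assoc[symmetric] power2_eq_square ennreal_mult[symmetric])
  finally show ?thesis .
qed

text \<open>The exponents differ by \<open>\<bar>norm x - norm u\<bar> * (norm x + norm u) \<le> R * (2 * norm u + R)\<close>.\<close>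

lemma gauss_density_near:
  fixes u x :: "real ^ 'n::finite"
  assumes "norm (x - u) \<le> R" "R * (2 * norm u + R) \<le> D"
  shows "exp (- D) * gauss_density u \<le> gauss_density x" "gauss_density x \<le> exp D * gauss_density u"
proof -
  have "0 \<le> R" using assms(1) norm_ge_zero by (rule order_trans[rotated])
  have "norm x \<le> norm u + R" using assms(1) norm_triangle_sub[of x u] by simp
  have "\<bar>norm x - norm u\<bar> \<le> R" using assms(1) norm_triangle_ineq3[of x u] by simp
  have "\<bar>(norm x)\<^sup>2 - (norm u)\<^sup>2\<bar> = \<bar>norm x - norm u\<bar> * (norm x + norm u)"
    by (simp add: power2_eq_square square_diff_square_factored abs_mult mult.commute)
  also have "\<dots> \<le> R * (2 * norm u + R)"
    using \<open>\<bar>norm x - norm u\<bar> \<le> R\<close> \<open>norm x \<le> norm u + R\<close> \<open>0 \<le> R\<close> by (intro mult_mono) auto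
  finally have "\<bar>(norm x)\<^sup>2 - (norm u)\<^sup>2\<bar> \<le> D" using assms(2) by simp
  then have e: "exp (- D - (norm u)\<^sup>2) \<le> exp (- (norm x)\<^sup>2)" "exp (- (norm x)\<^sup>2) \<le> exp (D - (norm u)\<^sup>2)"
    by auto
  then have "pi powr (- real CARD('n) / 2) * exp (- D - (norm u)\<^sup>2) \<le> gauss_density x"
    "gauss_density x \<le> pi powr (- real CARD('n) / 2) * exp (D - (norm u)\<^sup>2)"
    unfolding gauss_density_def by (intro mult_left_mono; simp)+
  then show "exp (- D) * gauss_density u \<le> gauss_density x" "gauss_density x \<le> exp D * gauss_density u"
    by (auto simp: gauss_density_def exp_diff exp_minus field_simps)
qed

text \<open>The size condition for admissible balls, imposed at the corner instead of the centre
  and with an arbitrary constant.\<close>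

definition local_cube :: "real \<Rightarrow> real ^ 'n::finite \<Rightarrow> real \<Rightarrow> bool" where
  "local_cube A u s \<longleftrightarrow> 0 < s \<and> s \<le> A \<and> s * norm u \<le> A"

text \<open>A bound, in either order, for the quotient of the Gauss density at a point near a local
  cube and at its corner. The type argument only carries the dimension.\<close>

definition local_ratio :: "'n::finite itself \<Rightarrow> real \<Rightarrow> real" where
  "local_ratio _ A = exp (6 * real CARD('n) * A + 9 * (real CARD('n))\<^sup>2 * A\<^sup>2)"

lemma local_ratio_ge_1: "0 \<le> A \<Longrightarrow> 1 \<le> local_ratio TYPE('n::finite) A"
  by (simp add: local_ratio_def)

text \<open>The points at distance \<open>3 n s\<close> include the balls of radius \<open>2 n t\<close>, \<open>t \<le> s\<close>, around
  points of the cube, which have to be compared with subcubes of side \<open>t\<close>.\<close>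

lemma gauss_density_local:
  fixes u x :: "real ^ 'n::finite"
  assumes "local_cube A u s" "norm (x - u) \<le> 3 * real CARD('n) * s"
  shows "gauss_density u / local_ratio TYPE('n) A \<le> gauss_density x"
    "gauss_density x \<le> local_ratio TYPE('n) A * gauss_density u"
proof -
  let ?n = "real CARD('n)"
  have A: "0 < s" "s \<le> A" "s * norm u \<le> A" using assms by (auto simp: local_cube_def)
  have "s * s \<le> A * A" using A by (intro mult_mono) auto
  have "3 * ?n * s * (2 * norm u + 3 * ?n * s) = 6 * ?n * (s * norm u) + 9 * ?n\<^sup>2 * (s * s)"
    by (simp add: algebra_simps power2_eq_square)
  also have "\<dots> \<le> 6 * ?n * A + 9 * ?n\<^sup>2 * (A * A)"
    using A \<open>s * s \<le> A * A\<close> by (intro add_mono mult_left_mono) auto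
  finally have "3 * ?n * s * (2 * norm u + 3 * ?n * s) \<le> 6 * ?n * A + 9 * ?n\<^sup>2 * A\<^sup>2"
    by (simp add: power2_eq_square)
  moreover have "exp (- (6 * ?n * A + 9 * ?n\<^sup>2 * A\<^sup>2)) = 1 / local_ratio TYPE('n) A"
    by (simp add: local_ratio_def exp_minus inverse_eq_divide del: minus_add_distrib)
  ultimately
  show "gauss_density u / local_ratio TYPE('n) A \<le> gauss_density x"
    "gauss_density x \<le> local_ratio TYPE('n) A * gauss_density u"
    using gauss_density_near[OF assms(2), of "6 * ?n * A + 9 * ?n\<^sup>2 * A\<^sup>2"]
    by (simp_all add: local_ratio_def[of "TYPE('n)"])
qed

lemma gauss_density_cube:
  fixes u x :: "real ^ 'n::finite"
  assumes "local_cube A u s" "x \<in> cube u s"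
  shows "gauss_density u / local_ratio TYPE('n) A \<le> gauss_density x"
    "gauss_density x \<le> local_ratio TYPE('n) A * gauss_density u"
proof -
  have "0 < s" using assms by (simp add: local_cube_def)
  have "norm (x - u) \<le> real CARD('n) * s" using assms by (intro norm_diff_cube_le)
  also have "\<dots> \<le> 3 * real CARD('n) * s" using \<open>0 < s\<close> by simp
  finally show "gauss_density u / local_ratio TYPE('n) A \<le> gauss_density x"
    "gauss_density x \<le> local_ratio TYPE('n) A * gauss_density u"
    using gauss_density_local[OF assms(1)] by auto
qed

lemma emeasure_gauss_cube:
  fixes u :: "real ^ 'n::finite"
  assumes "local_cube A u s"
  shows "ennreal (gauss_density u / local_ratio TYPE('n) A * s ^ CARD('n)) \<le> emeasure gauss_measure (cube u s)"
    "emeasure gauss_measure (cube u s) \<le> ennreal (local_ratio TYPE('n) A * gauss_density u * s ^ CARD('n))"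
proof -
  have s: "0 < s" "0 < local_ratio TYPE('n) A" "0 \<le> gauss_density u"
    using assms gauss_density_pos[of u] by (auto simp: local_cube_def local_ratio_def)
  show "ennreal (gauss_density u / local_ratio TYPE('n) A * s ^ CARD('n)) \<le> emeasure gauss_measure (cube u s)"
    using emeasure_gauss_ge[of "cube u s", OF _ gauss_density_cube(1)[OF assms]] s
    by (simp add: emeasure_cube ennreal_mult[symmetric])
  show "emeasure gauss_measure (cube u s) \<le> ennreal (local_ratio TYPE('n) A * gauss_density u * s ^ CARD('n))"
    using emeasure_gauss_le[of "cube u s", OF _ gauss_density_cube(2)[OF assms]] s
    by (simp add: emeasure_cube ennreal_mult[symmetric])
qed

text \<open>Multiplying out the minimum also removes the special value at the origin.\<close>

lemma le_admissible_fun_iff: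
  assumes "0 < a" "0 < r"
  shows "r \<le> a * admissible_fun c \<longleftrightarrow> r \<le> a \<and> r * norm c \<le> a"
proof (cases "norm c \<le> 1")
  case True
  have "r \<le> a \<Longrightarrow> r * norm c \<le> a"
    using mult_left_mono[OF True, of r] assms by linarith
  then show ?thesis using True by (auto simp: admissible_fun_def min_def field_simps)
next
  case False
  have "r * norm c \<le> a \<Longrightarrow> r \<le> a"
    using mult_left_mono[of 1 "norm c" r] False assms by linarith
  then show ?thesis using False by (auto simp: admissible_fun_def min_def field_simps)
qed

lemma admissible_ballsE:
  assumes "B \<in> admissible_balls a" "0 < a"
  obtains c r where "B = ball c r" "0 < r" "r \<le> a" "r * norm c \<le> a"
  using assms by (auto simp: admissible_balls_def le_admissible_fun_iff)

lemma admissible_ballsI: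
  "0 < a \<Longrightarrow> 0 < r \<Longrightarrow> r \<le> a \<Longrightarrow> r * norm c \<le> a \<Longrightarrow> ball c r \<in> admissible_balls a"
  unfolding admissible_balls_def using le_admissible_fun_iff by blast

lemma cube_subset_ball:
  fixes c :: "real ^ 'n::finite"
  assumes "0 < s" "real CARD('n) * s < r"
  shows "cube c s \<subseteq> ball c r"
  using norm_diff_cube_le[of _ c s] assms by (force simp: dist_norm norm_minus_commute)

lemma ball_subset_cube:
  fixes c :: "real ^ 'n::finite"
  shows "ball c r \<subseteq> cube (\<chi> i. c $ i - r) (2 * r)"
proof
  fix x assume "x \<in> ball c r"
  then have "norm (x - c) < r" by (simp add: dist_norm norm_minus_commute)
  then have "\<bar>x $ i - c $ i\<bar> < r" for i
    using component_le_norm_cart[of "x - c" i] by simp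
  then show "x \<in> cube (\<chi> i. c $ i - r) (2 * r)"
    unfolding cube_def by (auto simp: abs_less_iff) (smt (verit, best))+
qed

text \<open>Passing from the centre of an admissible ball to the corner of a cube of comparable
  size changes the constant in the size condition by a quadratic term.\<close>

lemma local_cube_of_ball:
  fixes u c :: "real ^ 'n::finite"
  assumes "0 < r" "r \<le> a" "r * norm c \<le> a" "c \<in> cube u s" "0 < s" "s \<le> 6 * r"
  shows "local_cube (6 * a + 36 * real CARD('n) * a\<^sup>2) u s"
proof -
  have "norm u \<le> norm c + norm (c - u)"
    by (metis norm_minus_commute norm_triangle_sub)
  also have "\<dots> \<le> norm c + real CARD('n) * s"
    using norm_diff_cube_le[OF assms(4)] by simp
  also have "\<dots> \<le> norm c + real CARD('n) * (6 * r)"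
    using assms by (intro add_left_mono mult_left_mono) auto
  finally have "s * norm u \<le> (6 * r) * (norm c + real CARD('n) * (6 * r))"
    using assms by (intro mult_mono) auto
  also have "\<dots> = 6 * (r * norm c) + 36 * real CARD('n) * (r * r)" by (simp add: algebra_simps)
  also have "\<dots> \<le> 6 * a + 36 * real CARD('n) * (a * a)"
    using assms by (intro add_mono mult_left_mono mult_mono) auto
  finally show ?thesis using assms
    by (auto simp: local_cube_def power2_eq_square intro: order_trans[of _ "6 * a"])
qed

text \<open>The ball contains a cube of side \<open>s / (12 n)\<close> cornered at its centre, on which the
  density is at least a fixed fraction of that at \<open>u\<close>.\<close>

lemma emeasure_gauss_ball_ge:
  fixes u c :: "real ^ 'n::finite"
  assumes "local_cube A u s" "ball c r \<subseteq> cube u s" "0 < r" "s \<le> 6 * r"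
  shows "ennreal (gauss_density u / local_ratio TYPE('n) A * (s / (12 * real CARD('n))) ^ CARD('n))
    \<le> emeasure gauss_measure (ball c r)"
proof -
  let ?n = "real CARD('n)"
  have s: "0 < s" "0 < local_ratio TYPE('n) A" "0 \<le> gauss_density u"
    using assms gauss_density_pos[of u] by (auto simp: local_cube_def local_ratio_def)
  have sub: "cube c (s / (12 * ?n)) \<subseteq> ball c r"
    using s assms by (intro cube_subset_ball) auto
  have "ennreal (gauss_density u / local_ratio TYPE('n) A * (s / (12 * ?n)) ^ CARD('n)) =
      ennreal (gauss_density u / local_ratio TYPE('n) A) * emeasure lborel (cube c (s / (12 * ?n)))"
    using s by (simp add: emeasure_cube ennreal_mult[symmetric])
  also have "\<dots> \<le> emeasure gauss_measure (cube c (s / (12 * ?n)))"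
    using gauss_density_cube(1)[OF assms(1)] sub assms(2) by (intro emeasure_gauss_ge) auto
  also have "\<dots> \<le> emeasure gauss_measure (ball c r)"
    using sub by (intro emeasure_mono) auto
  finally show ?thesis .
qed

lemma emeasure_gauss_bounded_finite:
  fixes A :: "(real ^ 'n::finite) set"
  assumes "bounded A" "A \<in> sets borel"
  shows "emeasure gauss_measure A < top"
proof -
  have "emeasure gauss_measure A \<le> ennreal (pi powr (- real CARD('n) / 2)) * emeasure lborel A"
    using assms by (intro emeasure_gauss_le) (auto simp: gauss_density_def)
  also have "\<dots> < top"
    using emeasure_bounded_finite[OF assms(1)] by (simp add: ennreal_mult_less_top)
  finally show ?thesis .
qed

lemma emeasure_gauss_ball:
  fixes c :: "real ^ 'n::finite"
  shows "emeasure gauss_measure (ball c r) = ennreal (measure gauss_measure (ball c r))"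
  using emeasure_gauss_bounded_finite[of "ball c r"] by (intro emeasure_eq_ennreal_measure) auto

lemma measure_gauss_ball_pos:
  fixes c :: "real ^ 'n::finite"
  assumes "0 < r"
  shows "0 < measure gauss_measure (ball c r)"
proof -
  have "emeasure gauss_measure (ball c r) \<noteq> 0"
  proof
    assume "emeasure gauss_measure (ball c r) = 0"
    then have "AE x in gauss_measure. x \<notin> ball c r"
      by (intro AE_not_in null_setsI) auto
    then have "AE x in lborel. x \<notin> ball c r" by (simp only: AE_gauss_iff)
    then have "emeasure lborel (ball c r) = 0"
      using AE_iff_measurable[of "ball c r" lborel "\<lambda>x. x \<notin> ball c r"] by (simp add: ball_def)
    then show False using content_ball_pos[OF assms, of c] by (simp add: measure_def)
  qed
  then show ?thesis
    by (simp add: emeasure_gauss_ball zero_less_measure_iff)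
qed

section \<open>Independence of the aperture\<close>

lemma ennreal_mult_square:
  "0 \<le> c \<Longrightarrow> 0 \<le> t \<Longrightarrow> ennreal c * (\<kappa> * (ennreal t)\<^sup>2) = ennreal (c * t\<^sup>2) * \<kappa>"
  by (simp add: ennreal_power ennreal_mult mult_ac)

text \<open>Descent to scale \<open>(3/4)\<^sup>m\<close> with \<open>m\<close> depending only on the two constants: at that scale
  every subcube lies in an admissible ball of the given aperture, and the masses of the
  two are comparable.\<close>

lemma pair_osc_cube_of_balls:
  fixes a' A :: real
  assumes "0 < a'" "0 < A"
  obtains C where "0 < C"
    "\<And>(b :: real ^ 'n::finite \<Rightarrow> real) \<kappa> u s. \<lbrakk>b \<in> borel_measurable borel;
      \<And>B. B \<in> admissible_balls a' \<Longrightarrow> pair_osc gauss_measure b B \<le> \<kappa> * (emeasure gauss_measure B)\<^sup>2;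
      local_cube A u s\<rbrakk> \<Longrightarrow> pair_osc lborel b (cube u s) \<le> ennreal C * \<kappa> * (ennreal (s ^ CARD('n)))\<^sup>2"
proof -
  let ?n = "real CARD('n)"
  define K where "K = local_ratio TYPE('n) A"
  have K: "1 \<le> K" unfolding K_def using assms by (intro local_ratio_ge_1) simp
  define A' where "A' = A + ?n * A\<^sup>2"
  have A': "0 < A'" "A \<le> A'" using assms by (auto simp: A'_def intro: add_pos_nonneg)
  \<comment> \<open>A subcube has its corner \<open>v\<close> in the given cube, where \<open>s * norm v \<le> A'\<close>; the ball
    around a subcube of side \<open>t\<close> has radius \<open>2 n t\<close>.\<close>
  obtain m where m: "(3 / 4 :: real) ^ m < a' / (2 * ?n * A')"
    using real_arch_pow_inv[of "a' / (2 * ?n * A')" "3 / 4"] assms A' by auto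
  define C where "C = (2 ^ Suc (2 * CARD('n))) ^ m * (K ^ 4 * ((4 * ?n) ^ CARD('n))\<^sup>2)"
  have "0 < C" using K by (simp add: C_def)
  have main: "pair_osc lborel b (cube u s) \<le> ennreal C * \<kappa> * (ennreal (s ^ CARD('n)))\<^sup>2"
    if b [measurable]: "b \<in> borel_measurable borel"
      and \<kappa>: "\<And>B. B \<in> admissible_balls a' \<Longrightarrow> pair_osc gauss_measure b B \<le> \<kappa> * (emeasure gauss_measure B)\<^sup>2"
      and g: "local_cube A u s" for b :: "real ^ 'n \<Rightarrow> real" and \<kappa> u s
  proof -
    have s: "0 < s" "s \<le> A" "s * norm u \<le> A" using g by (auto simp: local_cube_def)
    define w where "w = gauss_density u"
    have w: "0 < w" by (simp add: w_def gauss_density_pos)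
    let ?t = "(3 / 4) ^ m * s"
    have t: "0 < ?t" "?t \<le> s" using s by (auto simp: power_le_one mult_left_le_one_le)
    have step: "pair_osc lborel b (cube v ?t) \<le> ennreal (K ^ 4 * ((4 * ?n) ^ CARD('n))\<^sup>2 * (s ^ CARD('n))\<^sup>2) * \<kappa>"
      if sub: "cube v ?t \<subseteq> cube u s" for v
    proof -
      define \<rho> where "\<rho> = 2 * ?n * ?t"
      have v: "v \<in> cube u s" using sub mem_cube_corner[OF t(1)] by blast
      have nv: "norm (v - u) \<le> ?n * s" using v by (rule norm_diff_cube_le)
      have rho: "0 < \<rho>" "\<rho> \<le> 2 * ?n * s" using t by (auto simp: \<rho>_def)
      have small: "2 * ?n * (3 / 4) ^ m * A' \<le> a'"
        using m A' by (simp add: field_simps)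
      have "norm v \<le> norm u + ?n * s" using nv norm_triangle_sub[of v u] by simp
      then have "s * norm v \<le> s * norm u + ?n * (s * s)"
        using s mult_left_mono[of "norm v" "norm u + ?n * s" s] by (simp add: algebra_simps)
      also have "\<dots> \<le> A'"
        unfolding A'_def power2_eq_square using s by (intro add_mono mult_left_mono mult_mono) auto
      finally have sv: "s * norm v \<le> A'" .
      have "\<rho> \<le> a'"
      proof -
        have "\<rho> = 2 * ?n * (3 / 4) ^ m * s" by (simp add: \<rho>_def)
        also have "\<dots> \<le> 2 * ?n * (3 / 4) ^ m * A'" using s A' by (intro mult_left_mono) auto
        finally show ?thesis using small by simp
      qed
      moreover have "\<rho> * norm v \<le> a'"
      proof -
        have "\<rho> * norm v = 2 * ?n * (3 / 4) ^ m * (s * norm v)" by (simp add: \<rho>_def)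
        also have "\<dots> \<le> 2 * ?n * (3 / 4) ^ m * A'" using sv by (intro mult_left_mono) auto
        finally show ?thesis using small by simp
      qed
      ultimately have adm: "ball v \<rho> \<in> admissible_balls a'"
        using rho assms by (intro admissible_ballsI) auto
      have cb: "cube v ?t \<subseteq> ball v \<rho>"
        using t by (intro cube_subset_ball) (auto simp: \<rho>_def)
      have up: "gauss_density x \<le> K * w" if "x \<in> ball v \<rho>" for x
      proof -
        have "norm (x - v) \<le> 2 * ?n * s" using that rho by (simp add: dist_norm norm_minus_commute)
        then have "norm (x - u) \<le> 3 * ?n * s"
          using nv norm_triangle_ineq[of "x - v" "v - u"] by simp
        then show ?thesis unfolding K_def w_def by (rule gauss_density_local(2)[OF g])
      qed
      have lo: "w / K \<le> gauss_density x" if "x \<in> cube v ?t" for x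
        unfolding K_def w_def using gauss_density_cube(1)[OF g] sub that by auto
      have eb: "emeasure gauss_measure (ball v \<rho>) \<le> ennreal (K * w * (4 * ?n * s) ^ CARD('n))"
      proof -
        have "emeasure gauss_measure (ball v \<rho>) \<le> ennreal (K * w) * emeasure lborel (ball v \<rho>)"
          using K w by (intro emeasure_gauss_le up) auto
        also have "emeasure lborel (ball v \<rho>) \<le> emeasure lborel (cube (\<chi> i. v $ i - \<rho>) (2 * \<rho>))"
          by (intro emeasure_mono ball_subset_cube) auto
        also have "\<dots> = ennreal ((2 * \<rho>) ^ CARD('n))" using rho by (intro emeasure_cube) auto
        also have "\<dots> \<le> ennreal ((4 * ?n * s) ^ CARD('n))"
          using rho by (intro ennreal_leI power_mono) linarith+
        finally show ?thesis using K w s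
          by (simp add: ennreal_mult[symmetric] mult_left_mono)
      qed
      have "pair_osc lborel b (cube v ?t) \<le> ennreal ((1 / (w / K))\<^sup>2) * pair_osc gauss_measure b (cube v ?t)"
        using w K by (intro pair_osc_lborel_le lo) auto
      also have "pair_osc gauss_measure b (cube v ?t) \<le> pair_osc gauss_measure b (ball v \<rho>)"
        by (rule pair_osc_mono[OF cb])
      also have "\<dots> \<le> \<kappa> * (emeasure gauss_measure (ball v \<rho>))\<^sup>2" by (rule \<kappa>[OF adm])
      also have "\<dots> \<le> \<kappa> * (ennreal (K * w * (4 * ?n * s) ^ CARD('n)))\<^sup>2"
        by (intro mult_left_mono power_mono eb) auto
      also have "ennreal ((1 / (w / K))\<^sup>2) * \<dots> =
          ennreal ((1 / (w / K))\<^sup>2 * (K * w * (4 * ?n * s) ^ CARD('n))\<^sup>2) * \<kappa>"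
        using K w s by (intro ennreal_mult_square) auto
      also have "(1 / (w / K))\<^sup>2 * (K * w * (4 * ?n * s) ^ CARD('n))\<^sup>2 = K ^ 4 * ((4 * ?n) ^ CARD('n))\<^sup>2 * (s ^ CARD('n))\<^sup>2"
        using K w by (simp add: power_mult_distrib field_simps power2_eq_square power4_eq_xxxx)
      finally show ?thesis by (simp add: mult_left_mono)
    qed
    have "pair_osc lborel b (cube u s) \<le>
        (2 ^ Suc (2 * CARD('n))) ^ m * (ennreal (K ^ 4 * ((4 * ?n) ^ CARD('n))\<^sup>2 * (s ^ CARD('n))\<^sup>2) * \<kappa>)"
      by (rule pair_osc_descent[OF b s(1) step])
    also have "(2 ^ Suc (2 * CARD('n))) ^ m = ennreal ((2 ^ Suc (2 * CARD('n))) ^ m)"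
      by (simp add: ennreal_power[symmetric] del: power_Suc)
    also have "ennreal ((2 ^ Suc (2 * CARD('n))) ^ m) * (ennreal (K ^ 4 * ((4 * ?n) ^ CARD('n))\<^sup>2 * (s ^ CARD('n))\<^sup>2) * \<kappa>)
       = ennreal C * \<kappa> * (ennreal (s ^ CARD('n)))\<^sup>2"
      using K s unfolding C_def
      by (simp add: ennreal_mult ennreal_power mult_ac del: power_Suc)
    finally show ?thesis .
  qed
  show ?thesis by (rule that[OF \<open>0 < C\<close> main])
qed

text \<open>A ball lies in the cube circumscribed about it, and that cube is local with a constant
  depending on \<open>a\<close>.\<close>

lemma pair_osc_change_aperture:
  fixes a' a :: real
  assumes "0 < a'" "0 < a"
  obtains C where "0 < C"
    "\<And>(b :: real ^ 'n::finite \<Rightarrow> real) \<kappa> B. \<lbrakk>b \<in> borel_measurable borel;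
      \<And>B. B \<in> admissible_balls a' \<Longrightarrow> pair_osc gauss_measure b B \<le> \<kappa> * (emeasure gauss_measure B)\<^sup>2;
      B \<in> admissible_balls a\<rbrakk> \<Longrightarrow> pair_osc gauss_measure b B \<le> ennreal C * \<kappa> * (emeasure gauss_measure B)\<^sup>2"
proof -
  let ?n = "real CARD('n)"
  define A where "A = 6 * a + 36 * ?n * a\<^sup>2"
  have A: "0 < A" unfolding A_def using assms by (intro add_pos_nonneg) auto
  define K where "K = local_ratio TYPE('n) A"
  have K: "1 \<le> K" unfolding K_def using A by (intro local_ratio_ge_1) simp
  obtain C0 where C0: "0 < C0"
    "\<And>(b :: real ^ 'n::finite \<Rightarrow> real) \<kappa> u s. \<lbrakk>b \<in> borel_measurable borel;
      \<And>B. B \<in> admissible_balls a' \<Longrightarrow> pair_osc gauss_measure b B \<le> \<kappa> * (emeasure gauss_measure B)\<^sup>2;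
      local_cube A u s\<rbrakk> \<Longrightarrow> pair_osc lborel b (cube u s) \<le> ennreal C0 * \<kappa> * (ennreal (s ^ CARD('n)))\<^sup>2"
    using pair_osc_cube_of_balls[OF assms(1) A, where 'n = 'n] by metis
  define T where "T = (12 * ?n) ^ CARD('n)"
  have T: "0 < T" by (simp add: T_def)
  define C where "C = K ^ 4 * T\<^sup>2 * C0"
  have "0 < C" using K C0(1) T by (simp add: C_def)
  have main: "pair_osc gauss_measure b B \<le> ennreal C * \<kappa> * (emeasure gauss_measure B)\<^sup>2"
    if b [measurable]: "b \<in> borel_measurable borel"
      and \<kappa>: "\<And>B. B \<in> admissible_balls a' \<Longrightarrow> pair_osc gauss_measure b B \<le> \<kappa> * (emeasure gauss_measure B)\<^sup>2"
      and B: "B \<in> admissible_balls a" for b :: "real ^ 'n \<Rightarrow> real" and \<kappa> B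
  proof -
    obtain c r where cr: "B = ball c r" "0 < r" "r \<le> a" "r * norm c \<le> a"
      using admissible_ballsE[OF B assms(2)] .
    define u where "u = (\<chi> i. c $ i - r)"
    define s where "s = 2 * r"
    have sub: "ball c r \<subseteq> cube u s" unfolding u_def s_def by (rule ball_subset_cube)
    have s: "0 < s" "s \<le> 6 * r" using cr by (auto simp: s_def)
    have "c \<in> cube u s" using sub cr by auto
    then have g: "local_cube A u s"
      unfolding A_def using cr s by (intro local_cube_of_ball) auto
    define w where "w = gauss_density u"
    have w: "0 < w" by (simp add: w_def gauss_density_pos)
    define N where "N = s ^ CARD('n)"
    have N: "0 < N" using s by (simp add: N_def)
    have eB: "ennreal (w / K * (N / T)) \<le> emeasure gauss_measure B"
      using emeasure_gauss_ball_ge[OF g sub cr(2) s(2)]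
      unfolding K_def w_def N_def T_def cr(1) by (simp add: power_divide)
    have "pair_osc gauss_measure b B \<le> pair_osc gauss_measure b (cube u s)"
      unfolding cr(1) by (rule pair_osc_mono[OF sub])
    also have "\<dots> \<le> ennreal ((K * w)\<^sup>2) * pair_osc lborel b (cube u s)"
      using K w gauss_density_cube(2)[OF g]
      by (intro pair_osc_gauss_le) (auto simp: K_def w_def)
    also have "\<dots> \<le> ennreal ((K * w)\<^sup>2) * (ennreal C0 * \<kappa> * (ennreal N)\<^sup>2)"
      unfolding N_def by (intro mult_left_mono C0(2) b \<kappa> g) auto
    also have "\<dots> = ennreal ((K * w)\<^sup>2 * C0 * N\<^sup>2) * \<kappa>"
      using K w C0(1) N by (simp add: ennreal_mult ennreal_power mult_ac)
    also have "(K * w)\<^sup>2 * C0 * N\<^sup>2 = C * (w / K * (N / T))\<^sup>2"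
      using K T by (simp add: C_def power_mult_distrib field_simps power2_eq_square power4_eq_xxxx)
    also have "ennreal (C * (w / K * (N / T))\<^sup>2) * \<kappa> = ennreal C * \<kappa> * (ennreal (w / K * (N / T)))\<^sup>2"
      using K T N w \<open>0 < C\<close> by (simp add: ennreal_mult ennreal_power mult_ac)
    also have "\<dots> \<le> ennreal C * \<kappa> * (emeasure gauss_measure B)\<^sup>2"
      by (intro mult_left_mono power_mono eB) auto
    finally show ?thesis .
  qed
  show ?thesis by (rule that[OF \<open>0 < C\<close> main])
qed

section \<open>Exponential sums of dyadic averages\<close>

text \<open>Averages are taken with respect to Lebesgue measure, for which all cubes of one
  generation have the same mass.\<close>

definition cube_avg :: "(real ^ 'n::finite \<Rightarrow> real) \<Rightarrow> real ^ 'n \<Rightarrow> real \<Rightarrow> real" where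
  "cube_avg b u s = (LINT x:cube u s|lborel. b x) / s ^ CARD('n)"

text \<open>On the cube, the conditional expectation of \<open>b\<close> on the \<open>k\<close>-th dyadic generation.\<close>

primrec dyadic_avg :: "nat \<Rightarrow> (real ^ 'n::finite \<Rightarrow> real) \<Rightarrow> real ^ 'n \<Rightarrow> real \<Rightarrow> real ^ 'n \<Rightarrow> real" where
  "dyadic_avg 0 b u s x = cube_avg b u s"
| "dyadic_avg (Suc k) b u s x = (\<Sum>S\<in>UNIV. indicator (cube (corner u (s / 2) S) (s / 2)) x *
     dyadic_avg k b (corner u (s / 2) S) (s / 2) x)"

text \<open>The integral of \<open>exp (\<mu> * \<bar>E - v\<bar>)\<close> over the cube, where \<open>E\<close> is the \<open>k\<close>-th dyadic
  average of \<open>b\<close>. The finite sum suits an induction that starts afresh at subcubes while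
  keeping the reference value \<open>v\<close> of the ancestor.\<close>

primrec dyadic_exp_sum :: "real \<Rightarrow> nat \<Rightarrow> (real ^ 'n::finite \<Rightarrow> real) \<Rightarrow> real ^ 'n \<Rightarrow> real \<Rightarrow> real \<Rightarrow> real" where
  "dyadic_exp_sum \<mu> 0 b u s v = exp (\<mu> * \<bar>cube_avg b u s - v\<bar>) * s ^ CARD('n)"
| "dyadic_exp_sum \<mu> (Suc k) b u s v = (\<Sum>S\<in>UNIV. dyadic_exp_sum \<mu> k b (corner u (s / 2) S) (s / 2) v)"

lemma cube_child_subset: "0 < s \<Longrightarrow> cube (corner u (s / 2) S) (s / 2) \<subseteq> cube u s"
  by (rule cube_corner_subset) auto

lemma set_integrable_child:
  fixes b :: "real ^ 'n::finite \<Rightarrow> real"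
  assumes "set_integrable lborel (cube u s) b" "0 < s"
  shows "set_integrable lborel (cube (corner u (s / 2) S) (s / 2)) b"
  by (rule set_integrable_subset[OF assms(1)]) (auto intro: cube_child_subset[OF assms(2), THEN subsetD])

lemma set_integral_children:
  fixes b :: "real ^ 'n::finite \<Rightarrow> real"
  assumes "set_integrable lborel (cube u s) b" "0 < s"
  shows "(LINT x:cube u s|lborel. b x) =
    (\<Sum>S\<in>UNIV. LINT x:cube (corner u (s / 2) S) (s / 2)|lborel. b x)"
proof -
  have "(LINT x:cube u s|lborel. b x) =
    (LINT x|lborel. (\<Sum>S\<in>UNIV. indicator (cube (corner u (s / 2) S) (s / 2)) x *\<^sub>R b x))"
    unfolding set_lebesgue_integral_def
    by (subst indicator_cube_children[OF assms(2)]) (simp only: real_scaleR_def sum_distrib_right)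
  also have "\<dots> = (\<Sum>S\<in>UNIV. LINT x:cube (corner u (s / 2) S) (s / 2)|lborel. b x)"
    unfolding set_lebesgue_integral_def
    using set_integrable_child[OF assms] unfolding set_integrable_def
    by (intro Bochner_Integration.integral_sum) auto
  finally show ?thesis .
qed

lemma children_volume:
  "(\<Sum>S\<in>(UNIV :: 'n::finite set set). (s / 2) ^ CARD('n)) = (s::real) ^ CARD('n)"
  by (simp add: card_set_UNIV power_divide)

lemma set_integrable_const_cube:
  fixes u :: "real ^ 'n::finite"
  assumes "0 \<le> s"
  shows "set_integrable lborel (cube u s) (\<lambda>x. c::real)"
  using emeasure_cube[OF assms, of u] unfolding set_integrable_def
  by (intro integrable_scaleR_left integrable_real_indicator) auto

lemma set_integral_const_cube:
  fixes u :: "real ^ 'n::finite"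
  assumes "0 \<le> s"
  shows "(LINT x:cube u s|lborel. c::real) = c * s ^ CARD('n)"
  using emeasure_cube[OF assms, of u] measure_cube[OF assms, of u]
  by (simp add: set_lebesgue_integral_def)

lemma cube_avg_diff_le:
  fixes b :: "real ^ 'n::finite \<Rightarrow> real"
  assumes "set_integrable lborel (cube u s) b" "0 < s"
  shows "\<bar>cube_avg b u s - v\<bar> * s ^ CARD('n) \<le> (LINT x:cube u s|lborel. \<bar>b x - v\<bar>)"
proof -
  note c = set_integrable_const_cube[of s u, OF less_imp_le[OF assms(2)]]
  have "(cube_avg b u s - v) * s ^ CARD('n) = (LINT x:cube u s|lborel. b x) - (LINT x:cube u s|lborel. v)"
    using assms(2) by (simp add: cube_avg_def set_integral_const_cube left_diff_distrib)
  also have "\<dots> = (LINT x:cube u s|lborel. b x - v)"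
    by (rule set_integral_diff(2)[OF assms(1) c, symmetric])
  finally have "\<bar>cube_avg b u s - v\<bar> * s ^ CARD('n) = \<bar>LINT x:cube u s|lborel. b x - v\<bar>"
    using assms(2) by (metis abs_mult abs_of_pos zero_less_power)
  also have "\<dots> \<le> (LINT x:cube u s|lborel. \<bar>b x - v\<bar>)"
    using set_integral_norm_bound[OF set_integral_diff(1)[OF assms(1) c]] by simp
  finally show ?thesis .
qed

lemma set_integrable_abs_diff:
  fixes b :: "real ^ 'n::finite \<Rightarrow> real"
  assumes "set_integrable lborel (cube u s) b" "0 < s"
  shows "set_integrable lborel (cube u s) (\<lambda>x. \<bar>b x - v\<bar>)"
  using set_integrable_abs[OF set_integral_diff(1)[OF assms(1) set_integrable_const_cube]] assms(2) by simp

lemma dyadic_exp_sum_nonneg: "0 \<le> s \<Longrightarrow> 0 \<le> dyadic_exp_sum \<mu> k b u s v"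
  by (induction k arbitrary: u s) (auto intro: sum_nonneg)

lemma dyadic_exp_sum_shift:
  assumes "0 \<le> \<mu>" "0 < s"
  shows "dyadic_exp_sum \<mu> k b u s v \<le> exp (\<mu> * \<bar>w - v\<bar>) * dyadic_exp_sum \<mu> k b (u :: real ^ 'n::finite) s w"
  using assms(2)
proof (induction k arbitrary: u s)
  case 0
  have "\<bar>cube_avg b u s - v\<bar> \<le> \<bar>w - v\<bar> + \<bar>cube_avg b u s - w\<bar>" by simp
  then have "\<mu> * \<bar>cube_avg b u s - v\<bar> \<le> \<mu> * \<bar>w - v\<bar> + \<mu> * \<bar>cube_avg b u s - w\<bar>"
    using assms(1) by (metis distrib_left mult_left_mono)
  then have "exp (\<mu> * \<bar>cube_avg b u s - v\<bar>) \<le> exp (\<mu> * \<bar>w - v\<bar>) * exp (\<mu> * \<bar>cube_avg b u s - w\<bar>)"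
    by (simp add: exp_add[symmetric])
  then have "exp (\<mu> * \<bar>cube_avg b u s - v\<bar>) * s ^ CARD('n) \<le> exp (\<mu> * \<bar>w - v\<bar>) * exp (\<mu> * \<bar>cube_avg b u s - w\<bar>) * s ^ CARD('n)"
    using 0 by (intro mult_right_mono) auto
  then show ?case by (simp add: mult.assoc)
next
  case (Suc k)
  then show ?case by (simp add: sum_distrib_left sum_mono)
qed

text \<open>The stopping time argument of John and Nirenberg, by induction on the number \<open>k\<close> of
  generations. With \<open>v\<close> the average over the cube, descend through the generations until
  the average differs from \<open>v\<close> by more than \<open>H\<close>. On a stopped cube the difference is at
  most \<open>H + d\<close>, since one generation changes the average by at most \<open>d\<close>; there the
  induction hypothesis is applied with the cube's own average as reference. The stopped
  cubes have total volume at most \<open>1/H\<close> times the integral of \<open>\<bar>b - v\<bar>\<close>, hence at most a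
  quarter of the volume of the cube.\<close>

lemma dyadic_exp_sum_bounded:
  fixes b :: "real ^ 'n::finite \<Rightarrow> real"
  assumes int: "set_integrable lborel (cube u0 s0) b"
    and \<kappa>: "0 < \<kappa>"
    and osc: "\<And>u s. 0 < s \<Longrightarrow> cube u s \<subseteq> cube u0 s0 \<Longrightarrow>
      (LINT x:cube u s|lborel. \<bar>b x - cube_avg b u s\<bar>) \<le> \<kappa> * s ^ CARD('n)"
    and s: "0 < s" "cube u s \<subseteq> cube u0 s0"
    and \<mu>: "\<mu> = ln 2 / ((4 + 2 ^ CARD('n)) * \<kappa>)"
  shows "dyadic_exp_sum \<mu> k b u s (cube_avg b u s) \<le> 4 * s ^ CARD('n)"
  using s
proof (induction k arbitrary: u s rule: less_induct)
  case (less k)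
  \<comment> \<open>With \<open>H = 4 \<kappa>\<close> and \<open>\<mu> (H + d) = ln 2\<close>, the bound \<open>4\<close> reproduces itself: cubes that
    never stop contribute at most \<open>2\<close>, stopped cubes at most \<open>2 * 4\<close> times the fraction
    \<open>1/4\<close>.\<close>
  define d where "d = 2 ^ CARD('n) * \<kappa>"
  define H where "H = 4 * \<kappa>"
  have dH: "0 < d" "0 < H" using \<kappa> by (auto simp: d_def H_def)
  have l0: "0 < \<mu>" using \<kappa> by (simp add: \<mu> add_pos_pos)
  have "\<mu> * (H + d) = ln 2"
  proof -
    have "H + d = (4 + 2 ^ CARD('n)) * \<kappa>" by (simp add: H_def d_def algebra_simps)
    moreover have "(4 + 2 ^ CARD('n)) * \<kappa> \<noteq> 0" using \<kappa> by (simp add: add_pos_pos less_imp_neq[symmetric])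
    ultimately show ?thesis by (simp add: \<mu>)
  qed
  then have e2: "exp (\<mu> * (H + d)) = 2" by simp
  have eH: "exp (\<mu> * H) \<le> 2"
    using e2 l0 dH by (metis exp_le_cancel_iff less_add_same_cancel1 less_imp_le mult_left_mono)
  have ints: "set_integrable lborel (cube u' s') b" if "cube u' s' \<subseteq> cube u0 s0" for u' s'
    by (rule set_integrable_subset[OF int]) (use that in auto)
  have jump: "\<bar>cube_avg b (corner u' (s' / 2) S) (s' / 2) - cube_avg b u' s'\<bar> \<le> d"
    if "0 < s'" "cube u' s' \<subseteq> cube u0 s0" for u' s' S
  proof -
    have i: "set_integrable lborel (cube u' s') b" using ints that by auto
    have "\<bar>cube_avg b (corner u' (s' / 2) S) (s' / 2) - cube_avg b u' s'\<bar> * (s' / 2) ^ CARD('n)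
      \<le> (LINT x:cube (corner u' (s' / 2) S) (s' / 2)|lborel. \<bar>b x - cube_avg b u' s'\<bar>)"
      using that by (intro cube_avg_diff_le set_integrable_child i) auto
    also have "\<dots> \<le> (LINT x:cube u' s'|lborel. \<bar>b x - cube_avg b u' s'\<bar>)"
      using set_integrable_abs_diff[OF i] set_integrable_abs_diff[OF set_integrable_child[OF i]] that
        cube_child_subset[OF that(1), of u' S]
      unfolding set_integrable_def set_lebesgue_integral_def
      by (intro integral_mono) (auto simp: indicator_def)
    also have "\<dots> \<le> \<kappa> * s' ^ CARD('n)" by (intro osc that)
    also have "\<dots> = d * (s' / 2) ^ CARD('n)" by (simp add: d_def power_divide)
    finally show ?thesis using that by simp
  qed
  define v where "v = cube_avg b u s"
  have J0: "0 \<le> (LINT x:cube u' s'|lborel. \<bar>b x - v\<bar>)" for u' s'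
    by (simp add: set_lebesgue_integral_def)
  \<comment> \<open>The volume of a stopped cube is charged to the integral of \<open>\<bar>b - v\<bar>\<close> over it.\<close>
  have stop: "dyadic_exp_sum \<mu> j b u' s' v \<le> 2 * s' ^ CARD('n) + 8 / H * (LINT x:cube u' s'|lborel. \<bar>b x - v\<bar>)"
    if "j < k" "0 < s'" "cube u' s' \<subseteq> cube u0 s0" "H < \<bar>cube_avg b u' s' - v\<bar>" "\<bar>cube_avg b u' s' - v\<bar> \<le> H + d" for j u' s'
  proof -
    have "H * s' ^ CARD('n) \<le> \<bar>cube_avg b u' s' - v\<bar> * s' ^ CARD('n)"
      using that by (intro mult_right_mono) auto
    also have "\<dots> \<le> (LINT x:cube u' s'|lborel. \<bar>b x - v\<bar>)"
      using that by (intro cube_avg_diff_le ints) auto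
    finally have vol: "8 * s' ^ CARD('n) \<le> 8 / H * (LINT x:cube u' s'|lborel. \<bar>b x - v\<bar>)"
      using dH by (simp add: field_simps)
    have "\<mu> * \<bar>cube_avg b u' s' - v\<bar> \<le> \<mu> * (H + d)" using l0 that by (intro mult_left_mono) auto
    then have "exp (\<mu> * \<bar>cube_avg b u' s' - v\<bar>) \<le> 2" using e2 by (metis exp_le_cancel_iff)
    have "dyadic_exp_sum \<mu> j b u' s' v \<le>
        exp (\<mu> * \<bar>cube_avg b u' s' - v\<bar>) * dyadic_exp_sum \<mu> j b u' s' (cube_avg b u' s')"
      using l0 that by (intro dyadic_exp_sum_shift) auto
    also have "\<dots> \<le> 2 * (4 * s' ^ CARD('n))"
      using less.IH[OF that(1-3)] \<open>exp (\<mu> * \<bar>cube_avg b u' s' - v\<bar>) \<le> 2\<close> that(2)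
      by (intro mult_mono) (auto intro: dyadic_exp_sum_nonneg)
    finally show ?thesis using vol zero_le_power[of s' "CARD('n)"] that(2) by linarith
  qed
  \<comment> \<open>The bound is additive over children. The cube itself, \<open>j = k\<close>, does not stop, so that
    the induction hypothesis is only used for fewer generations.\<close>
  have descend: "dyadic_exp_sum \<mu> j b u' s' v \<le> 2 * s' ^ CARD('n) + 8 / H * (LINT x:cube u' s'|lborel. \<bar>b x - v\<bar>)"
    if "j \<le> k" "0 < s'" "cube u' s' \<subseteq> cube u0 s0" "\<bar>cube_avg b u' s' - v\<bar> \<le> H + d"
      "j = k \<longrightarrow> \<bar>cube_avg b u' s' - v\<bar> \<le> H" for j u' s'
    using that
  proof (induction j arbitrary: u' s')
    case 0
    show ?case
    proof (cases "\<bar>cube_avg b u' s' - v\<bar> \<le> H")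
      case True
      then have "\<mu> * \<bar>cube_avg b u' s' - v\<bar> \<le> \<mu> * H" using l0 by (intro mult_left_mono) auto
      then have "exp (\<mu> * \<bar>cube_avg b u' s' - v\<bar>) \<le> 2" using eH by (meson exp_le_cancel_iff order_trans)
      then have "dyadic_exp_sum \<mu> 0 b u' s' v \<le> 2 * s' ^ CARD('n)"
        using 0 by (simp add: mult_right_mono)
      moreover have "0 \<le> 8 / H * (LINT x:cube u' s'|lborel. \<bar>b x - v\<bar>)"
        using J0 dH by (intro mult_nonneg_nonneg) auto
      ultimately show ?thesis by simp
    next
      case False
      with 0 show ?thesis by (intro stop) (auto simp: le_less)
    qed
  next
    case (Suc j)
    show ?case
    proof (cases "\<bar>cube_avg b u' s' - v\<bar> \<le> H")
      case True
      let ?c = "\<lambda>S. corner u' (s' / 2) S"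
      have "dyadic_exp_sum \<mu> j b (?c S) (s' / 2) v \<le>
          2 * (s' / 2) ^ CARD('n) + 8 / H * (LINT x:cube (?c S) (s' / 2)|lborel. \<bar>b x - v\<bar>)" for S
      proof (rule Suc.IH)
        show "cube (?c S) (s' / 2) \<subseteq> cube u0 s0"
          using cube_child_subset Suc.prems by blast
        show "\<bar>cube_avg b (?c S) (s' / 2) - v\<bar> \<le> H + d"
          using jump[of s' u' S] True Suc.prems by linarith
      qed (use Suc.prems in auto)
      then have "dyadic_exp_sum \<mu> (Suc j) b u' s' v \<le>
          (\<Sum>S\<in>UNIV. 2 * (s' / 2) ^ CARD('n) + 8 / H * (LINT x:cube (?c S) (s' / 2)|lborel. \<bar>b x - v\<bar>))"
        by (simp add: sum_mono)
      also have "\<dots> = 2 * s' ^ CARD('n) + 8 / H * (LINT x:cube u' s'|lborel. \<bar>b x - v\<bar>)"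
        using set_integral_children[OF set_integrable_abs_diff[OF ints], of u' s' v] Suc.prems
        by (simp only: sum.distrib sum_distrib_left[symmetric] children_volume)
      finally show ?thesis .
    next
      case False
      with Suc.prems show ?thesis by (intro stop) (auto simp: le_less)
    qed
  qed
  have "dyadic_exp_sum \<mu> k b u s v \<le> 2 * s ^ CARD('n) + 8 / H * (LINT x:cube u s|lborel. \<bar>b x - v\<bar>)"
    using less.prems dH by (intro descend) (auto simp: v_def)
  also have "(LINT x:cube u s|lborel. \<bar>b x - v\<bar>) \<le> \<kappa> * s ^ CARD('n)"
    unfolding v_def by (intro osc less.prems)
  then have "8 / H * (LINT x:cube u s|lborel. \<bar>b x - v\<bar>) \<le> 8 / H * (\<kappa> * s ^ CARD('n))"
    using dH by (intro mult_left_mono) auto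
  also have "8 / H * (\<kappa> * s ^ CARD('n)) = 2 * s ^ CARD('n)" using \<kappa> by (simp add: H_def)
  finally show ?case unfolding v_def by simp
qed

section \<open>Convergence of dyadic averages\<close>

lemma AE_lborel_of_negligible:
  assumes "negligible N"
  shows "AE x in lborel. x \<notin> N"
proof -
  obtain N' where "N' \<in> null_sets lborel" "N \<subseteq> N'"
    using assms by (auto simp: negligible_iff_null_sets null_sets_completion_iff2)
  then show ?thesis by (intro AE_I') auto
qed

text \<open>Dominated convergence; it serves for the truncations of \<open>b\<close> and again for their
  continuous approximations.\<close>

lemma set_L1_tendsto:
  fixes f :: "'a \<Rightarrow> real"
  assumes [measurable]: "A \<in> sets M" "\<And>k. g k \<in> borel_measurable M" "f \<in> borel_measurable M"
    and w: "set_integrable M A w" and lim: "AE x in M. (\<lambda>k. g k x) \<longlonglongrightarrow> f x"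
    and dom: "\<And>k x. \<bar>f x - g k x\<bar> \<le> w x"
  shows "(\<lambda>k::nat. LINT x:A|M. \<bar>f x - g k x\<bar>) \<longlonglongrightarrow> 0" "set_integrable M A (\<lambda>x. \<bar>f x - g k x\<bar>)"
proof -
  have le: "norm (indicator A x *\<^sub>R \<bar>f x - g k x\<bar>) \<le> indicator A x *\<^sub>R w x" for k x
    using dom[of x k] by (simp add: indicator_def)
  show "set_integrable M A (\<lambda>x. \<bar>f x - g k x\<bar>)"
    unfolding set_integrable_def
    by (rule Bochner_Integration.integrable_bound[OF w[unfolded set_integrable_def]])
      (measurable, intro AE_I2 order_trans[OF le], simp)
  have "(\<lambda>k. LINT x|M. indicator A x *\<^sub>R \<bar>f x - g k x\<bar>) \<longlonglongrightarrow> (LINT x|M. indicator A x *\<^sub>R \<bar>f x - f x\<bar>)"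
  proof (rule integral_dominated_convergence[OF _ _ w[unfolded set_integrable_def]])
    show "AE x in M. (\<lambda>k. indicator A x *\<^sub>R \<bar>f x - g k x\<bar>) \<longlonglongrightarrow> indicator A x *\<^sub>R \<bar>f x - f x\<bar>"
      using lim by eventually_elim (intro tendsto_intros)
    show "AE x in M. norm (indicator A x *\<^sub>R \<bar>f x - g k x\<bar>) \<le> indicator A x *\<^sub>R w x" for k
      by (intro AE_I2 le)
  qed measurable
  then show "(\<lambda>k. LINT x:A|M. \<bar>f x - g k x\<bar>) \<longlonglongrightarrow> 0" by (simp add: set_lebesgue_integral_def)
qed

text \<open>A measurable function is an almost everywhere limit of continuous ones. To dominate the
  convergence, \<open>b\<close> and its approximants are both clipped at a height \<open>M\<close>, chosen first so
  that clipping \<open>b\<close> costs at most \<open>e/2\<close>.\<close>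

lemma continuous_dense_L1_cube:
  fixes b :: "real ^ 'n::finite \<Rightarrow> real"
  assumes b [measurable]: "b \<in> borel_measurable borel" and int: "set_integrable lborel (cube u s) b"
    and "0 < s" "0 < e"
  obtains g where "continuous_on UNIV g" "(LINT x:cube u s|lborel. \<bar>b x - g x\<bar>) < e"
proof -
  define clip where "clip = (\<lambda>(M::nat) (t::real). max (- real M) (min (real M) t))"
  have clip_cont: "continuous_on UNIV (clip M)" for M unfolding clip_def by (intro continuous_intros)
  have [measurable]: "clip M \<in> borel_measurable borel" for M
    using clip_cont by (rule borel_measurable_continuous_onI)
  have clip_bd: "\<bar>clip M t\<bar> \<le> real M" for M t by (auto simp: clip_def)
  have clip_le: "\<bar>t - clip M t\<bar> \<le> \<bar>t\<bar>" for M t by (auto simp: clip_def)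
  have clip_lim: "(\<lambda>M. clip M t) \<longlonglongrightarrow> t" for t
  proof (rule tendsto_eventually)
    obtain M0 where "\<bar>t\<bar> \<le> real M0" using real_arch_simple by blast
    then show "eventually (\<lambda>M. clip M t = t) sequentially"
      by (intro eventually_sequentiallyI[of M0]) (auto simp: clip_def)
  qed
  note L1 = set_L1_tendsto[OF _ _ _ set_integrable_abs[OF int] AE_I2[OF clip_lim] clip_le]
  have "eventually (\<lambda>M. (LINT x:cube u s|lborel. \<bar>b x - clip M (b x)\<bar>) < e / 2) sequentially"
    using \<open>0 < e\<close> by (intro order_tendstoD(2)[OF L1(1)]) auto
  then obtain M where M: "(LINT x:cube u s|lborel. \<bar>b x - clip M (b x)\<bar>) < e / 2"
    by (auto simp: eventually_sequentially)
  have "b \<in> borel_measurable lborel" using b by simp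
  then have "b \<in> borel_measurable lebesgue" by (rule measurable_completion)
  then have "b measurable_on UNIV"
    by (intro lebesgue_measurable_imp_measurable_on) auto
  then obtain N g where N: "negligible N" and g: "\<And>k. continuous_on UNIV (g k)"
      and lim: "\<And>x. x \<notin> N \<Longrightarrow> (\<lambda>k. g k x) \<longlonglongrightarrow> b x"
    unfolding measurable_on_def by auto
  have [measurable]: "g k \<in> borel_measurable borel" for k
    using g by (rule borel_measurable_continuous_onI)
  have c2: "set_integrable lborel (cube u s) (\<lambda>x. 2 * real M)"
    using \<open>0 < s\<close> by (intro set_integrable_const_cube) simp
  have "(\<lambda>k. clip M (g k x)) \<longlonglongrightarrow> clip M (b x)" if "x \<notin> N" for x
    using clip_cont[of M] by (intro isCont_tendsto_compose[OF _ lim[OF that]]) (simp add: continuous_on_eq_continuous_at)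
  then have lim': "AE x in lborel. (\<lambda>k. clip M (g k x)) \<longlonglongrightarrow> clip M (b x)"
    using AE_lborel_of_negligible[OF N] by (auto elim: eventually_mono)
  have dom: "\<bar>clip M (b x) - clip M (g k x)\<bar> \<le> 2 * real M" for k x
    using clip_bd[of M "b x"] clip_bd[of M "g k x"] by linarith
  note L1' = set_L1_tendsto[OF _ _ _ c2 lim' dom]
  have "eventually (\<lambda>k. (LINT x:cube u s|lborel. \<bar>clip M (b x) - clip M (g k x)\<bar>) < e / 2) sequentially"
    using \<open>0 < e\<close> by (intro order_tendstoD(2)[OF L1'(1)]) auto
  then obtain k where k: "(LINT x:cube u s|lborel. \<bar>clip M (b x) - clip M (g k x)\<bar>) < e / 2"
    by (auto simp: eventually_sequentially)
  have i1: "set_integrable lborel (cube u s) (\<lambda>x. \<bar>b x - clip M (b x)\<bar>)" by (rule L1(2)) auto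
  have i2: "set_integrable lborel (cube u s) (\<lambda>x. \<bar>clip M (b x) - clip M (g k x)\<bar>)" by (rule L1'(2)) auto
  have "(LINT x:cube u s|lborel. \<bar>b x - clip M (g k x)\<bar>) \<le>
      (LINT x:cube u s|lborel. \<bar>b x - clip M (b x)\<bar> + \<bar>clip M (b x) - clip M (g k x)\<bar>)"
    unfolding set_lebesgue_integral_def
    using set_integral_add(1)[OF i1 i2] unfolding set_integrable_def
    by (rule integral_mono_AE') (auto intro!: AE_I2 split: split_indicator)
  also have "\<dots> = (LINT x:cube u s|lborel. \<bar>b x - clip M (b x)\<bar>) + (LINT x:cube u s|lborel. \<bar>clip M (b x) - clip M (g k x)\<bar>)"
    by (rule set_integral_add(2)[OF i1 i2])
  also have "\<dots> < e" using M k by simp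
  finally have "(LINT x:cube u s|lborel. \<bar>b x - clip M (g k x)\<bar>) < e" .
  moreover have "continuous_on UNIV (\<lambda>x. clip M (g k x))"
    by (rule continuous_on_compose2[OF clip_cont g]) auto
  ultimately show ?thesis by (intro that)
qed

lemma dyadic_avg_child:
  assumes "0 < s" "x \<in> cube (corner u (s / 2) S) (s / 2)"
  shows "dyadic_avg (Suc k) b u s x = dyadic_avg k b (corner u (s / 2) S) (s / 2) x"
proof -
  have "indicator (cube (corner u (s / 2) S') (s / 2)) x * dyadic_avg k b (corner u (s / 2) S') (s / 2) x =
      (if S' = S then dyadic_avg k b (corner u (s / 2) S) (s / 2) x else 0)" for S'
    using assms(2) by (auto simp: indicator_def mem_dyadic_child_iff[OF assms(1)])
  then show ?thesis by simp
qed

lemma mem_some_child: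
  "0 < s \<Longrightarrow> x \<in> cube u s \<Longrightarrow> \<exists>S. x \<in> cube (corner u (s / 2) S) (s / 2)"
  by (simp add: mem_dyadic_child_iff)

lemma borel_measurable_dyadic_avg [measurable]:
  "(\<lambda>x. dyadic_avg k b u s x) \<in> borel_measurable borel"
proof (induction k arbitrary: u s)
  case 0
  then show ?case by simp
next
  case (Suc k)
  then show ?case unfolding dyadic_avg.simps
    by (intro borel_measurable_sum borel_measurable_times borel_measurable_indicator) auto
qed

lemma nn_integral_children:
  fixes f :: "real ^ 'n::finite \<Rightarrow> ennreal"
  assumes [measurable]: "f \<in> borel_measurable borel" and "0 < s"
  shows "(\<integral>\<^sup>+x\<in>cube u s. f x \<partial>lborel) = (\<Sum>S\<in>UNIV. \<integral>\<^sup>+x\<in>cube (corner u (s / 2) S) (s / 2). f x \<partial>lborel)"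
proof -
  have "(\<integral>\<^sup>+x\<in>cube u s. f x \<partial>lborel) =
     (\<integral>\<^sup>+x. (\<Sum>S\<in>UNIV. f x * indicator (cube (corner u (s / 2) S) (s / 2)) x) \<partial>lborel)"
    by (subst indicator_cube_children[OF assms(2)]) (simp only: sum_distrib_left)
  also have "\<dots> = (\<Sum>S\<in>UNIV. \<integral>\<^sup>+x\<in>cube (corner u (s / 2) S) (s / 2). f x \<partial>lborel)"
    by (rule nn_integral_sum) auto
  finally show ?thesis .
qed

lemma nn_integral_dyadic_avg_Suc:
  fixes u :: "real ^ 'n::finite"
  assumes [measurable]: "\<phi> \<in> borel_measurable borel" and s: "0 < s"
  shows "(\<integral>\<^sup>+x\<in>cube u s. \<phi> (dyadic_avg (Suc k) b u s x) \<partial>lborel) =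
    (\<Sum>S\<in>UNIV. \<integral>\<^sup>+x\<in>cube (corner u (s / 2) S) (s / 2). \<phi> (dyadic_avg k b (corner u (s / 2) S) (s / 2) x) \<partial>lborel)"
proof -
  have "(\<integral>\<^sup>+x\<in>cube u s. \<phi> (dyadic_avg (Suc k) b u s x) \<partial>lborel) =
     (\<Sum>S\<in>UNIV. \<integral>\<^sup>+x\<in>cube (corner u (s / 2) S) (s / 2). \<phi> (dyadic_avg (Suc k) b u s x) \<partial>lborel)"
    by (rule nn_integral_children[OF _ s]) measurable
  also have "\<dots> = (\<Sum>S\<in>UNIV. \<integral>\<^sup>+x\<in>cube (corner u (s / 2) S) (s / 2). \<phi> (dyadic_avg k b (corner u (s / 2) S) (s / 2) x) \<partial>lborel)"
    using dyadic_avg_child[OF s, of _ u _ k b]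
    by (intro sum.cong nn_integral_cong refl) (auto simp: indicator_def simp del: dyadic_avg.simps)
  finally show ?thesis .
qed

lemma nn_integral_exp_dyadic_avg:
  fixes u :: "real ^ 'n::finite"
  assumes "0 < s"
  shows "(\<integral>\<^sup>+x\<in>cube u s. ennreal (exp (\<mu> * \<bar>dyadic_avg k b u s x - v\<bar>)) \<partial>lborel) = ennreal (dyadic_exp_sum \<mu> k b u s v)"
  using assms
proof (induction k arbitrary: u s)
  case 0
  then show ?case
    by (simp add: nn_integral_cmult_indicator emeasure_cube ennreal_mult)
next
  case (Suc k)
  have "(\<integral>\<^sup>+x\<in>cube u s. ennreal (exp (\<mu> * \<bar>dyadic_avg (Suc k) b u s x - v\<bar>)) \<partial>lborel) =
      (\<Sum>S\<in>UNIV. \<integral>\<^sup>+x\<in>cube (corner u (s / 2) S) (s / 2). ennreal (exp (\<mu> * \<bar>dyadic_avg k b (corner u (s / 2) S) (s / 2) x - v\<bar>)) \<partial>lborel)"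
    by (rule nn_integral_dyadic_avg_Suc[OF _ Suc.prems, of "\<lambda>t. ennreal (exp (\<mu> * \<bar>t - v\<bar>))"]) measurable
  also have "\<dots> = (\<Sum>S\<in>UNIV. ennreal (dyadic_exp_sum \<mu> k b (corner u (s / 2) S) (s / 2) v))"
    using Suc by (intro sum.cong refl) simp
  also have "\<dots> = ennreal (dyadic_exp_sum \<mu> (Suc k) b u s v)"
    using Suc.prems by (subst sum_ennreal) (auto intro: dyadic_exp_sum_nonneg)
  finally show ?case .
qed

lemma nn_integral_dyadic_avg_le:
  fixes u :: "real ^ 'n::finite"
  assumes "set_integrable lborel (cube u s) h" "h \<in> borel_measurable borel" "0 < s"
  shows "(\<integral>\<^sup>+x\<in>cube u s. ennreal \<bar>dyadic_avg k h u s x\<bar> \<partial>lborel) \<le> (\<integral>\<^sup>+x\<in>cube u s. ennreal \<bar>h x\<bar> \<partial>lborel)"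
  using assms(1,3)
proof (induction k arbitrary: u s)
  case 0
  have "(\<integral>\<^sup>+x\<in>cube u s. ennreal \<bar>dyadic_avg 0 h u s x\<bar> \<partial>lborel) = ennreal (\<bar>cube_avg h u s - 0\<bar> * s ^ CARD('n))"
    using 0 by (simp add: nn_integral_cmult_indicator emeasure_cube ennreal_mult)
  also have "\<dots> \<le> ennreal (LINT x:cube u s|lborel. \<bar>h x - 0\<bar>)"
    by (intro ennreal_leI cube_avg_diff_le 0)
  also have "\<dots> = (\<integral>\<^sup>+x. ennreal (indicator (cube u s) x *\<^sub>R \<bar>h x\<bar>) \<partial>lborel)"
    using set_integrable_abs[OF 0(1)] unfolding set_lebesgue_integral_def set_integrable_def
    by (subst nn_integral_eq_integral) auto
  also have "\<dots> = (\<integral>\<^sup>+x\<in>cube u s. ennreal \<bar>h x\<bar> \<partial>lborel)"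
    by (intro nn_integral_cong) (auto simp: indicator_def)
  finally show ?case .
next
  case (Suc k)
  have "(\<integral>\<^sup>+x\<in>cube u s. ennreal \<bar>dyadic_avg (Suc k) h u s x\<bar> \<partial>lborel) =
     (\<Sum>S\<in>UNIV. \<integral>\<^sup>+x\<in>cube (corner u (s / 2) S) (s / 2). ennreal \<bar>dyadic_avg k h (corner u (s / 2) S) (s / 2) x\<bar> \<partial>lborel)"
    by (rule nn_integral_dyadic_avg_Suc[OF _ Suc.prems(2), of "\<lambda>t. ennreal \<bar>t\<bar>"]) measurable
  also have "\<dots> \<le> (\<Sum>S\<in>UNIV. \<integral>\<^sup>+x\<in>cube (corner u (s / 2) S) (s / 2). ennreal \<bar>h x\<bar> \<partial>lborel)"
    using Suc by (intro sum_mono Suc.IH set_integrable_child) auto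
  also have "\<dots> = (\<integral>\<^sup>+x\<in>cube u s. ennreal \<bar>h x\<bar> \<partial>lborel)"
    using assms Suc by (intro nn_integral_children[symmetric]) auto
  finally show ?case .
qed

lemma dyadic_avg_diff:
  fixes u :: "real ^ 'n::finite"
  assumes "set_integrable lborel (cube u s) f" "set_integrable lborel (cube u s) g" "0 < s"
  shows "dyadic_avg k (\<lambda>x. f x - g x) u s x = dyadic_avg k f u s x - dyadic_avg k g u s x"
  using assms
proof (induction k arbitrary: u s)
  case 0
  then show ?case by (simp add: cube_avg_def set_integral_diff diff_divide_distrib)
next
  case (Suc k)
  have "dyadic_avg k (\<lambda>x. f x - g x) (corner u (s / 2) S) (s / 2) x =
      dyadic_avg k f (corner u (s / 2) S) (s / 2) x - dyadic_avg k g (corner u (s / 2) S) (s / 2) x" for S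
    using Suc.prems by (intro Suc.IH set_integrable_child) auto
  then show ?case by (simp add: right_diff_distrib sum_subtractf del: sum_indicator_mult)
qed

lemma set_integrable_continuous_cube:
  fixes u :: "real ^ 'n::finite"
  assumes "continuous_on UNIV g" "0 \<le> s"
  shows "set_integrable lborel (cube u s) (g :: _ \<Rightarrow> real)"
proof -
  have "cube u s \<subseteq> cbox u (\<chi> i. u $ i + s)" by (auto simp: cube_def mem_box_cart less_imp_le)
  moreover have "set_integrable lborel (cbox u (\<chi> i. u $ i + s)) g"
    unfolding set_integrable_def
    by (rule borel_integrable_compact) (auto intro: continuous_on_subset[OF assms(1)])
  ultimately show ?thesis by (rule set_integrable_subset[rotated 2]) simp
qed

text \<open>The cube of the \<open>k\<close>-th generation containing \<open>x\<close> has side \<open>s / 2\<^sup>k\<close>, and the average of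
  \<open>g\<close> over it differs from \<open>g x\<close> by at most the oscillation of \<open>g\<close>.\<close>

lemma dyadic_avg_uniformly_close:
  fixes u :: "real ^ 'n::finite"
  assumes g: "continuous_on UNIV g" and "0 < s" "x \<in> cube u s"
    and "\<And>y z. y \<in> cube u s \<Longrightarrow> z \<in> cube u s \<Longrightarrow> norm (y - z) \<le> real CARD('n) * (s / 2 ^ k) \<Longrightarrow> \<bar>g y - g z\<bar> \<le> e"
  shows "\<bar>dyadic_avg k g u s x - g x\<bar> \<le> e"
  using assms(2-)
proof (induction k arbitrary: u s)
  case 0
  have i: "set_integrable lborel (cube u s) g" using g 0 by (intro set_integrable_continuous_cube) auto
  have e: "\<bar>g y - g x\<bar> \<le> e" if "y \<in> cube u s" for y
  proof (rule 0(3)[OF that 0(2)])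
    have "\<bar>(y - x) $ i\<bar> \<le> s" for i
    proof -
      have "u $ i \<le> x $ i" "x $ i < u $ i + s" "u $ i \<le> y $ i" "y $ i < u $ i + s"
        using that 0 by (auto simp: cube_def)
      then show ?thesis by simp
    qed
    then have "(\<Sum>i\<in>UNIV. \<bar>(y - x) $ i\<bar>) \<le> (\<Sum>i\<in>(UNIV::'n set). s)" by (intro sum_mono)
    then show "norm (y - x) \<le> real CARD('n) * (s / 2 ^ 0)"
      using norm_le_l1_cart[of "y - x"] by simp
  qed
  have "\<bar>dyadic_avg 0 g u s x - g x\<bar> * s ^ CARD('n) \<le> (LINT y:cube u s|lborel. \<bar>g y - g x\<bar>)"
    using cube_avg_diff_le[OF i 0(1)] by simp
  also have "\<dots> \<le> (LINT y:cube u s|lborel. e)"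
    using e 0 by (intro set_integral_mono set_integrable_abs_diff i set_integrable_const_cube) auto
  also have "\<dots> = e * s ^ CARD('n)" using 0 by (intro set_integral_const_cube) auto
  finally show ?case using 0 by simp
next
  case (Suc k)
  then obtain S where S: "x \<in> cube (corner u (s / 2) S) (s / 2)" using mem_some_child by blast
  have "\<bar>dyadic_avg k g (corner u (s / 2) S) (s / 2) x - g x\<bar> \<le> e"
  proof (rule Suc.IH)
    fix y z assume yz: "y \<in> cube (corner u (s / 2) S) (s / 2)" "z \<in> cube (corner u (s / 2) S) (s / 2)"
      "norm (y - z) \<le> real CARD('n) * (s / 2 / 2 ^ k)"
    show "\<bar>g y - g z\<bar> \<le> e"
      using yz cube_child_subset[OF Suc.prems(1), of u S] by (intro Suc.prems(3)) auto
  qed (use Suc.prems S in auto)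
  then show ?case using dyadic_avg_child[OF Suc.prems(1) S, of k g] by (simp del: dyadic_avg.simps)
qed

section \<open>The John--Nirenberg inequality\<close>

lemma set_nn_integral_eq_LINT:
  fixes f :: "'a \<Rightarrow> real"
  assumes "set_integrable M A f" "\<And>x. 0 \<le> f x"
  shows "(\<integral>\<^sup>+x\<in>A. ennreal (f x) \<partial>M) = ennreal (LINT x:A|M. f x)"
proof -
  have "(\<integral>\<^sup>+x\<in>A. ennreal (f x) \<partial>M) = (\<integral>\<^sup>+x. ennreal (indicator A x *\<^sub>R f x) \<partial>M)"
    by (intro nn_integral_cong) (auto simp: indicator_def)
  also have "\<dots> = ennreal (LINT x:A|M. f x)"
    using assms unfolding set_lebesgue_integral_def set_integrable_def
    by (intro nn_integral_eq_integral) auto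
  finally show ?thesis .
qed

text \<open>Approximation of \<open>b\<close> by a continuous \<open>g\<close>: the averages of \<open>b - g\<close> are small by
  contraction, those of \<open>g\<close> converge uniformly. This replaces the Lebesgue differentiation
  theorem.\<close>

lemma dyadic_avg_L1_close:
  fixes b :: "real ^ 'n::finite \<Rightarrow> real"
  assumes b [measurable]: "b \<in> borel_measurable borel" and int: "set_integrable lborel (cube u s) b"
    and s: "0 < s" and e: "0 < e"
  shows "\<exists>K. \<forall>k\<ge>K. (\<integral>\<^sup>+x\<in>cube u s. ennreal \<bar>dyadic_avg k b u s x - b x\<bar> \<partial>lborel) \<le> ennreal (3 * e)"
proof -
  obtain g where g: "continuous_on UNIV g" and bg: "(LINT x:cube u s|lborel. \<bar>b x - g x\<bar>) < e"
    using continuous_dense_L1_cube[OF b int s e] .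
  have [measurable]: "g \<in> borel_measurable borel" using g by (rule borel_measurable_continuous_onI)
  have gi: "set_integrable lborel (cube u s) g"
    using g s by (intro set_integrable_continuous_cube) auto
  have di: "set_integrable lborel (cube u s) (\<lambda>x. b x - g x)"
    by (rule set_integral_diff(1)[OF int gi])
  have small: "(\<integral>\<^sup>+x\<in>cube u s. ennreal \<bar>b x - g x\<bar> \<partial>lborel) \<le> ennreal e"
    using set_nn_integral_eq_LINT[OF set_integrable_abs[OF di]] bg by (simp add: ennreal_leI)
  define v where "v = (\<chi> i. u $ i + s)"
  have sub: "cube u s \<subseteq> cbox u v" by (auto simp: cube_def v_def mem_box_cart less_imp_le)
  have "uniformly_continuous_on (cbox u v) g"
    by (intro compact_uniformly_continuous continuous_on_subset[OF g]) auto
  moreover have "0 < e / s ^ CARD('n)" using e s by simp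
  ultimately obtain d where d: "0 < d"
      "\<And>y z. y \<in> cbox u v \<Longrightarrow> z \<in> cbox u v \<Longrightarrow> dist z y < d \<Longrightarrow> dist (g z) (g y) < e / s ^ CARD('n)"
    unfolding uniformly_continuous_on_def by metis
  obtain K where K: "(1 / 2 :: real) ^ K < d / (real CARD('n) * s)"
    using real_arch_pow_inv[of "d / (real CARD('n) * s)" "1 / 2"] d s by auto
  have main: "(\<integral>\<^sup>+x\<in>cube u s. ennreal \<bar>dyadic_avg k b u s x - b x\<bar> \<partial>lborel) \<le> ennreal (3 * e)" if "K \<le> k" for k
  proof -
    have "(1 / 2 :: real) ^ k \<le> (1 / 2) ^ K" using that by (intro power_decreasing) auto
    also note K
    finally have "(1 / 2) ^ k < d / (real CARD('n) * s)" .
    then have small_k: "real CARD('n) * (s / 2 ^ k) < d" using s by (simp add: field_simps)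
    have close: "\<bar>dyadic_avg k g u s x - g x\<bar> \<le> e / s ^ CARD('n)" if "x \<in> cube u s" for x
    proof (rule dyadic_avg_uniformly_close[OF g s that])
      fix y z assume "y \<in> cube u s" "z \<in> cube u s" "norm (y - z) \<le> real CARD('n) * (s / 2 ^ k)"
      then show "\<bar>g y - g z\<bar> \<le> e / s ^ CARD('n)"
        using d(2)[of z y] sub small_k by (force simp: dist_norm)
    qed
    have "ennreal \<bar>dyadic_avg k b u s x - b x\<bar> * indicator (cube u s) x \<le>
       ennreal \<bar>dyadic_avg k (\<lambda>x. b x - g x) u s x\<bar> * indicator (cube u s) x +
       (ennreal (e / s ^ CARD('n)) * indicator (cube u s) x + ennreal \<bar>b x - g x\<bar> * indicator (cube u s) x)" for x
    proof (cases "x \<in> cube u s")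
      case True
      have "\<bar>dyadic_avg k b u s x - b x\<bar> \<le> \<bar>dyadic_avg k (\<lambda>x. b x - g x) u s x\<bar> + (e / s ^ CARD('n) + \<bar>b x - g x\<bar>)"
        using close[OF True] by (simp add: dyadic_avg_diff[OF int gi s])
      then show ?thesis using True e s by (simp add: ennreal_plus[symmetric] ennreal_leI del: ennreal_plus)
    qed simp
    then have "(\<integral>\<^sup>+x\<in>cube u s. ennreal \<bar>dyadic_avg k b u s x - b x\<bar> \<partial>lborel) \<le>
       (\<integral>\<^sup>+x. ennreal \<bar>dyadic_avg k (\<lambda>x. b x - g x) u s x\<bar> * indicator (cube u s) x +
       (ennreal (e / s ^ CARD('n)) * indicator (cube u s) x + ennreal \<bar>b x - g x\<bar> * indicator (cube u s) x) \<partial>lborel)"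
      by (intro nn_integral_mono)
    also have "\<dots> = (\<integral>\<^sup>+x\<in>cube u s. ennreal \<bar>dyadic_avg k (\<lambda>x. b x - g x) u s x\<bar> \<partial>lborel) +
       (ennreal (e / s ^ CARD('n)) * emeasure lborel (cube u s) + (\<integral>\<^sup>+x\<in>cube u s. ennreal \<bar>b x - g x\<bar> \<partial>lborel))"
      by (simp add: nn_integral_add nn_integral_cmult_indicator)
    also have "\<dots> \<le> ennreal e + (ennreal e + ennreal e)"
    proof (intro add_mono small)
      show "(\<integral>\<^sup>+x\<in>cube u s. ennreal \<bar>dyadic_avg k (\<lambda>x. b x - g x) u s x\<bar> \<partial>lborel) \<le> ennreal e"
        by (rule order_trans[OF nn_integral_dyadic_avg_le[OF di _ s] small]) simp
      show "ennreal (e / s ^ CARD('n)) * emeasure lborel (cube u s) \<le> ennreal e"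
        using e s by (simp add: emeasure_cube ennreal_mult[symmetric])
    qed
    also have "\<dots> = ennreal (3 * e)" using e by (simp add: ennreal_plus[symmetric] del: ennreal_plus)
    finally show ?thesis .
  qed
  show ?thesis using main by blast
qed

lemma dyadic_avg_tendsto_subseq:
  fixes b :: "real ^ 'n::finite \<Rightarrow> real"
  assumes b [measurable]: "b \<in> borel_measurable borel" and int: "set_integrable lborel (cube u s) b"
    and s: "0 < s"
  obtains r where "strict_mono (r :: nat \<Rightarrow> nat)"
    "AE x in lborel. x \<in> cube u s \<longrightarrow> (\<lambda>k. dyadic_avg (r k) b u s x) \<longlonglongrightarrow> b x"
proof -
  define w where "w = (\<lambda>k x. indicator (cube u s) x * (dyadic_avg k b u s x - b x))"
  have nw: "(\<integral>\<^sup>+x. ennreal (norm (w k x)) \<partial>lborel) = (\<integral>\<^sup>+x\<in>cube u s. ennreal \<bar>dyadic_avg k b u s x - b x\<bar> \<partial>lborel)" for k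
    by (intro nn_integral_cong) (auto simp: w_def indicator_def)
  have fin: "(\<integral>\<^sup>+x\<in>cube u s. ennreal \<bar>b x\<bar> \<partial>lborel) < top"
    using set_nn_integral_eq_LINT[OF set_integrable_abs[OF int]] by simp
  have [measurable]: "w k \<in> borel_measurable lborel" for k unfolding w_def by measurable
  have wi: "integrable lborel (w k)" for k
  proof (rule integrableI_bounded)
    have "(\<integral>\<^sup>+x. ennreal (norm (w k x)) \<partial>lborel) \<le>
       (\<integral>\<^sup>+x. ennreal \<bar>dyadic_avg k b u s x\<bar> * indicator (cube u s) x + ennreal \<bar>b x\<bar> * indicator (cube u s) x \<partial>lborel)"
      by (intro nn_integral_mono)
        (auto simp: w_def ennreal_plus[symmetric] simp del: ennreal_plus intro!: ennreal_leI split: split_indicator)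
    also have "\<dots> = (\<integral>\<^sup>+x\<in>cube u s. ennreal \<bar>dyadic_avg k b u s x\<bar> \<partial>lborel) + (\<integral>\<^sup>+x\<in>cube u s. ennreal \<bar>b x\<bar> \<partial>lborel)"
      by (simp add: nn_integral_add)
    also have "\<dots> < \<infinity>"
      using order.strict_trans1[OF nn_integral_dyadic_avg_le[OF int b s] fin] fin by (simp add: ennreal_add_less_top)
    finally show "(\<integral>\<^sup>+x. ennreal (norm (w k x)) \<partial>lborel) < \<infinity>" .
  qed simp
  have "(\<lambda>k. LINT x|lborel. norm (w k x)) \<longlonglongrightarrow> 0"
  proof (rule LIMSEQ_I)
    fix e :: real assume "0 < e"
    then obtain K where K: "\<forall>k\<ge>K. (\<integral>\<^sup>+x. ennreal (norm (w k x)) \<partial>lborel) \<le> ennreal (3 * (e / 6))"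
      using dyadic_avg_L1_close[OF b int s, of "e / 6"] unfolding nw by auto
    have "norm ((LINT x|lborel. norm (w k x)) - 0) < e" if "K \<le> k" for k
    proof -
      have "ennreal (LINT x|lborel. norm (w k x)) \<le> ennreal (3 * (e / 6))"
        using K that nn_integral_eq_integral[OF integrable_norm[OF wi]] by simp
      then have "(LINT x|lborel. norm (w k x)) \<le> 3 * (e / 6)"
        using \<open>0 < e\<close> by (subst (asm) ennreal_le_iff) auto
      moreover have "0 \<le> (LINT x|lborel. norm (w k x))" by simp
      ultimately show ?thesis using \<open>0 < e\<close> by (simp del: integral_nonneg_AE)
    qed
    then show "\<exists>K. \<forall>k\<ge>K. norm ((LINT x|lborel. norm (w k x)) - 0) < e" by blast
  qed
  then obtain r where r: "strict_mono r" "AE x in lborel. (\<lambda>k. w (r k) x) \<longlonglongrightarrow> 0"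
    using tendsto_L1_AE_subseq[of lborel w] wi by blast
  have "(\<lambda>k. dyadic_avg (r k) b u s x) \<longlonglongrightarrow> b x" if "(\<lambda>k. w (r k) x) \<longlonglongrightarrow> 0" "x \<in> cube u s" for x
    using that by (simp add: w_def LIM_zero_iff)
  then have "AE x in lborel. x \<in> cube u s \<longrightarrow> (\<lambda>k. dyadic_avg (r k) b u s x) \<longlonglongrightarrow> b x"
    using r(2) by (auto elim: eventually_mono)
  then show ?thesis using that r(1) by blast
qed

text \<open>Fatou's lemma along a subsequence of dyadic averages that converges almost everywhere;
  the bound does not depend on the generation.\<close>

lemma John_Nirenberg_exp:
  fixes b :: "real ^ 'n::finite \<Rightarrow> real"
  assumes b [measurable]: "b \<in> borel_measurable borel" and int: "set_integrable lborel (cube u s) b"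
    and \<kappa>: "0 < \<kappa>" and s: "0 < s"
    and osc: "\<And>u' s'. 0 < s' \<Longrightarrow> cube u' s' \<subseteq> cube u s \<Longrightarrow>
      (LINT x:cube u' s'|lborel. \<bar>b x - cube_avg b u' s'\<bar>) \<le> \<kappa> * s' ^ CARD('n)"
    and \<mu>: "\<mu> = ln 2 / ((4 + 2 ^ CARD('n)) * \<kappa>)"
  shows "(\<integral>\<^sup>+x\<in>cube u s. ennreal (exp (\<mu> * \<bar>b x - cube_avg b u s\<bar>)) \<partial>lborel) \<le> ennreal (4 * s ^ CARD('n))"
proof -
  define v where "v = cube_avg b u s"
  obtain r where r: "strict_mono (r :: nat \<Rightarrow> nat)"
    "AE x in lborel. x \<in> cube u s \<longrightarrow> (\<lambda>k. dyadic_avg (r k) b u s x) \<longlonglongrightarrow> b x"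
    using dyadic_avg_tendsto_subseq[OF b int s] .
  have "(\<integral>\<^sup>+x\<in>cube u s. ennreal (exp (\<mu> * \<bar>b x - v\<bar>)) \<partial>lborel) =
     (\<integral>\<^sup>+x. liminf (\<lambda>k. ennreal (exp (\<mu> * \<bar>dyadic_avg (r k) b u s x - v\<bar>)) * indicator (cube u s) x) \<partial>lborel)"
  proof (rule nn_integral_cong_AE)
    have "ennreal (exp (\<mu> * \<bar>b x - v\<bar>)) * indicator (cube u s) x =
      liminf (\<lambda>k. ennreal (exp (\<mu> * \<bar>dyadic_avg (r k) b u s x - v\<bar>)) * indicator (cube u s) x)"
      if *: "x \<in> cube u s \<longrightarrow> (\<lambda>k. dyadic_avg (r k) b u s x) \<longlonglongrightarrow> b x" for x
    proof (rule lim_imp_Liminf[symmetric])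
      show "(\<lambda>k. ennreal (exp (\<mu> * \<bar>dyadic_avg (r k) b u s x - v\<bar>)) * indicator (cube u s) x) \<longlonglongrightarrow>
          ennreal (exp (\<mu> * \<bar>b x - v\<bar>)) * indicator (cube u s) x"
        using * by (cases "x \<in> cube u s") (auto intro!: tendsto_intros)
    qed simp
    then show "AE x in lborel. ennreal (exp (\<mu> * \<bar>b x - v\<bar>)) * indicator (cube u s) x =
      liminf (\<lambda>k. ennreal (exp (\<mu> * \<bar>dyadic_avg (r k) b u s x - v\<bar>)) * indicator (cube u s) x)"
      using r(2) by (auto elim: eventually_mono)
  qed
  also have "\<dots> \<le> liminf (\<lambda>k. \<integral>\<^sup>+x\<in>cube u s. ennreal (exp (\<mu> * \<bar>dyadic_avg (r k) b u s x - v\<bar>)) \<partial>lborel)"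
    by (rule nn_integral_liminf) measurable
  also have "\<dots> \<le> liminf (\<lambda>k::nat. ennreal (4 * s ^ CARD('n)))"
  proof (intro Liminf_mono always_eventually allI)
    fix k
    show "(\<integral>\<^sup>+x\<in>cube u s. ennreal (exp (\<mu> * \<bar>dyadic_avg (r k) b u s x - v\<bar>)) \<partial>lborel) \<le> ennreal (4 * s ^ CARD('n))"
      unfolding nn_integral_exp_dyadic_avg[OF s] v_def
      by (intro ennreal_leI dyadic_exp_sum_bounded[OF int \<kappa> osc s _ \<mu>]) auto
  qed
  also have "\<dots> = ennreal (4 * s ^ CARD('n))" by (simp add: Liminf_const)
  finally show ?thesis unfolding v_def .
qed

text \<open>Raising \<open>y \<le> exp y\<close> with \<open>y = \<mu> t / \<sigma>\<close> to the power \<open>\<sigma>\<close>.\<close>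

lemma powr_le_exp:
  fixes t \<mu> \<sigma> :: real
  assumes "0 \<le> t" "0 < \<mu>" "0 < \<sigma>"
  shows "t powr \<sigma> \<le> (\<sigma> / \<mu>) powr \<sigma> * exp (\<mu> * t)"
proof -
  have "\<mu> * t / \<sigma> \<le> exp (\<mu> * t / \<sigma>)"
    using exp_ge_add_one_self[of "\<mu> * t / \<sigma>"] by linarith
  then have "t \<le> \<sigma> / \<mu> * exp (\<mu> * t / \<sigma>)" using assms by (simp add: field_simps)
  then have "t powr \<sigma> \<le> (\<sigma> / \<mu> * exp (\<mu> * t / \<sigma>)) powr \<sigma>"
    using assms by (intro powr_mono2) auto
  also have "\<dots> = (\<sigma> / \<mu>) powr \<sigma> * exp (\<mu> * t)"
    using assms by (simp only: powr_mult exp_powr_real) simp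
  finally show ?thesis .
qed

text \<open>Averaging \<open>b x - b y\<close> in \<open>y\<close> first gives \<open>b x\<close> minus the mean of \<open>b\<close>.\<close>

lemma cube_avg_osc_le_pair_osc:
  fixes b :: "real ^ 'n::finite \<Rightarrow> real"
  assumes b [measurable]: "b \<in> borel_measurable borel" and int: "set_integrable lborel (cube u s) b"
    and s: "0 < s" and "0 \<le> \<kappa>" and pair: "pair_osc lborel b (cube u s) \<le> ennreal (\<kappa> * (s ^ CARD('n))\<^sup>2)"
  shows "(LINT x:cube u s|lborel. \<bar>b x - cube_avg b u s\<bar>) \<le> \<kappa> * s ^ CARD('n)"
proof -
  let ?N = "s ^ CARD('n)"
  let ?J = "LINT x:cube u s|lborel. \<bar>b x - cube_avg b u s\<bar>"
  have J: "0 \<le> ?J" by (simp add: set_lebesgue_integral_def)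
  have "ennreal ?N * ennreal ?J = (\<integral>\<^sup>+x. ennreal ?N * (ennreal \<bar>b x - cube_avg b u s\<bar> * indicator (cube u s) x) \<partial>lborel)"
    using set_nn_integral_eq_LINT[OF set_integrable_abs_diff[OF int s, of "cube_avg b u s"]]
    by (subst nn_integral_cmult) auto
  also have "\<dots> \<le> pair_osc lborel b (cube u s)"
    unfolding pair_osc_def
  proof (intro nn_integral_mono)
    fix x
    have "ennreal ?N * ennreal \<bar>b x - cube_avg b u s\<bar> \<le> ennreal (LINT y:cube u s|lborel. \<bar>b y - b x\<bar>)"
      using cube_avg_diff_le[OF int s, of "b x"] s
      by (simp add: ennreal_mult[symmetric] ennreal_leI mult.commute abs_minus_commute)
    also have "\<dots> = (\<integral>\<^sup>+y\<in>cube u s. ennreal \<bar>b x - b y\<bar> \<partial>lborel)"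
      using set_nn_integral_eq_LINT[OF set_integrable_abs_diff[OF int s, of "b x"]] by (simp add: abs_minus_commute)
    finally show "ennreal ?N * (ennreal \<bar>b x - cube_avg b u s\<bar> * indicator (cube u s) x) \<le>
      (\<integral>\<^sup>+y\<in>cube u s. ennreal \<bar>b x - b y\<bar> \<partial>lborel) * indicator (cube u s) x"
      by (auto split: split_indicator)
  qed
  also note pair
  finally have "ennreal (?N * ?J) \<le> ennreal (\<kappa> * ?N\<^sup>2)" using s J by (simp add: ennreal_mult)
  then have "?N * ?J \<le> ?N * (\<kappa> * ?N)"
    using assms(4) s by (subst (asm) ennreal_le_iff) (auto simp: power2_eq_square mult_ac)
  then show ?thesis using s by simp
qed

text \<open>Both \<open>b x\<close> and \<open>b y\<close> are compared with the average over the cube. The bound is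
  homogeneous of degree \<open>\<sigma>\<close> in \<open>\<kappa>\<close>, because the exponential rate \<open>\<mu>\<close> is inversely
  proportional to \<open>\<kappa>\<close>.\<close>

lemma John_Nirenberg_pair:
  fixes b :: "real ^ 'n::finite \<Rightarrow> real"
  assumes b [measurable]: "b \<in> borel_measurable borel" and int: "set_integrable lborel (cube u s) b"
    and \<kappa>: "0 < \<kappa>" and s: "0 < s" and \<sigma>: "0 < \<sigma>"
    and osc: "\<And>u' s'. 0 < s' \<Longrightarrow> cube u' s' \<subseteq> cube u s \<Longrightarrow>
      pair_osc lborel b (cube u' s') \<le> ennreal (\<kappa> * (s' ^ CARD('n))\<^sup>2)"
  shows "(\<integral>\<^sup>+x\<in>cube u s. (\<integral>\<^sup>+y\<in>cube u s. ennreal (\<bar>b x - b y\<bar> powr \<sigma>) \<partial>lborel) \<partial>lborel) \<le>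
    ennreal (8 * 2 powr \<sigma> * (\<sigma> * (4 + 2 ^ CARD('n)) / ln 2) powr \<sigma> * \<kappa> powr \<sigma> * (s ^ CARD('n))\<^sup>2)"
proof -
  let ?N = "s ^ CARD('n)"
  let ?Q = "cube u s"
  define \<mu> where "\<mu> = ln 2 / ((4 + 2 ^ CARD('n)) * \<kappa>)"
  have pos: "0 < (4 + 2 ^ CARD('n) :: real)" by (simp add: add_pos_pos)
  have mu: "0 < \<mu>" using \<kappa> pos by (simp add: \<mu>_def)
  define v where "v = cube_avg b u s"
  define D where "D = (\<sigma> / \<mu>) powr \<sigma>"
  have D: "D = (\<sigma> * (4 + 2 ^ CARD('n)) / ln 2) powr \<sigma> * \<kappa> powr \<sigma>"
    using \<sigma> \<kappa> pos unfolding D_def \<mu>_def by (simp add: powr_mult powr_divide mult_ac)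
  have D0: "0 \<le> D" by (simp add: D_def)
  have "(\<integral>\<^sup>+x\<in>?Q. ennreal (exp (\<mu> * \<bar>b x - v\<bar>)) \<partial>lborel) \<le> ennreal (4 * ?N)"
    unfolding v_def
    using \<kappa> by (intro John_Nirenberg_exp[OF b int \<kappa> s _ \<mu>_def] cube_avg_osc_le_pair_osc osc set_integrable_subset[OF int]) auto
  then have "ennreal D * (\<integral>\<^sup>+x\<in>?Q. ennreal (exp (\<mu> * \<bar>b x - v\<bar>)) \<partial>lborel) \<le> ennreal (D * (4 * ?N))"
    using D0 s by (subst ennreal_mult) (auto intro: mult_left_mono)
  moreover have "(\<integral>\<^sup>+x\<in>?Q. ennreal (\<bar>b x - v\<bar> powr \<sigma>) \<partial>lborel) \<le> ennreal D * (\<integral>\<^sup>+x\<in>?Q. ennreal (exp (\<mu> * \<bar>b x - v\<bar>)) \<partial>lborel)"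
  proof -
    have "(\<integral>\<^sup>+x\<in>?Q. ennreal (\<bar>b x - v\<bar> powr \<sigma>) \<partial>lborel) \<le> (\<integral>\<^sup>+x. ennreal D * (ennreal (exp (\<mu> * \<bar>b x - v\<bar>)) * indicator ?Q x) \<partial>lborel)"
      using powr_le_exp[OF abs_ge_zero mu \<sigma>] D0 unfolding D_def
      by (intro nn_integral_mono) (auto simp: ennreal_mult[symmetric] intro!: ennreal_leI split: split_indicator)
    then show ?thesis by (simp add: nn_integral_cmult)
  qed
  ultimately have mom: "(\<integral>\<^sup>+x\<in>?Q. ennreal (\<bar>b x - v\<bar> powr \<sigma>) \<partial>lborel) \<le> ennreal (D * (4 * ?N))" by simp
  have tri: "ennreal (\<bar>b x - b y\<bar> powr \<sigma>) \<le> ennreal (2 powr \<sigma>) * (ennreal (\<bar>b x - v\<bar> powr \<sigma>) + ennreal (\<bar>b y - v\<bar> powr \<sigma>))" for x y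
  proof -
    have "ennreal (\<bar>b x - b y\<bar> powr \<sigma>) = ennreal_powr (ennreal \<bar>b x - b y\<bar>) \<sigma>" by (simp add: ennreal_powr_ennreal)
    also have "\<dots> \<le> ennreal_powr (ennreal \<bar>b x - v\<bar> + ennreal \<bar>b y - v\<bar>) \<sigma>"
      using \<sigma> by (intro ennreal_powr_mono) (auto simp: ennreal_plus[symmetric] simp del: ennreal_plus intro!: ennreal_leI)
    also have "\<dots> \<le> ennreal (2 powr \<sigma>) * (ennreal_powr (ennreal \<bar>b x - v\<bar>) \<sigma> + ennreal_powr (ennreal \<bar>b y - v\<bar>) \<sigma>)"
      by (rule ennreal_powr_sum_le[OF \<sigma>])
    finally show ?thesis by (simp add: ennreal_powr_ennreal)
  qed
  have inner: "(\<integral>\<^sup>+y\<in>?Q. ennreal (\<bar>b x - b y\<bar> powr \<sigma>) \<partial>lborel) \<le>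
      ennreal (2 powr \<sigma>) * (ennreal (\<bar>b x - v\<bar> powr \<sigma>) * ennreal ?N + ennreal (D * (4 * ?N)))" for x
  proof -
    have "(\<integral>\<^sup>+y\<in>?Q. ennreal (\<bar>b x - b y\<bar> powr \<sigma>) \<partial>lborel) \<le>
      (\<integral>\<^sup>+y. ennreal (2 powr \<sigma>) * (ennreal (\<bar>b x - v\<bar> powr \<sigma>) * indicator ?Q y + ennreal (\<bar>b y - v\<bar> powr \<sigma>) * indicator ?Q y) \<partial>lborel)"
      using tri[of x] by (intro nn_integral_mono) (auto split: split_indicator)
    also have "\<dots> = ennreal (2 powr \<sigma>) * (ennreal (\<bar>b x - v\<bar> powr \<sigma>) * ennreal ?N + (\<integral>\<^sup>+y\<in>?Q. ennreal (\<bar>b y - v\<bar> powr \<sigma>) \<partial>lborel))"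
      using s by (simp add: nn_integral_cmult nn_integral_add nn_integral_cmult_indicator emeasure_cube)
    finally show ?thesis using mom by (meson add_left_mono mult_left_mono order_trans zero_le)
  qed
  have "(\<integral>\<^sup>+x\<in>?Q. (\<integral>\<^sup>+y\<in>?Q. ennreal (\<bar>b x - b y\<bar> powr \<sigma>) \<partial>lborel) \<partial>lborel) \<le>
     (\<integral>\<^sup>+x. ennreal (2 powr \<sigma>) * (ennreal ?N * (ennreal (\<bar>b x - v\<bar> powr \<sigma>) * indicator ?Q x) + ennreal (D * (4 * ?N)) * indicator ?Q x) \<partial>lborel)"
    using inner by (intro nn_integral_mono) (auto simp: mult_ac split: split_indicator)
  also have "\<dots> = ennreal (2 powr \<sigma>) * (ennreal ?N * (\<integral>\<^sup>+x\<in>?Q. ennreal (\<bar>b x - v\<bar> powr \<sigma>) \<partial>lborel) + ennreal (D * (4 * ?N)) * ennreal ?N)"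
    using s by (simp add: nn_integral_cmult nn_integral_add nn_integral_cmult_indicator emeasure_cube)
  also have "\<dots> \<le> ennreal (2 powr \<sigma>) * (ennreal ?N * ennreal (D * (4 * ?N)) + ennreal (D * (4 * ?N)) * ennreal ?N)"
    by (intro mult_left_mono add_mono mom) auto
  also have "\<dots> = ennreal (8 * 2 powr \<sigma> * D * ?N\<^sup>2)"
    using s D0 by (simp add: ennreal_mult[symmetric] ennreal_plus[symmetric] power2_eq_square algebra_simps del: ennreal_plus)
  finally show ?thesis unfolding D by (simp add: mult_ac)
qed

lemma cube_subset_side_le:
  fixes u :: "real ^ 'n::finite"
  assumes "cube u' s' \<subseteq> cube u s" "0 < s'" "0 < s"
  shows "s' \<le> s"
proof -
  have "emeasure lborel (cube u' s') \<le> emeasure lborel (cube u s)"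
    using assms by (intro emeasure_mono) auto
  then have "s' ^ CARD('n) \<le> s ^ CARD('n)" using assms by (simp add: emeasure_cube)
  then show ?thesis using power_strict_mono[of s s' "CARD('n)"] assms by (force simp: not_le[symmetric])
qed

lemma local_cube_subcube:
  fixes u :: "real ^ 'n::finite"
  assumes "local_cube A u s" "cube u' s' \<subseteq> cube u s" "0 < s'"
  shows "local_cube (A + real CARD('n) * A\<^sup>2) u' s'"
proof -
  have s: "0 < s" "s \<le> A" "s * norm u \<le> A" using assms by (auto simp: local_cube_def)
  have le: "s' \<le> s" using cube_subset_side_le assms s by blast
  have "u' \<in> cube u s" using assms mem_cube_corner by blast
  then have "norm (u' - u) \<le> real CARD('n) * s" by (rule norm_diff_cube_le)
  then have "norm u' \<le> norm u + real CARD('n) * s" using norm_triangle_sub[of u' u] by simp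
  then have "s' * norm u' \<le> s * (norm u + real CARD('n) * s)"
    using le s by (intro mult_mono) auto
  also have "\<dots> = s * norm u + real CARD('n) * (s * s)" by (simp add: algebra_simps)
  also have "\<dots> \<le> A + real CARD('n) * A\<^sup>2"
    unfolding power2_eq_square using s by (intro add_mono mult_left_mono mult_mono) auto
  finally have "s' * norm u' \<le> A + real CARD('n) * A\<^sup>2" .
  moreover have "s' \<le> A + real CARD('n) * A\<^sup>2" proof (rule order_trans)
    show "s' \<le> A" using le s by simp
  qed simp
  ultimately show ?thesis using assms(3) by (simp add: local_cube_def)
qed

text \<open>Every subcube of a local cube is local with a larger constant, so the condition on
  balls controls the oscillation at all smaller scales, as John--Nirenberg requires. The
  two passages between \<open>\<gamma>\<close> and Lebesgue measure cost only powers of the density ratio,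
  since both sides are quadratic in the measure.\<close>

lemma gauss_power_oscillation:
  fixes A \<sigma> :: real
  assumes "0 < A" "0 < \<sigma>"
  obtains C where "0 < C"
    "\<And>(b :: real ^ 'n::finite \<Rightarrow> real) \<kappa> u s. \<lbrakk>integrable gauss_measure b; 0 < \<kappa>;
      \<And>B. B \<in> admissible_balls 1 \<Longrightarrow> pair_osc gauss_measure b B \<le> ennreal \<kappa> * (emeasure gauss_measure B)\<^sup>2;
      local_cube A u s\<rbrakk> \<Longrightarrow>
      (\<integral>\<^sup>+x\<in>cube u s. (\<integral>\<^sup>+y\<in>cube u s. ennreal (\<bar>b x - b y\<bar> powr \<sigma>) \<partial>gauss_measure) \<partial>gauss_measure)
        \<le> ennreal (C * \<kappa> powr \<sigma>) * (emeasure gauss_measure (cube u s))\<^sup>2"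
proof -
  define A' where "A' = A + real CARD('n) * A\<^sup>2"
  have "0 < A'" using assms by (auto simp: A'_def intro: add_pos_nonneg)
  obtain C0 where C0: "0 < C0"
    "\<And>(b :: real ^ 'n::finite \<Rightarrow> real) \<kappa> u s. \<lbrakk>b \<in> borel_measurable borel;
      \<And>B. B \<in> admissible_balls 1 \<Longrightarrow> pair_osc gauss_measure b B \<le> \<kappa> * (emeasure gauss_measure B)\<^sup>2;
      local_cube A' u s\<rbrakk> \<Longrightarrow> pair_osc lborel b (cube u s) \<le> ennreal C0 * \<kappa> * (ennreal (s ^ CARD('n)))\<^sup>2"
    using pair_osc_cube_of_balls[OF zero_less_one \<open>0 < A'\<close>, where 'n = 'n] by metis
  define K where "K = local_ratio TYPE('n) A"
  have K: "1 \<le> K" unfolding K_def using assms by (intro local_ratio_ge_1) simp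
  define L where "L = 8 * 2 powr \<sigma> * (\<sigma> * (4 + 2 ^ CARD('n)) / ln 2) powr \<sigma>"
  have pos: "0 < (4 + 2 ^ CARD('n) :: real)" by (simp add: add_pos_pos)
  have L: "0 < L" using assms pos by (simp add: L_def)
  define C where "C = K ^ 4 * L * C0 powr \<sigma>"
  have "0 < C" using K L C0(1) by (simp add: C_def)
  have main: "(\<integral>\<^sup>+x\<in>cube u s. (\<integral>\<^sup>+y\<in>cube u s. ennreal (\<bar>b x - b y\<bar> powr \<sigma>) \<partial>gauss_measure) \<partial>gauss_measure)
        \<le> ennreal (C * \<kappa> powr \<sigma>) * (emeasure gauss_measure (cube u s))\<^sup>2"
    if int: "integrable gauss_measure b" and \<kappa>: "0 < \<kappa>"
      and osc: "\<And>B. B \<in> admissible_balls 1 \<Longrightarrow> pair_osc gauss_measure b B \<le> ennreal \<kappa> * (emeasure gauss_measure B)\<^sup>2"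
      and g: "local_cube A u s" for b :: "real ^ 'n \<Rightarrow> real" and \<kappa> u s
  proof -
    have b [measurable]: "b \<in> borel_measurable borel"
      using borel_measurable_integrable[OF int] by simp
    have s: "0 < s" using g by (simp add: local_cube_def)
    define w where "w = gauss_density u"
    have w: "0 < w" by (simp add: w_def gauss_density_pos)
    define N where "N = s ^ CARD('n)"
    have N: "0 < N" using s by (simp add: N_def)
    let ?I = "\<lambda>M. \<integral>\<^sup>+x\<in>cube u s. (\<integral>\<^sup>+y\<in>cube u s. ennreal (\<bar>b x - b y\<bar> powr \<sigma>) \<partial>M) \<partial>M"
    let ?L = "L * (C0 * \<kappa>) powr \<sigma> * N\<^sup>2"
    have eQ: "ennreal (w / K * N) \<le> emeasure gauss_measure (cube u s)"
      using emeasure_gauss_cube(1)[OF g] by (simp add: w_def K_def N_def)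
    have intQ: "set_integrable lborel (cube u s) b"
      unfolding set_integrable_def
    proof (rule integrableI_bounded)
      have "(\<integral>\<^sup>+x. ennreal (norm (indicator (cube u s) x *\<^sub>R b x)) \<partial>lborel) = (\<integral>\<^sup>+x\<in>cube u s. ennreal \<bar>b x\<bar> \<partial>lborel)"
        by (intro nn_integral_cong) (auto simp: indicator_def)
      also have "\<dots> \<le> ennreal (1 / (w / K)) * (\<integral>\<^sup>+x\<in>cube u s. ennreal \<bar>b x\<bar> \<partial>gauss_measure)"
        using w K gauss_density_cube(1)[OF g] by (intro nn_integral_lborel_le_gauss) (auto simp: w_def K_def)
      also have "(\<integral>\<^sup>+x\<in>cube u s. ennreal \<bar>b x\<bar> \<partial>gauss_measure) \<le> (\<integral>\<^sup>+x. ennreal (norm (b x)) \<partial>gauss_measure)"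
        by (intro nn_integral_mono) (auto simp: indicator_def)
      also have "ennreal (1 / (w / K)) * \<dots> < \<infinity>"
        using int by (simp add: integrable_iff_bounded ennreal_mult_less_top)
      finally show "(\<integral>\<^sup>+x. ennreal (norm (indicator (cube u s) x *\<^sub>R b x)) \<partial>lborel) < \<infinity>"
        by (simp add: mult_left_mono)
    qed simp
    have step1: "?I gauss_measure
      \<le> ennreal ((K * w)\<^sup>2) * ?I lborel"
      using K w gauss_density_cube(2)[OF g]
      by (intro double_integral_gauss_le) (auto simp: K_def w_def)
    have step2: "ennreal ((K * w)\<^sup>2) * ?I lborel \<le> ennreal ((K * w)\<^sup>2) * ennreal (?L)"
    proof (rule mult_left_mono)
    show "?I lborel
      \<le> ennreal (?L)"
      unfolding L_def N_def
    proof (rule John_Nirenberg_pair[OF b intQ _ s assms(2)])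
      show "0 < C0 * \<kappa>" using C0(1) \<kappa> by simp
      fix u' :: "real ^ 'n" and s' :: real assume *: "0 < s'" "cube u' s' \<subseteq> cube u s"
      have "pair_osc lborel b (cube u' s') \<le> ennreal C0 * ennreal \<kappa> * (ennreal (s' ^ CARD('n)))\<^sup>2"
        using *
        by (intro C0(2) b osc local_cube_subcube[OF g, folded A'_def]) auto
      then show "pair_osc lborel b (cube u' s') \<le> ennreal (C0 * \<kappa> * (s' ^ CARD('n))\<^sup>2)"
        using C0(1) \<kappa> * by (simp add: ennreal_mult ennreal_power)
    qed
    qed simp
    have step3: "ennreal ((K * w)\<^sup>2) * ennreal (?L) = ennreal (C * \<kappa> powr \<sigma> * (w / K * N)\<^sup>2)"
    proof -
      have "(K * w)\<^sup>2 * (?L) = C * \<kappa> powr \<sigma> * (w / K * N)\<^sup>2"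
      proof -
        have "(C0 * \<kappa>) powr \<sigma> = C0 powr \<sigma> * \<kappa> powr \<sigma>" by (rule powr_mult)
        moreover have "(K * w)\<^sup>2 * (L * (d * k) * N\<^sup>2) = K ^ 4 * L * d * k * (w / K * N)\<^sup>2" for d k
        proof -
          have "(K * w)\<^sup>2 = K ^ 4 * (w / K)\<^sup>2"
            using K by (simp add: power_divide power_mult_distrib power2_eq_square power4_eq_xxxx)
          then show ?thesis by (simp only: power_mult_distrib mult_ac)
        qed
        ultimately show ?thesis unfolding C_def by simp
      qed
      moreover have "ennreal ((K * w)\<^sup>2) * ennreal (?L) = ennreal ((K * w)\<^sup>2 * (?L))"
        using L by (intro ennreal_mult[symmetric]) auto
      ultimately show ?thesis by (simp only:)
    qed
    have step4: "ennreal (C * \<kappa> powr \<sigma> * (w / K * N)\<^sup>2) = ennreal (C * \<kappa> powr \<sigma>) * (ennreal (w / K * N))\<^sup>2"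
      using ennreal_mult_square[of "C * \<kappa> powr \<sigma>" "w / K * N" 1] \<open>0 < C\<close> w K N
      by (simp only: mult_1_left mult_1_right mult_nonneg_nonneg divide_nonneg_nonneg powr_ge_zero less_imp_le zero_le_one order_trans[OF zero_le_one K])
    have step5: "ennreal (C * \<kappa> powr \<sigma>) * (ennreal (w / K * N))\<^sup>2 \<le> ennreal (C * \<kappa> powr \<sigma>) * (emeasure gauss_measure (cube u s))\<^sup>2"
      by (intro mult_left_mono power_mono eQ) simp_all
    show ?thesis
      by (rule order_trans[OF step1 order_trans[OF step2[unfolded step3 step4] step5]])
  qed
  show ?thesis by (rule that[OF \<open>0 < C\<close> main])
qed

section \<open>A fractional Carleson embedding\<close>

lemma sum_set_nn_integral_swap:
  assumes I: "countable I" and [measurable]: "G \<in> borel_measurable M"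
    and A: "\<And>i. i \<in> I \<Longrightarrow> A i \<in> sets M"
  shows "(\<integral>\<^sup>+i. c i * (\<integral>\<^sup>+x\<in>A i. G x \<partial>M) \<partial>count_space I) =
    (\<integral>\<^sup>+x. G x * (\<integral>\<^sup>+i. c i * indicator (A i) x \<partial>count_space I) \<partial>M)"
proof -
  have [measurable]: "(\<lambda>x. G x * (c i * indicator (A i) x)) \<in> borel_measurable M" if "i \<in> I" for i
    using A[OF that] by measurable
  have "c i * (\<integral>\<^sup>+x\<in>A i. G x \<partial>M) = (\<integral>\<^sup>+x. G x * (c i * indicator (A i) x) \<partial>M)" if "i \<in> I" for i
    using A[OF that] by (subst nn_integral_cmult[symmetric]) (auto intro!: nn_integral_cong simp: mult_ac)
  then have "(\<integral>\<^sup>+i. c i * (\<integral>\<^sup>+x\<in>A i. G x \<partial>M) \<partial>count_space I) =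
      (\<integral>\<^sup>+i. \<integral>\<^sup>+x. G x * (c i * indicator (A i) x) \<partial>M \<partial>count_space I)"
    by (intro nn_integral_cong) simp
  also have "\<dots> = (\<integral>\<^sup>+x. \<integral>\<^sup>+i. G x * (c i * indicator (A i) x) \<partial>count_space I \<partial>M)"
    by (rule nn_integral_count_space_nn_integral[OF I, symmetric]) measurable
  also have "\<dots> = (\<integral>\<^sup>+x. G x * (\<integral>\<^sup>+i. c i * indicator (A i) x \<partial>count_space I) \<partial>M)"
    by (simp add: nn_integral_cmult)
  finally show ?thesis .
qed

text \<open>With \<open>N\<close> the integral of \<open>F\<^sup>p\<close>, split \<open>F\<close> on \<open>Q i\<close> at the height \<open>T i\<close> with
  \<open>T i\<^sup>p = N / m i\<close>. Below \<open>T i\<close>, Jensen's inequality replaces the \<open>q\<close>-th power of the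
  integral by the integral of \<open>F\<^sup>q\<close>. Above \<open>T i\<close>, the integral of \<open>F\<close> is at most \<open>T i\<close> to
  the power \<open>1 - p\<close> times \<open>N\<close>, and this bound is used for all but one of the \<open>q\<close> factors.
  After interchanging sum and integral, each half is at every point a sum of powers of the
  masses of those sets whose mass lies on one side of \<open>N\<close> divided by \<open>F(x)\<^sup>p\<close>. The
  hypothesis \<open>geo\<close> says that such sums are of the order of the threshold; the exponent is
  positive below \<open>T i\<close> and negative above.\<close>

lemma fractional_embedding:
  fixes F :: "'a \<Rightarrow> real" and m :: "'i \<Rightarrow> real" and p q C :: real
  assumes pq: "1 < p" "p < q" and I: "countable I"
    and Q: "\<And>i. i \<in> I \<Longrightarrow> Q i \<in> sets M" and [measurable]: "F \<in> borel_measurable M"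
    and m: "\<And>i. i \<in> I \<Longrightarrow> 0 < m i" "\<And>i. i \<in> I \<Longrightarrow> emeasure M (Q i) = ennreal (m i)"
    and F: "\<And>x. 0 \<le> F x" and C: "0 < C"
    and geo: "\<And>e x \<tau>. e \<in> {q / p - 1, 1 / p - 1} \<Longrightarrow> 0 < \<tau> \<Longrightarrow>
      (\<integral>\<^sup>+i. ennreal (if x \<in> Q i \<and> m i powr e \<le> \<tau> then m i powr e else 0) \<partial>count_space I) \<le> ennreal (C * \<tau>)"
  shows "(\<integral>\<^sup>+i. ennreal (m i powr (q / p - q)) * ennreal_powr (\<integral>\<^sup>+x\<in>Q i. ennreal (F x) \<partial>M) q \<partial>count_space I)
    \<le> ennreal (2 powr q * (2 * C)) * ennreal_powr (\<integral>\<^sup>+x. ennreal (F x powr p) \<partial>M) (q / p)"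
proof -
  define N where "N = (\<integral>\<^sup>+x. ennreal (F x powr p) \<partial>M)"
  let ?term = "\<lambda>A i. ennreal (m i powr (q / p - q)) * ennreal_powr (\<integral>\<^sup>+x\<in>A i. ennreal (F x) \<partial>M) q"
  have q1: "1 < q" using pq by simp
  consider "N = 0" | "N = top" | "0 < N" "N < top" using less_top zero_less_iff_neq_zero by blast
  then show ?thesis
  proof cases
    case 1
    then have "AE x in M. ennreal (F x powr p) = 0" unfolding N_def by (simp add: nn_integral_0_iff_AE)
    then have "AE x in M. F x = 0"
      by (rule eventually_mono) (auto simp: ennreal_eq_0_iff powr_eq_0_iff)
    then have "(\<integral>\<^sup>+x\<in>Q i. ennreal (F x) \<partial>M) = (\<integral>\<^sup>+x. 0 \<partial>M)" for i
      by (intro nn_integral_cong_AE) (auto elim: eventually_mono)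
    then show ?thesis by simp
  next
    case 2
    moreover have "0 < 2 powr q * (2 * C)" using C by simp
    ultimately have "ennreal (2 powr q * (2 * C)) * ennreal_powr N (q / p) = top"
      by (simp only: ennreal_powr_top ennreal_mult_eq_top_iff ennreal_eq_0_iff) simp
    then show ?thesis unfolding N_def by (simp only: top_greatest)
  next
    case 3
    then obtain N' where N': "N = ennreal N'" "0 < N'" by (cases N) auto
    define T where "T = (\<lambda>i. (N' / m i) powr (1 / p))"
    define lo where "lo = (\<lambda>i. {x \<in> space M. F x \<le> T i} \<inter> Q i)"
    define hi where "hi = (\<lambda>i. {x \<in> space M. T i < F x} \<inter> Q i)"
    have sets [measurable]: "lo i \<in> sets M" "hi i \<in> sets M" if "i \<in> I" for i
      using Q[OF that] unfolding lo_def hi_def by measurable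
    have T: "0 < T i" if "i \<in> I" for i using m(1)[OF that] N' by (simp add: T_def)
    have T_iff: "F x \<le> T i \<longleftrightarrow> m i \<le> N' * F x powr - p" if "i \<in> I" "0 < F x" for i x
    proof -
      have "F x \<le> T i \<longleftrightarrow> F x powr p \<le> T i powr p"
        using pq that T[OF that(1)] powr_mono2[of p "F x" "T i"] powr_less_mono2[of p "T i" "F x"]
        by (auto simp: not_le[symmetric])
      also have "T i powr p = N' / m i" using m(1)[OF that(1)] N' pq by (simp add: T_def powr_powr)
      also have "F x powr p \<le> N' / m i \<longleftrightarrow> m i \<le> N' * F x powr - p"
        using m(1)[OF that(1)] that(2) by (simp add: powr_minus field_simps)
      finally show ?thesis .
    qed
    \<comment> \<open>The exponent \<open>r = p + p e\<close> is the one for which the threshold \<open>N' / F(x)\<^sup>p\<close>, raised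
      to the power \<open>e\<close>, leaves exactly \<open>F(x)\<^sup>p\<close>.\<close>
    have key: "(\<integral>\<^sup>+i. ennreal (m i powr e) * (\<integral>\<^sup>+x\<in>A i. ennreal (F x powr r) \<partial>M) \<partial>count_space I) \<le> ennreal (C * N' powr (e + 1))"
      if e: "e \<in> {q / p - 1, 1 / p - 1}" and r: "r = p + p * e" and A: "\<And>i. i \<in> I \<Longrightarrow> A i \<in> sets M"
        and sub: "\<And>i x. i \<in> I \<Longrightarrow> x \<in> A i \<Longrightarrow> 0 < F x \<Longrightarrow> x \<in> Q i \<and> m i powr e \<le> (N' * F x powr - p) powr e"
      for e r and A :: "'i \<Rightarrow> 'a set"
    proof -
      have "ennreal (F x powr r) * (\<integral>\<^sup>+i. ennreal (m i powr e) * indicator (A i) x \<partial>count_space I) \<le> ennreal (C * N' powr e) * ennreal (F x powr p)" for x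
      proof (cases "F x = 0")
        case False
        then have Fx: "0 < F x" using F[of x] by simp
        let ?t = "(N' * F x powr - p) powr e"
        have "(\<integral>\<^sup>+i. ennreal (m i powr e) * indicator (A i) x \<partial>count_space I) \<le> (\<integral>\<^sup>+i. ennreal (if x \<in> Q i \<and> m i powr e \<le> ?t then m i powr e else 0) \<partial>count_space I)"
          using sub[OF _ _ Fx] by (intro nn_integral_mono) (auto simp: indicator_def)
        also have "\<dots> \<le> ennreal (C * ?t)" using N' Fx by (intro geo e) simp
        finally have "ennreal (F x powr r) * (\<integral>\<^sup>+i. ennreal (m i powr e) * indicator (A i) x \<partial>count_space I) \<le> ennreal (F x powr r) * ennreal (C * ?t)"
          by (rule mult_left_mono) simp
        also have "\<dots> = ennreal (C * N' powr e) * ennreal (F x powr p)"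
        proof -
          have "F x powr r * ?t = N' powr e * (F x powr r * F x powr (- p * e))"
            by (simp only: powr_mult powr_powr mult_ac)
          also have "F x powr r * F x powr (- p * e) = F x powr p" by (simp add: powr_add[symmetric] r)
          finally show ?thesis using C by (simp add: ennreal_mult[symmetric] mult_ac)
        qed
        finally show ?thesis .
      qed simp
      then have "(\<integral>\<^sup>+x. ennreal (F x powr r) * (\<integral>\<^sup>+i. ennreal (m i powr e) * indicator (A i) x \<partial>count_space I) \<partial>M) \<le>
          (\<integral>\<^sup>+x. ennreal (C * N' powr e) * ennreal (F x powr p) \<partial>M)"
        by (intro nn_integral_mono)
      also have "\<dots> = ennreal (C * N' powr e) * N" unfolding N_def by (rule nn_integral_cmult) measurable
      also have "\<dots> = ennreal (C * N' powr (e + 1))"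
        using N' C by (simp add: ennreal_mult[symmetric] powr_add)
      finally show ?thesis by (subst sum_set_nn_integral_swap[OF I _ A]) auto
    qed
    have "?term lo i \<le> ennreal (m i powr (q / p - 1)) * (\<integral>\<^sup>+x\<in>lo i. ennreal (F x powr q) \<partial>M)" if i: "i \<in> I" for i
    proof -
      have "ennreal_powr (\<integral>\<^sup>+x\<in>lo i. ennreal (F x) \<partial>M) q \<le>
          ennreal_powr (emeasure M (lo i)) (q - 1) * (\<integral>\<^sup>+x\<in>lo i. ennreal_powr (ennreal (F x)) q \<partial>M)"
        by (rule nn_integral_power_set_le[OF _ sets(1)[OF i] q1]) measurable
      also have "\<dots> \<le> ennreal (m i powr (q - 1)) * (\<integral>\<^sup>+x\<in>lo i. ennreal (F x powr q) \<partial>M)"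
      proof (rule mult_mono)
        have "emeasure M (lo i) \<le> ennreal (m i)"
          unfolding m(2)[OF i, symmetric] using Q[OF i] by (intro emeasure_mono) (auto simp: lo_def)
        then have "ennreal_powr (emeasure M (lo i)) (q - 1) \<le> ennreal_powr (ennreal (m i)) (q - 1)"
          using q1 by (intro ennreal_powr_mono) auto
        then show "ennreal_powr (emeasure M (lo i)) (q - 1) \<le> ennreal (m i powr (q - 1))"
          using m(1)[OF i] by (simp add: ennreal_powr_ennreal)
      qed (simp_all add: ennreal_powr_ennreal F)
      finally have "?term lo i \<le> ennreal (m i powr (q / p - q)) * (ennreal (m i powr (q - 1)) * (\<integral>\<^sup>+x\<in>lo i. ennreal (F x powr q) \<partial>M))"
        by (rule mult_left_mono) simp
      then show ?thesis
        using m(1)[OF i] by (simp add: mult.assoc[symmetric] ennreal_mult[symmetric] powr_add[symmetric])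
    qed
    then have "(\<integral>\<^sup>+i. ?term lo i \<partial>count_space I) \<le> (\<integral>\<^sup>+i. ennreal (m i powr (q / p - 1)) * (\<integral>\<^sup>+x\<in>lo i. ennreal (F x powr q) \<partial>M) \<partial>count_space I)"
      by (intro nn_integral_mono) simp
    also have "\<dots> \<le> ennreal (C * N' powr (q / p - 1 + 1))"
    proof (rule key[OF _ _ sets(1)])
      fix i x assume *: "i \<in> I" "x \<in> lo i" "0 < F x"
      then have "m i \<le> N' * F x powr - p" using T_iff by (simp add: lo_def)
      then show "x \<in> Q i \<and> m i powr (q / p - 1) \<le> (N' * F x powr - p) powr (q / p - 1)"
        using * pq m(1)[OF *(1)] by (auto simp: lo_def intro!: powr_mono2)
    qed (use pq in \<open>simp_all add: field_simps\<close>)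
    finally have low: "(\<integral>\<^sup>+i. ?term lo i \<partial>count_space I) \<le> ennreal (C * N' powr (q / p))" by simp
    have "?term hi i \<le> ennreal (N' powr ((q - 1) / p)) * (ennreal (m i powr (1 / p - 1)) * (\<integral>\<^sup>+x\<in>hi i. ennreal (F x powr 1) \<partial>M))" if i: "i \<in> I" for i
    proof -
      note mi = m(1)[OF i] and Ti = T[OF i]
      let ?h = "\<integral>\<^sup>+x\<in>hi i. ennreal (F x) \<partial>M"
      have "?h \<le> (\<integral>\<^sup>+x. ennreal (T i powr (1 - p)) * ennreal (F x powr p) \<partial>M)"
      proof (rule nn_integral_mono)
        fix x
        show "ennreal (F x) * indicator (hi i) x \<le> ennreal (T i powr (1 - p)) * ennreal (F x powr p)"
        proof (cases "T i < F x")
          case True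
          have "F x = F x powr (1 - p) * F x powr p" using True Ti by (simp add: powr_add[symmetric])
          also have "\<dots> \<le> T i powr (1 - p) * F x powr p"
            using True Ti pq by (intro mult_right_mono powr_mono2') auto
          finally show ?thesis by (auto simp: indicator_def ennreal_mult[symmetric] intro!: ennreal_leI)
        qed (simp add: hi_def)
      qed
      also have "\<dots> = ennreal (T i powr (1 - p) * N')"
        using N' by (simp add: nn_integral_cmult N_def[symmetric] ennreal_mult)
      finally have "ennreal_powr ?h (q - 1) \<le> ennreal_powr (ennreal (T i powr (1 - p) * N')) (q - 1)"
        using q1 by (intro ennreal_powr_mono) auto
      also have "\<dots> = ennreal ((T i powr (1 - p) * N') powr (q - 1))"
        using N' by (intro ennreal_powr_ennreal) simp
      finally have hb: "ennreal_powr ?h (q - 1) \<le> ennreal ((T i powr (1 - p) * N') powr (q - 1))" .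
      have id: "m i powr (q / p - q) * (T i powr (1 - p) * N') powr (q - 1) = N' powr ((q - 1) / p) * m i powr (1 / p - 1)"
      proof -
        have "T i powr (1 - p) = N' powr ((1 - p) / p) / m i powr ((1 - p) / p)"
          unfolding T_def by (simp add: powr_powr powr_divide)
        also have "\<dots> = N' powr ((1 - p) / p) * m i powr (- ((1 - p) / p))"
          by (simp only: powr_minus_divide) simp
        finally have "T i powr (1 - p) * N' = N' powr ((1 - p) / p + 1) * m i powr (- ((1 - p) / p))"
          using N' by (simp add: powr_add)
        moreover have "(1 - p) / p + 1 = 1 / p" using pq by (simp add: field_simps)
        ultimately have "(T i powr (1 - p) * N') powr (q - 1) = N' powr (1 / p * (q - 1)) * m i powr (- ((1 - p) / p) * (q - 1))"
          by (simp only: powr_mult powr_powr)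
        then have "m i powr (q / p - q) * (T i powr (1 - p) * N') powr (q - 1) =
            N' powr ((q - 1) / p) * m i powr (q / p - q + - ((1 - p) / p) * (q - 1))"
          unfolding powr_add by simp
        also have "q / p - q + - ((1 - p) / p) * (q - 1) = 1 / p - 1" using pq by (simp add: field_simps)
        finally show ?thesis .
      qed
      have "ennreal_powr ?h q = ennreal_powr ?h (q - 1) * ?h"
        using ennreal_powr_add[of "q - 1" 1 ?h] q1 by simp
      also have "\<dots> \<le> ennreal ((T i powr (1 - p) * N') powr (q - 1)) * ?h"
        by (intro mult_right_mono hb) simp
      finally have "?term hi i \<le> ennreal (m i powr (q / p - q)) * (ennreal ((T i powr (1 - p) * N') powr (q - 1)) * ?h)"
        by (rule mult_left_mono) simp
      also have "\<dots> = ennreal (N' powr ((q - 1) / p) * m i powr (1 / p - 1)) * ?h"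
        by (simp only: mult.assoc[symmetric] ennreal_mult[symmetric] powr_ge_zero id)
      finally show ?thesis using F by (simp add: ennreal_mult mult.assoc)
    qed
    then have "(\<integral>\<^sup>+i. ?term hi i \<partial>count_space I) \<le> (\<integral>\<^sup>+i. ennreal (N' powr ((q - 1) / p)) *
        (ennreal (m i powr (1 / p - 1)) * (\<integral>\<^sup>+x\<in>hi i. ennreal (F x powr 1) \<partial>M)) \<partial>count_space I)"
      by (intro nn_integral_mono) simp
    also have "\<dots> = ennreal (N' powr ((q - 1) / p)) *
        (\<integral>\<^sup>+i. ennreal (m i powr (1 / p - 1)) * (\<integral>\<^sup>+x\<in>hi i. ennreal (F x powr 1) \<partial>M) \<partial>count_space I)"
      by (rule nn_integral_cmult) simp
    also have "\<dots> \<le> ennreal (N' powr ((q - 1) / p)) * ennreal (C * N' powr (1 / p - 1 + 1))"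
    proof (intro mult_left_mono key[OF _ _ sets(2)])
      fix i x assume *: "i \<in> I" "x \<in> hi i" "0 < F x"
      then have "N' * F x powr - p \<le> m i" using T_iff[of i x] by (simp add: hi_def)
      then show "x \<in> Q i \<and> m i powr (1 / p - 1) \<le> (N' * F x powr - p) powr (1 / p - 1)"
        using * pq N' by (auto simp: hi_def intro!: powr_mono2')
    qed (use pq in \<open>simp_all add: field_simps\<close>)
    also have "\<dots> = ennreal (C * N' powr (q / p))"
    proof -
      have "N' powr ((q - 1) / p) * N' powr (1 / p - 1 + 1) = N' powr (q / p)"
        by (simp add: powr_add[symmetric] diff_divide_distrib)
      then show ?thesis using C by (simp add: ennreal_mult[symmetric] mult.left_commute)
    qed
    finally have high: "(\<integral>\<^sup>+i. ?term hi i \<partial>count_space I) \<le> ennreal (C * N' powr (q / p))" .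
    have split: "?term Q i \<le> ennreal (2 powr q) * (?term lo i + ?term hi i)" if "i \<in> I" for i
    proof -
      have "(\<integral>\<^sup>+x\<in>Q i. ennreal (F x) \<partial>M) = (\<integral>\<^sup>+x. ennreal (F x) * indicator (lo i) x + ennreal (F x) * indicator (hi i) x \<partial>M)"
        by (intro nn_integral_cong) (auto simp: lo_def hi_def indicator_def)
      also have "\<dots> = (\<integral>\<^sup>+x\<in>lo i. ennreal (F x) \<partial>M) + (\<integral>\<^sup>+x\<in>hi i. ennreal (F x) \<partial>M)"
        using sets[OF that] by (intro nn_integral_add) auto
      finally have "?term Q i \<le> ennreal (m i powr (q / p - q)) * (ennreal (2 powr q) *
          (ennreal_powr (\<integral>\<^sup>+x\<in>lo i. ennreal (F x) \<partial>M) q + ennreal_powr (\<integral>\<^sup>+x\<in>hi i. ennreal (F x) \<partial>M) q))"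
        using ennreal_powr_sum_le[of q] q1 by (simp add: mult_left_mono)
      then show ?thesis by (simp add: distrib_left mult_ac)
    qed
    have "(\<integral>\<^sup>+i. ?term Q i \<partial>count_space I) \<le> (\<integral>\<^sup>+i. ennreal (2 powr q) * (?term lo i + ?term hi i) \<partial>count_space I)"
      using split by (intro nn_integral_mono) simp
    also have "\<dots> = ennreal (2 powr q) * ((\<integral>\<^sup>+i. ?term lo i \<partial>count_space I) + (\<integral>\<^sup>+i. ?term hi i \<partial>count_space I))"
      by (simp add: nn_integral_cmult nn_integral_add)
    also have "\<dots> \<le> ennreal (2 powr q) * (ennreal (C * N' powr (q / p)) + ennreal (C * N' powr (q / p)))"
      by (intro mult_left_mono add_mono low high) simp
    also have "\<dots> = ennreal (2 powr q * (2 * C)) * ennreal (N' powr (q / p))"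
      using C by (simp add: ennreal_mult[symmetric] ennreal_plus[symmetric] mult_ac del: ennreal_plus)
    also have "ennreal (N' powr (q / p)) = ennreal_powr N (q / p)"
      using N' by (simp add: ennreal_powr_ennreal)
    finally show ?thesis unfolding N_def .
  qed
qed

section \<open>A lattice of local cubes\<close>

text \<open>The lattice of generation \<open>k\<close> has mesh \<open>a / 2\<^sup>k\<close>, and its cubes have side three meshes.
  An admissible ball with radius between half a mesh and one mesh then fits into one of
  them; natural numbers \<open>k\<close> suffice because admissible radii are at most \<open>a\<close>.\<close>

definition lattice_corner :: "real \<Rightarrow> nat \<times> (int ^ 'n::finite) \<Rightarrow> real ^ 'n" where
  "lattice_corner a i = (\<chi> j. a / 2 ^ fst i * real_of_int (snd i $ j))"

definition lattice_side :: "real \<Rightarrow> nat \<times> (int ^ 'n::finite) \<Rightarrow> real" where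
  "lattice_side a i = 3 * (a / 2 ^ fst i)"

definition lattice_cube :: "real \<Rightarrow> nat \<times> (int ^ 'n::finite) \<Rightarrow> (real ^ 'n) set" where
  "lattice_cube a i = cube (lattice_corner a i) (lattice_side a i)"

definition lattice_index :: "real \<Rightarrow> real \<Rightarrow> (nat \<times> (int ^ 'n::finite)) set" where
  "lattice_index a A = {i. local_cube A (lattice_corner a i) (lattice_side a i)}"

lemma countable_lattice_index: "countable (lattice_index a A)"
  by (rule countableI_type)

lemma lattice_cube_cover:
  fixes c :: "real ^ 'n::finite"
  assumes "0 < r" "r \<le> a"
  obtains i where "ball c r \<subseteq> lattice_cube a i" "lattice_side a i \<le> 6 * r" "0 < lattice_side a i"
proof -
  have a: "0 < a" using assms by simp
  obtain n where "(1 / 2) ^ n < r / a"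
    using real_arch_pow_inv[of "r / a" "1 / 2"] assms a by auto
  then have "a / 2 ^ n < r" using a by (simp add: field_simps)
  moreover have "\<not> a / 2 ^ 0 < r" using assms by simp
  ultimately obtain k where k: "\<not> a / 2 ^ k < r" "a / 2 ^ Suc k < r"
    using ex_least_nat_less[of "\<lambda>k. a / 2 ^ k < r" n] by auto
  define \<rho> where "\<rho> = a / 2 ^ k"
  have rho: "0 < \<rho>" "r \<le> \<rho>" "\<rho> < 2 * r" using k a by (auto simp: \<rho>_def)
  \<comment> \<open>One mesh below the lattice point under \<open>c\<close>, to leave room for the radius on both
    sides.\<close>
  define z :: "int ^ 'n" where "z = (\<chi> j. \<lfloor>c $ j / \<rho>\<rfloor> - 1)"
  have z: "\<rho> * real_of_int (z $ j) \<le> c $ j - \<rho>" "c $ j - 2 * \<rho> < \<rho> * real_of_int (z $ j)" for j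
  proof -
    have "real_of_int (z $ j) \<le> c $ j / \<rho> - 1" "c $ j / \<rho> - 2 < real_of_int (z $ j)"
      unfolding z_def by (simp_all; linarith)+
    then have "\<rho> * real_of_int (z $ j) \<le> \<rho> * (c $ j / \<rho> - 1)" "\<rho> * (c $ j / \<rho> - 2) < \<rho> * real_of_int (z $ j)"
      using rho by (auto intro: mult_left_mono mult_strict_left_mono)
    then show "\<rho> * real_of_int (z $ j) \<le> c $ j - \<rho>" "c $ j - 2 * \<rho> < \<rho> * real_of_int (z $ j)"
      using rho by (simp_all add: right_diff_distrib)
  qed
  have "ball c r \<subseteq> lattice_cube a (k, z)"
  proof
    fix y assume "y \<in> ball c r"
    then have ny: "norm (y - c) < r" by (simp add: dist_norm norm_minus_commute)
    have "\<rho> * real_of_int (z $ j) \<le> y $ j \<and> y $ j < \<rho> * real_of_int (z $ j) + 3 * \<rho>" for j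
    proof -
      have "\<bar>y $ j - c $ j\<bar> < r" using ny component_le_norm_cart[of "y - c" j] by simp
      then show ?thesis using z[of j] rho by linarith
    qed
    then show "y \<in> lattice_cube a (k, z)"
      by (simp add: lattice_cube_def cube_def lattice_corner_def lattice_side_def \<rho>_def)
  qed
  moreover have "lattice_side a (k, z) \<le> 6 * r" "0 < lattice_side a (k, z)"
    using rho by (simp_all add: lattice_side_def \<rho>_def)
  ultimately show ?thesis using that by blast
qed

text \<open>In each coordinate, the corner is one of the three lattice points in the three meshes
  below \<open>x\<close>.\<close>

lemma lattice_cubes_at_point:
  fixes x :: "real ^ 'n::finite"
  assumes "0 < a"
  shows "finite {z. x \<in> lattice_cube a (k, z)}" "card {z. x \<in> lattice_cube a (k, z)} \<le> 3 ^ CARD('n)"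
proof -
  define \<rho> where "\<rho> = a / 2 ^ k"
  have rho: "0 < \<rho>" using assms by (simp add: \<rho>_def)
  define E where "E = PiE (UNIV :: 'n set) (\<lambda>j. {\<lfloor>x $ j / \<rho>\<rfloor> - 2 .. \<lfloor>x $ j / \<rho>\<rfloor>})"
  have E: "finite E" "card E = 3 ^ CARD('n)"
    by (auto simp: E_def card_PiE intro!: finite_PiE)
  have sub: "vec_nth ` {z. x \<in> lattice_cube a (k, z)} \<subseteq> E"
  proof safe
    fix z :: "int ^ 'n" assume "x \<in> lattice_cube a (k, z)"
    then have *: "\<rho> * real_of_int (z $ j) \<le> x $ j \<and> x $ j < \<rho> * real_of_int (z $ j) + 3 * \<rho>" for j
      by (simp add: lattice_cube_def cube_def lattice_corner_def lattice_side_def \<rho>_def)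
    have "z $ j \<in> {\<lfloor>x $ j / \<rho>\<rfloor> - 2 .. \<lfloor>x $ j / \<rho>\<rfloor>}" for j
    proof -
      have "real_of_int (z $ j) \<le> x $ j / \<rho>" "x $ j / \<rho> < real_of_int (z $ j) + 3"
        using *[of j] rho by (simp_all add: field_simps)
      then have "z $ j \<le> \<lfloor>x $ j / \<rho>\<rfloor>" "\<lfloor>x $ j / \<rho>\<rfloor> < z $ j + 3"
        by (simp_all add: le_floor_iff floor_less_iff)
      then show ?thesis by simp
    qed
    then show "vec_nth z \<in> E" by (auto simp: E_def)
  qed
  have inj: "inj_on vec_nth {z. x \<in> lattice_cube a (k, z)}"
    by (auto simp: inj_on_def vec_nth_inject)
  show "finite {z. x \<in> lattice_cube a (k, z)}"
    using finite_imageD[OF finite_subset[OF sub E(1)] inj] .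
  show "card {z. x \<in> lattice_cube a (k, z)} \<le> 3 ^ CARD('n)"
    using card_inj_on_le[OF inj sub E(1)] E(2) by simp
qed

lemma emeasure_gauss_cube_eq:
  fixes u :: "real ^ 'n::finite"
  assumes "local_cube A u s"
  shows "emeasure gauss_measure (cube u s) = ennreal (measure gauss_measure (cube u s))"
    and "gauss_density u / local_ratio TYPE('n) A * s ^ CARD('n) \<le> measure gauss_measure (cube u s)"
    and "measure gauss_measure (cube u s) \<le> local_ratio TYPE('n) A * gauss_density u * s ^ CARD('n)"
proof -
  have s: "0 < s" using assms by (simp add: local_cube_def)
  have K: "0 < local_ratio TYPE('n) A" by (simp add: local_ratio_def)
  have w: "0 < gauss_density u" by (rule gauss_density_pos)
  have "emeasure gauss_measure (cube u s) < top"
    using emeasure_gauss_cube(2)[OF assms] by (rule order.strict_trans1) simp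
  then show eq: "emeasure gauss_measure (cube u s) = ennreal (measure gauss_measure (cube u s))"
    by (intro emeasure_eq_ennreal_measure) simp
  show "gauss_density u / local_ratio TYPE('n) A * s ^ CARD('n) \<le> measure gauss_measure (cube u s)"
    using emeasure_gauss_cube(1)[OF assms] unfolding eq by (subst (asm) ennreal_le_iff) auto
  show "measure gauss_measure (cube u s) \<le> local_ratio TYPE('n) A * gauss_density u * s ^ CARD('n)"
    using emeasure_gauss_cube(2)[OF assms] K w s unfolding eq by (subst (asm) ennreal_le_iff) auto
qed

text \<open>The mass of a local lattice cube is determined, up to a factor, by its generation and
  by any one of its points. In terms of a point shared by several cubes, the masses form a
  geometric progression.\<close>

lemma lattice_cube_mass:
  fixes x :: "real ^ 'n::finite"
  assumes "(k, z) \<in> lattice_index a A" "x \<in> lattice_cube a (k, z)"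
  defines "v \<equiv> gauss_density x * (3 * a) ^ CARD('n) * (1 / 2 ^ CARD('n)) ^ k"
    and "L \<equiv> (local_ratio TYPE('n) A)\<^sup>2"
  shows "measure gauss_measure (lattice_cube a (k, z)) \<le> L * v"
    "v \<le> L * measure gauss_measure (lattice_cube a (k, z))"
proof -
  define u where "u = lattice_corner a (k, z)"
  define s where "s = lattice_side a (k, z)"
  have g: "local_cube A u s" and x: "x \<in> cube u s"
    using assms(1,2) by (auto simp: lattice_index_def lattice_cube_def u_def s_def)
  define K where "K = local_ratio TYPE('n) A"
  have K: "0 < K" by (simp add: K_def local_ratio_def)
  have s: "0 < s" using g by (simp add: local_cube_def)
  have v: "v = gauss_density x * s ^ CARD('n)"
    unfolding v_def s_def lattice_side_def
    by (simp add: power_mult_distrib power_divide power_mult[symmetric] mult.commute)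
  have lo: "gauss_density u \<le> K * gauss_density x"
    using gauss_density_cube(1)[OF g x] K by (simp add: K_def[symmetric] field_simps)
  have up: "gauss_density x \<le> K * gauss_density u"
    using gauss_density_cube(2)[OF g x] by (simp add: K_def)
  have "measure gauss_measure (cube u s) \<le> K * gauss_density u * s ^ CARD('n)"
    using emeasure_gauss_cube_eq(3)[OF g] by (simp add: K_def)
  also have "\<dots> \<le> K * (K * gauss_density x) * s ^ CARD('n)"
    using lo K s by (intro mult_right_mono mult_left_mono) auto
  finally show "measure gauss_measure (lattice_cube a (k, z)) \<le> L * v"
    unfolding v L_def K_def[symmetric] lattice_cube_def u_def[symmetric] s_def[symmetric]
    by (simp add: power2_eq_square mult_ac)
  have "v \<le> (K * gauss_density u) * s ^ CARD('n)"
    unfolding v using up s by (intro mult_right_mono) auto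
  also have "\<dots> = K\<^sup>2 * (gauss_density u / K * s ^ CARD('n))"
    using K by (simp add: power2_eq_square)
  also have "\<dots> \<le> K\<^sup>2 * measure gauss_measure (cube u s)"
    using emeasure_gauss_cube_eq(2)[OF g] K by (intro mult_left_mono) (auto simp: K_def)
  finally show "v \<le> L * measure gauss_measure (lattice_cube a (k, z))"
    unfolding L_def K_def[symmetric] lattice_cube_def u_def[symmetric] s_def[symmetric] .
qed

text \<open>Split off the first term. If it is admitted, it bounds all later ones, and the
  threshold may be lowered to the second term.\<close>

lemma geometric_partial_sum_le:
  fixes g \<theta> T :: real
  assumes "0 < \<theta>" "\<theta> < 1" "0 < g" "0 \<le> T"
  shows "(\<Sum>k<n. if g * \<theta> ^ k \<le> T then g * \<theta> ^ k else 0) \<le> T / (1 - \<theta>)"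
  using assms(3,4)
proof (induction n arbitrary: g T)
  case 0
  then show ?case using assms by simp
next
  case (Suc n)
  have sh: "(\<Sum>k<Suc n. if g * \<theta> ^ k \<le> T then g * \<theta> ^ k else 0) =
      (if g \<le> T then g else 0) + (\<Sum>k<n. if g * \<theta> * \<theta> ^ k \<le> T then g * \<theta> * \<theta> ^ k else 0)"
    by (subst sum.lessThan_Suc_shift) (auto intro!: sum.cong simp: mult.assoc)
  show ?case
  proof (cases "g \<le> T")
    case True
    have le: "g * \<theta> * \<theta> ^ k \<le> g * \<theta>" for k
      using assms Suc.prems by (simp add: mult_left_le power_le_one)
    have "(\<Sum>k<n. if g * \<theta> * \<theta> ^ k \<le> T then g * \<theta> * \<theta> ^ k else 0) \<le> (\<Sum>k<n. if g * \<theta> * \<theta> ^ k \<le> g * \<theta> then g * \<theta> * \<theta> ^ k else 0)"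
      using le assms Suc.prems by (intro sum_mono) auto
    also have "\<dots> \<le> g * \<theta> / (1 - \<theta>)" using assms Suc.prems by (intro Suc.IH) auto
    finally have "(\<Sum>k<Suc n. if g * \<theta> ^ k \<le> T then g * \<theta> ^ k else 0) \<le> g + g * \<theta> / (1 - \<theta>)"
      unfolding sh using True by simp
    also have "\<dots> = g / (1 - \<theta>)" using assms by (simp add: field_simps)
    also have "\<dots> \<le> T / (1 - \<theta>)" using True assms by (intro divide_right_mono) auto
    finally show ?thesis .
  next
    case False
    then show ?thesis unfolding sh using assms Suc by simp
  qed
qed

text \<open>A sum of those terms of a geometric progression that stay below \<open>\<tau>\<close> is at most of the
  order of its largest term, hence of \<open>\<tau>\<close>. For an increasing progression the partial sums
  are read backwards.\<close>

lemma geometric_sum_le: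
  fixes \<theta> :: real
  assumes "0 < \<theta>" "\<theta> \<noteq> 1"
  obtains D where "0 < D" "\<And>g \<tau>. 0 < g \<Longrightarrow> 0 \<le> \<tau> \<Longrightarrow>
    (\<integral>\<^sup>+k. ennreal (if g * \<theta> ^ k \<le> \<tau> then g * \<theta> ^ k else 0) \<partial>count_space UNIV) \<le> ennreal (D * \<tau>)"
proof -
  define \<eta> where "\<eta> = (if \<theta> < 1 then \<theta> else 1 / \<theta>)"
  have \<eta>: "0 < \<eta>" "\<eta> < 1" using assms by (auto simp: \<eta>_def)
  have part: "(\<Sum>k<n. if g * \<theta> ^ k \<le> \<tau> then g * \<theta> ^ k else 0) \<le> \<tau> / (1 - \<eta>)" if g: "0 < g" "0 \<le> \<tau>" for g \<tau> and n :: nat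
  proof (cases "\<theta> < 1")
    case True
    then show ?thesis using geometric_partial_sum_le[OF assms(1) True g, of n] by (simp add: \<eta>_def)
  next
    case False
    then have e: "\<eta> = 1 / \<theta>" by (simp add: \<eta>_def)
    define G where "G = g * \<theta> ^ n / \<theta>"
    have G: "0 < G" using assms g by (simp add: G_def)
    have "g * \<theta> ^ (n - Suc k) = G * \<eta> ^ k" if "k < n" for k
    proof -
      have "\<theta> ^ n = \<theta> ^ (n - Suc k) * (\<theta> * \<theta> ^ k)"
        using that by (simp flip: power_add power_Suc)
      then show ?thesis using assms by (simp add: G_def e power_divide)
    qed
    then have "(\<Sum>k<n. if g * \<theta> ^ k \<le> \<tau> then g * \<theta> ^ k else 0) = (\<Sum>k<n. if G * \<eta> ^ k \<le> \<tau> then G * \<eta> ^ k else 0)"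
      by (subst sum.nat_diff_reindex[symmetric]) (auto intro!: sum.cong)
    then show ?thesis using geometric_partial_sum_le[OF \<eta> G g(2), of n] by simp
  qed
  have main: "(\<integral>\<^sup>+k. ennreal (if g * \<theta> ^ k \<le> \<tau> then g * \<theta> ^ k else 0) \<partial>count_space UNIV) \<le> ennreal (1 / (1 - \<eta>) * \<tau>)"
    if g: "0 < g" "0 \<le> \<tau>" for g \<tau>
  proof -
    have "(\<Sum>k<n. ennreal (if g * \<theta> ^ k \<le> \<tau> then g * \<theta> ^ k else 0)) \<le> ennreal (1 / (1 - \<eta>) * \<tau>)" for n
      using part[OF g, of n] g assms(1) by (subst sum_ennreal) (auto intro: ennreal_leI)
    then show ?thesis unfolding nn_integral_count_space_nat by (intro suminf_le_const) auto
  qed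
  show ?thesis by (rule that[OF _ main]) (use \<eta> in simp)
qed

lemma powr_le_of_ratio:
  fixes x y :: real
  assumes "0 < x" "0 < y" "0 < L" "x \<le> L * y" "y \<le> L * x"
  shows "x powr e \<le> L powr \<bar>e\<bar> * y powr e"
proof (cases "0 \<le> e")
  case True
  then have "x powr e \<le> (L * y) powr e" using assms by (intro powr_mono2) auto
  then show ?thesis using True by (simp add: powr_mult)
next
  case False
  have "y / L \<le> x" using assms by (simp add: divide_le_eq mult.commute)
  then have "x powr e \<le> (y / L) powr e" using False assms by (intro powr_mono2') auto
  also have "\<dots> = L powr \<bar>e\<bar> * y powr e"
    using False by (simp only: powr_divide) (simp add: powr_minus divide_inverse mult.commute)
  finally show ?thesis .
qed

text \<open>At each generation at most \<open>3\<^sup>n\<close> cubes contain the point.\<close>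

lemma lattice_sum_le:
  fixes x :: "real ^ 'n::finite" and f :: "nat \<times> (int ^ 'n) \<Rightarrow> ennreal"
  assumes "0 < a" and f: "\<And>k z. (k, z) \<in> lattice_index a A \<Longrightarrow> x \<in> lattice_cube a (k, z) \<Longrightarrow> f (k, z) \<le> h k"
    and f0: "\<And>i. x \<notin> lattice_cube a i \<Longrightarrow> f i = 0"
  shows "(\<integral>\<^sup>+i. f i \<partial>count_space (lattice_index a A)) \<le> 3 ^ CARD('n) * (\<integral>\<^sup>+k. h k \<partial>count_space UNIV)"
proof -
  have "(\<integral>\<^sup>+i. f i \<partial>count_space (lattice_index a A)) = (\<integral>\<^sup>+i. f i * indicator (lattice_index a A) i \<partial>count_space UNIV)"
    by (subst nn_integral_count_space_indicator) auto
  also have "\<dots> = (\<integral>\<^sup>+k. \<integral>\<^sup>+z. f (k, z) * indicator (lattice_index a A) (k, z) \<partial>count_space UNIV \<partial>count_space UNIV)"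
    by (rule nn_integral_fst_count_space[symmetric])
  also have "\<dots> \<le> (\<integral>\<^sup>+k. 3 ^ CARD('n) * h k \<partial>count_space UNIV)"
  proof (rule nn_integral_mono)
    fix k :: nat
    let ?S = "{z. x \<in> lattice_cube a (k, z)}"
    note S = lattice_cubes_at_point[OF assms(1), of x k]
    have "(\<integral>\<^sup>+z. f (k, z) * indicator (lattice_index a A) (k, z) \<partial>count_space UNIV) \<le> (\<integral>\<^sup>+z. h k * indicator ?S z \<partial>count_space UNIV)"
    proof (rule nn_integral_mono)
      fix z
      show "f (k, z) * indicator (lattice_index a A) (k, z) \<le> h k * indicator ?S z"
        using f[of k z] f0[of "(k, z)"] by (auto simp: indicator_def)
    qed
    also have "\<dots> = h k * emeasure (count_space UNIV) ?S"
      by (rule nn_integral_cmult_indicator) simp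
    also have "\<dots> = h k * of_nat (card ?S)"
      using S(1) by simp
    also have "\<dots> \<le> h k * of_nat (3 ^ CARD('n))"
      using S(2) by (intro mult_left_mono of_nat_mono) auto
    finally show "(\<integral>\<^sup>+z. f (k, z) * indicator (lattice_index a A) (k, z) \<partial>count_space UNIV) \<le> 3 ^ CARD('n) * h k"
      by (simp add: mult.commute)
  qed
  also have "\<dots> = 3 ^ CARD('n) * (\<integral>\<^sup>+k. h k \<partial>count_space UNIV)" by (rule nn_integral_cmult) simp
  finally show ?thesis .
qed

text \<open>The hypothesis \<open>geo\<close> of the embedding for the lattice: up to factors, the powers of the
  masses of the cubes through \<open>x\<close> form a geometric progression, increasing or decreasing
  according to the sign of \<open>e\<close>.\<close>

lemma lattice_power_sum:
  fixes a A e :: real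
  assumes a: "0 < a" and e: "e \<noteq> 0"
  obtains C where "0 < C" "\<And>(x :: real ^ 'n::finite) \<tau>. 0 < \<tau> \<Longrightarrow>
    (\<integral>\<^sup>+i. ennreal (if x \<in> lattice_cube a i \<and> measure gauss_measure (lattice_cube a i) powr e \<le> \<tau>
        then measure gauss_measure (lattice_cube a i) powr e else 0) \<partial>count_space (lattice_index a A)) \<le> ennreal (C * \<tau>)"
proof -
  define L where "L = (local_ratio TYPE('n) A)\<^sup>2"
  have L: "0 < L" by (simp add: L_def local_ratio_def)
  define R where "R = L powr \<bar>e\<bar>"
  have R: "0 < R" using L by (simp add: R_def)
  define \<theta> where "\<theta> = (1 / 2 ^ CARD('n) :: real) powr e"
  have "1 < (2::real) ^ CARD('n)" by (rule one_less_power) auto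
  then have "1 / 2 ^ CARD('n) < (1::real)" by simp
  then have "1 / 2 ^ CARD('n) \<noteq> (1::real)" by (rule less_imp_neq)
  then have th: "0 < \<theta>" "\<theta> \<noteq> 1" using e powr_eq_one_iff_gen[of "1 / 2 ^ CARD('n)" e] by (auto simp: \<theta>_def)
  obtain D where D: "0 < D" "\<And>g \<tau>. 0 < g \<Longrightarrow> 0 \<le> \<tau> \<Longrightarrow>
    (\<integral>\<^sup>+k. ennreal (if g * \<theta> ^ k \<le> \<tau> then g * \<theta> ^ k else 0) \<partial>count_space UNIV) \<le> ennreal (D * \<tau>)"
  proof (rule geometric_sum_le[OF th], goal_cases)
    case (1 D) show ?case by (rule 1(1)[OF 1(2) 1(3)])
  qed
  have main: "(\<integral>\<^sup>+i. ennreal (if x \<in> lattice_cube a i \<and> measure gauss_measure (lattice_cube a i) powr e \<le> \<tau>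
        then measure gauss_measure (lattice_cube a i) powr e else 0) \<partial>count_space (lattice_index a A)) \<le> ennreal (3 ^ CARD('n) * R\<^sup>2 * D * \<tau>)"
    if \<tau>: "0 < \<tau>" for x :: "real ^ 'n" and \<tau>
  proof -
    define v where "v = gauss_density x * (3 * a) ^ CARD('n)"
    have v: "0 < v" using a by (simp add: v_def gauss_density_pos)
    define g where "g = v powr e"
    have g: "0 < g" using v by (simp add: g_def)
    have gk: "(v * (1 / 2 ^ CARD('n)) ^ k) powr e = g * \<theta> ^ k" for k
    proof -
      have "((1 / 2 ^ CARD('n) :: real) ^ k) powr e = \<theta> ^ k"
        unfolding \<theta>_def by (simp add: powr_powr mult.commute flip: powr_realpow)
      then show ?thesis unfolding g_def by (simp only: powr_mult)
    qed
    let ?h = "\<lambda>k. ennreal R * ennreal (if g * \<theta> ^ k \<le> R * \<tau> then g * \<theta> ^ k else 0)"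
    have "(\<integral>\<^sup>+i. ennreal (if x \<in> lattice_cube a i \<and> measure gauss_measure (lattice_cube a i) powr e \<le> \<tau>
        then measure gauss_measure (lattice_cube a i) powr e else 0) \<partial>count_space (lattice_index a A))
      \<le> 3 ^ CARD('n) * (\<integral>\<^sup>+k. ?h k \<partial>count_space UNIV)"
    proof (rule lattice_sum_le[OF a])
      fix k :: nat and z :: "int ^ 'n"
      assume i: "(k, z) \<in> lattice_index a A" "x \<in> lattice_cube a (k, z)"
      let ?m = "measure gauss_measure (lattice_cube a (k, z))" and ?v = "v * (1 / 2 ^ CARD('n)) ^ k"
      note mass = lattice_cube_mass[OF i, folded v_def L_def]
      have v0: "0 < ?v" using v by simp
      then have m0: "0 < ?m" using mass(2) L by (smt (verit) zero_less_mult_pos)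
      have "?m powr e \<le> R * (g * \<theta> ^ k)" "g * \<theta> ^ k \<le> R * ?m powr e"
        using powr_le_of_ratio[OF m0 v0 L mass, of e] powr_le_of_ratio[OF v0 m0 L mass(2,1), of e] unfolding gk R_def .
      moreover have "g * \<theta> ^ k \<le> R * \<tau>" if "g * \<theta> ^ k \<le> R * ?m powr e" "?m powr e \<le> \<tau>"
        using that R by (meson mult_left_mono less_imp_le order_trans)
      ultimately show "ennreal (if x \<in> lattice_cube a (k, z) \<and> ?m powr e \<le> \<tau> then ?m powr e else 0) \<le> ?h k"
        using R g th(1) by (auto simp: ennreal_mult[symmetric] ennreal_leI)
    qed simp
    also have "(\<integral>\<^sup>+k. ?h k \<partial>count_space UNIV) \<le> ennreal R * ennreal (D * (R * \<tau>))"
      using R \<tau> by (subst nn_integral_cmult) (auto intro!: mult_left_mono D(2) g)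
    also have "3 ^ CARD('n) * (ennreal R * ennreal (D * (R * \<tau>))) = ennreal (3 ^ CARD('n) * R\<^sup>2 * D * \<tau>)"
    proof -
      have "(3 :: ennreal) ^ CARD('n) = ennreal (3 ^ CARD('n))" by (simp add: ennreal_power[symmetric])
      then show ?thesis using R D(1) \<tau> by (simp add: ennreal_mult[symmetric] power2_eq_square mult_ac)
    qed
    finally show ?thesis by (simp add: mult_left_mono)
  qed
  show ?thesis by (rule that[OF _ main]) (use R D(1) in simp)
qed

section \<open>Measurability of the maximal commutator\<close>

lemma ball_borel [measurable]: "ball c r \<in> sets (borel :: 'a::metric_space measure)"
  by simp

lemma ennreal_divide_pos: "0 < m \<Longrightarrow> x / ennreal m = x * ennreal (1 / m)"
  by (simp add: divide_ennreal_def inverse_ennreal inverse_eq_divide)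

lemma tendsto_indicator_ball:
  fixes y :: "real ^ 'n::finite"
  assumes "(\<lambda>k. dist (c k) y) \<longlonglongrightarrow> dist c0 y" "r \<longlonglongrightarrow> r0" "dist c0 y \<noteq> r0"
  shows "eventually (\<lambda>k. y \<in> ball (c k) (r k) \<longleftrightarrow> y \<in> ball c0 r0) sequentially"
proof (cases "dist c0 y < r0")
  case True
  then have "eventually (\<lambda>k. dist (c k) y < (dist c0 y + r0) / 2) sequentially" "eventually (\<lambda>k. (dist c0 y + r0) / 2 < r k) sequentially"
    by (intro order_tendstoD[OF assms(1)] order_tendstoD[OF assms(2)]; simp)+
  then show ?thesis by eventually_elim (use True in simp)
next
  case False
  with assms(3) have "r0 < dist c0 y" by simp
  then have "eventually (\<lambda>k. (dist c0 y + r0) / 2 < dist (c k) y) sequentially" "eventually (\<lambda>k. r k < (dist c0 y + r0) / 2) sequentially"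
    by (intro order_tendstoD[OF assms(1)] order_tendstoD[OF assms(2)]; simp)+
  then show ?thesis by eventually_elim (use False in simp)
qed

text \<open>Spheres are null sets, so the indicators converge almost everywhere.\<close>

lemma measure_gauss_ball_tendsto:
  fixes c :: "nat \<Rightarrow> real ^ 'n::finite"
  assumes c: "c \<longlonglongrightarrow> c0" and r: "r \<longlonglongrightarrow> r0"
  shows "(\<lambda>k. measure gauss_measure (ball (c k) (r k))) \<longlonglongrightarrow> measure gauss_measure (ball c0 r0)"
proof -
  obtain R1 where R1: "\<And>k. norm (c k) \<le> R1" using convergent_imp_Bseq[OF convergentI[OF c]] by (auto simp: Bseq_def)
  obtain R2 where R2: "\<And>k. norm (r k) \<le> R2" using convergent_imp_Bseq[OF convergentI[OF r]] by (auto simp: Bseq_def)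
  let ?W = "cball (0 :: real ^ 'n) (R1 + R2)"
  have sub: "ball (c k) (r k) \<subseteq> ?W" for k
  proof
    fix y assume "y \<in> ball (c k) (r k)"
    then have "norm (y - c k) < r k" by (simp add: dist_norm norm_minus_commute)
    then show "y \<in> ?W" using R1[of k] R2[of k] norm_triangle_sub[of y "c k"] by simp
  qed
  have "(\<lambda>k. LINT y|gauss_measure. indicator (ball (c k) (r k)) y :: real) \<longlonglongrightarrow> (LINT y|gauss_measure. indicator (ball c0 r0) y)"
  proof (rule integral_dominated_convergence[where w = "indicator ?W"])
    show "integrable gauss_measure (indicator ?W :: _ \<Rightarrow> real)"
      using emeasure_gauss_bounded_finite[of ?W] by (intro integrable_real_indicator) auto
    have "AE y in gauss_measure. y \<notin> sphere c0 r0"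
      using AE_lborel_of_negligible[OF negligible_sphere, of c0 r0] by (simp only: AE_gauss_iff)
    then show "AE y in gauss_measure. (\<lambda>k. indicator (ball (c k) (r k)) y :: real) \<longlonglongrightarrow> indicator (ball c0 r0) y"
    proof eventually_elim
      case (elim y)
      have "eventually (\<lambda>k. y \<in> ball (c k) (r k) \<longleftrightarrow> y \<in> ball c0 r0) sequentially"
        using elim by (intro tendsto_indicator_ball r tendsto_intros c) auto
      then show ?case by (intro tendsto_eventually) (auto elim!: eventually_mono simp: indicator_def)
    qed
    show "AE y in gauss_measure. norm (indicator (ball (c k) (r k)) y :: real) \<le> indicator ?W y" for k
      using sub[of k] by (intro AE_I2) (auto simp: indicator_def)
  qed measurable
  then show ?thesis by simp
qed

text \<open>The supremum runs over uncountably many balls. For fixed \<open>x\<close> the quotient is lower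
  semicontinuous in centre and radius, by Fatou's lemma for the numerator and continuity
  of the denominator. The supremum is therefore unchanged on restriction to a countable
  dense set of centres and radii. Density is required inside the set of admissible pairs,
  so that approximating balls are admissible too.\<close>

lemma borel_measurable_max_commutator:
  fixes b f :: "real ^ 'n::finite \<Rightarrow> real"
  assumes b [measurable]: "b \<in> borel_measurable borel" and f [measurable]: "f \<in> borel_measurable borel"
  shows "max_commutator b a \<beta> f \<in> borel_measurable borel"
proof -
  define \<Omega> where "\<Omega> = {(c :: real ^ 'n, r). 0 < r \<and> r \<le> a * admissible_fun c}"
  obtain D where D: "countable D" "D \<subseteq> \<Omega>" "\<Omega> \<subseteq> closure D" using separable by blast
  define W where "W = (\<lambda>(c :: real ^ 'n, r). measure gauss_measure (ball c r) powr (1 - \<beta>))"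
  define \<Phi> where "\<Phi> = (\<lambda>(c, r) x. (\<integral>\<^sup>+y\<in>ball c r. ennreal (\<bar>b x - b y\<bar> * \<bar>f y\<bar>) \<partial>gauss_measure) / ennreal (W (c, r)) * indicator (ball c r) x)"
  have Wpos: "0 < W t" if t: "t \<in> \<Omega>" for t
  proof -
    obtain c r where "t = (c, r)" "0 < r" using t by (auto simp: \<Omega>_def)
    then show ?thesis using measure_gauss_ball_pos[of r c] by (simp add: W_def)
  qed
  have eq: "max_commutator b a \<beta> f x = (SUP t\<in>D. \<Phi> t x)" for x
  proof (rule antisym)
    show "(SUP t\<in>D. \<Phi> t x) \<le> max_commutator b a \<beta> f x"
    proof (rule SUP_least)
      fix t assume "t \<in> D"
      then obtain c r where t: "t = (c, r)" "0 < r" "r \<le> a * admissible_fun c" using D(2) by (auto simp: \<Omega>_def)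
      show "\<Phi> t x \<le> max_commutator b a \<beta> f x"
      proof (cases "x \<in> ball c r")
        case True
        then show ?thesis using t unfolding max_commutator_def
          by (intro SUP_upper2[of "ball c r"]) (auto simp: admissible_balls_def \<Phi>_def W_def)
      qed (simp add: \<Phi>_def t)
    qed
    show "max_commutator b a \<beta> f x \<le> (SUP t\<in>D. \<Phi> t x)"
      unfolding max_commutator_def
    proof (rule SUP_least)
      fix B assume "B \<in> {B \<in> admissible_balls a. x \<in> B}"
      then obtain c0 r0 where B: "B = ball c0 r0" "(c0, r0) \<in> \<Omega>" "x \<in> ball c0 r0"
        by (auto simp: admissible_balls_def \<Omega>_def)
      then obtain t where t: "\<And>k. t k \<in> D" "t \<longlonglongrightarrow> (c0, r0)"
        using D(3) closure_sequential by blast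
      define c where "c = (\<lambda>k. fst (t k))"
      define r where "r = (\<lambda>k. snd (t k))"
      have tk: "t k = (c k, r k)" for k by (simp add: c_def r_def)
      have c: "c \<longlonglongrightarrow> c0" and r: "r \<longlonglongrightarrow> r0"
        using tendsto_fst[OF t(2)] tendsto_snd[OF t(2)] by (simp_all add: c_def r_def)
      have "(\<lambda>k. W (t k)) \<longlonglongrightarrow> W (c0, r0)"
        unfolding W_def tk prod.case using measure_gauss_ball_pos[of r0 c0] B(2)
        by (intro tendsto_powr tendsto_const measure_gauss_ball_tendsto c r) (auto simp: \<Omega>_def)
      then have invW: "(\<lambda>k. 1 / W (t k)) \<longlonglongrightarrow> 1 / W (c0, r0)"
        using Wpos[OF B(2)] by (intro tendsto_divide) auto
      let ?g = "\<lambda>y. \<bar>b x - b y\<bar> * \<bar>f y\<bar>"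
      let ?G = "\<lambda>y k. ennreal (?g y) * indicator (ball (c k) (r k)) y * ennreal (1 / W (t k))"
      have ev: "eventually (\<lambda>k. y \<in> ball (c k) (r k)) sequentially" if "y \<in> ball c0 r0" for y
        using tendsto_indicator_ball[OF tendsto_dist[OF c tendsto_const] r, of y] that by (auto elim: eventually_mono)
      have "(\<integral>\<^sup>+y\<in>B. ennreal (?g y) \<partial>gauss_measure) / ennreal (W (c0, r0)) =
         (\<integral>\<^sup>+y. ennreal (?g y) * indicator (ball c0 r0) y * ennreal (1 / W (c0, r0)) \<partial>gauss_measure)"
        unfolding B(1) ennreal_divide_pos[OF Wpos[OF B(2)]] by (rule nn_integral_multc[symmetric]) measurable
      also have "\<dots> \<le> (\<integral>\<^sup>+y. liminf (?G y) \<partial>gauss_measure)"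
      proof (rule nn_integral_mono)
        fix y
        show "ennreal (?g y) * indicator (ball c0 r0) y * ennreal (1 / W (c0, r0)) \<le> liminf (?G y)"
        proof (cases "y \<in> ball c0 r0")
          case True
          have "(\<lambda>k. ennreal (?g y * (1 / W (t k)))) \<longlonglongrightarrow> ennreal (?g y * (1 / W (c0, r0)))"
            by (intro tendsto_ennrealI tendsto_mult tendsto_const invW)
          moreover have "eventually (\<lambda>k. ennreal (?g y * (1 / W (t k))) = ?G y k) sequentially"
            using ev[OF True]
          proof eventually_elim
            case (elim k)
            have "0 < W (t k)" using Wpos t(1) D(2) by blast
            then show ?case using elim by (simp add: ennreal_mult[symmetric])
          qed
          ultimately have "(?G y) \<longlonglongrightarrow> ennreal (?g y * (1 / W (c0, r0)))"
            by (rule Lim_transform_eventually)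
          then have "liminf (?G y) = ennreal (?g y * (1 / W (c0, r0)))"
            by (intro lim_imp_Liminf) auto
          then show ?thesis using True Wpos[OF B(2)] by (simp add: ennreal_mult[symmetric])
        qed simp
      qed
      also have "\<dots> \<le> liminf (\<lambda>k. \<integral>\<^sup>+y. ?G y k \<partial>gauss_measure)"
        by (rule nn_integral_liminf) measurable
      also have "\<dots> \<le> liminf (\<lambda>k::nat. SUP t\<in>D. \<Phi> t x)"
      proof (rule Liminf_mono)
        have xb: "x \<in> ball c0 r0" by (rule B(3))
        show "eventually (\<lambda>k. (\<integral>\<^sup>+y. ?G y k \<partial>gauss_measure) \<le> (SUP t\<in>D. \<Phi> t x)) sequentially"
          using ev[OF xb]
        proof eventually_elim
          case (elim k)
          have Wk: "0 < W (c k, r k)" using Wpos t(1) D(2) tk by (metis subsetD)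
          have "(\<integral>\<^sup>+y. ?G y k \<partial>gauss_measure) = \<Phi> (t k) x"
            unfolding tk \<Phi>_def prod.case ennreal_divide_pos[OF Wk]
            by (subst nn_integral_multc) (measurable, use elim in simp)
          then show ?case using t(1)[of k] by (auto intro: SUP_upper)
        qed
      qed
      also have "\<dots> = (SUP t\<in>D. \<Phi> t x)" by (simp add: Liminf_const)
      finally show "(\<integral>\<^sup>+y\<in>B. ennreal (?g y) \<partial>gauss_measure) / ennreal (measure gauss_measure B powr (1 - \<beta>)) \<le> (SUP t\<in>D. \<Phi> t x)"
        unfolding W_def B(1) by simp
    qed
  qed
  have "\<Phi> t \<in> borel_measurable borel" for t
  proof -
    obtain c r where t: "t = (c, r)" by (cases t)
    show ?thesis unfolding \<Phi>_def t prod.case by measurable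
  qed
  then have "(\<lambda>x. SUP t\<in>D. \<Phi> t x) \<in> borel_measurable borel"
    by (intro borel_measurable_SUP D(1))
  then show ?thesis using eq by (simp add: fun_eq_iff[symmetric] eq[abs_def])
qed

section \<open>The strong type bound\<close>

lemma ball_in_lattice_cube:
  fixes a :: real
  assumes "0 < a"
  defines "A \<equiv> 6 * a + 36 * real CARD('n::finite) * a\<^sup>2"
  obtains K where "0 < K" "\<And>B. B \<in> admissible_balls a \<Longrightarrow>
    \<exists>i \<in> lattice_index a A. B \<subseteq> lattice_cube a i \<and> measure gauss_measure (lattice_cube a i :: (real ^ 'n) set) \<le> K * measure gauss_measure B"
proof -
  define R where "R = local_ratio TYPE('n) A"
  have R: "0 < R" by (simp add: R_def local_ratio_def)
  define d where "d = (12 * real CARD('n)) ^ CARD('n)"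
  have d: "0 < d" by (simp add: d_def)
  have "\<exists>i \<in> lattice_index a A. B \<subseteq> lattice_cube a i \<and> measure gauss_measure (lattice_cube a i :: (real ^ 'n) set) \<le> R\<^sup>2 * d * measure gauss_measure B"
    if adm: "B \<in> admissible_balls a" for B :: "(real ^ 'n) set"
  proof -
    obtain c r where B: "B = ball c r" "0 < r" "r \<le> a" "r * norm c \<le> a"
      using admissible_ballsE[OF adm assms(1)] .
    obtain i where i: "ball c r \<subseteq> lattice_cube a i" "lattice_side a i \<le> 6 * r" "0 < lattice_side a i"
      using lattice_cube_cover[OF B(2,3)] .
    define u where "u = (lattice_corner a i :: real ^ 'n)"
    define s where "s = lattice_side a i"
    have Q: "lattice_cube a i = cube u s" by (simp add: lattice_cube_def u_def s_def)
    have "c \<in> cube u s" using i(1) B(2) unfolding Q by auto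
    then have g: "local_cube A u s"
      unfolding A_def using B i by (intro local_cube_of_ball) (auto simp: s_def)
    have sub: "ball c r \<subseteq> cube u s" using i(1) unfolding Q .
    have s: "0 < s" "s \<le> 6 * r" using i by (auto simp: s_def)
    have "ennreal (gauss_density u / R * (s / (12 * real CARD('n))) ^ CARD('n)) \<le> ennreal (measure gauss_measure B)"
      using emeasure_gauss_ball_ge[OF g sub B(2) s(2)] unfolding R_def B(1) emeasure_gauss_ball .
    then have "gauss_density u / R * (s ^ CARD('n) / d) \<le> measure gauss_measure B"
      by (subst (asm) ennreal_le_iff) (auto simp: d_def power_divide)
    then have "R\<^sup>2 * d * (gauss_density u / R * (s ^ CARD('n) / d)) \<le> R\<^sup>2 * d * measure gauss_measure B"
      using R d by (intro mult_left_mono) auto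
    moreover have "R\<^sup>2 * d * (gauss_density u / R * (s ^ CARD('n) / d)) = R * gauss_density u * s ^ CARD('n)"
      using R d by (simp add: power2_eq_square)
    ultimately have "measure gauss_measure (cube u s) \<le> R\<^sup>2 * d * measure gauss_measure B"
      using emeasure_gauss_cube_eq(3)[OF g] by (simp add: R_def)
    moreover have "i \<in> lattice_index a A" using g by (simp add: lattice_index_def u_def s_def)
    ultimately show ?thesis using sub unfolding B(1) Q[symmetric] by blast
  qed
  moreover have "0 < R\<^sup>2 * d" using R d by simp
  ultimately show ?thesis using that by blast
qed

lemma lattice_cube_borel [measurable]: "lattice_cube a i \<in> sets borel"
  by (simp add: lattice_cube_def)

lemma lattice_cube_measure:
  fixes i :: "nat \<times> (int ^ 'n::finite)"
  assumes "i \<in> lattice_index a A"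
  shows "0 < measure gauss_measure (lattice_cube a i)"
    "emeasure gauss_measure (lattice_cube a i) = ennreal (measure gauss_measure (lattice_cube a i))"
proof -
  have g: "local_cube A (lattice_corner a i) (lattice_side a i)"
    using assms by (simp add: lattice_index_def)
  have "0 < gauss_density (lattice_corner a i) / local_ratio TYPE('n) A * lattice_side a i ^ CARD('n)"
    using g gauss_density_pos[of "lattice_corner a i"] by (simp add: local_cube_def local_ratio_def)
  then show "0 < measure gauss_measure (lattice_cube a i)"
    unfolding lattice_cube_def using emeasure_gauss_cube_eq(2)[OF g] by linarith
  show "emeasure gauss_measure (lattice_cube a i) = ennreal (measure gauss_measure (lattice_cube a i))"
    unfolding lattice_cube_def by (rule emeasure_gauss_cube_eq(1)[OF g])
qed

text \<open>This is \<open>nn_integral_power_set_le\<close> with exponent \<open>1/\<tau>\<close>, applied to the power \<open>\<tau>\<close> of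
  \<open>h\<close>.\<close>

lemma nn_integral_small_power_set_le:
  fixes h :: "'a \<Rightarrow> ennreal"
  assumes [measurable]: "h \<in> borel_measurable M" "A \<in> sets M" and \<tau>: "0 < \<tau>" "\<tau> < 1"
  shows "(\<integral>\<^sup>+x\<in>A. ennreal_powr (h x) \<tau> \<partial>M) \<le>
    ennreal_powr (emeasure M A) (1 - \<tau>) * ennreal_powr (\<integral>\<^sup>+x\<in>A. h x \<partial>M) \<tau>"
proof -
  have r: "1 < 1 / \<tau>" using \<tau> by simp
  have "ennreal_powr (\<integral>\<^sup>+x\<in>A. ennreal_powr (h x) \<tau> \<partial>M) (1 / \<tau>) \<le>
      ennreal_powr (emeasure M A) (1 / \<tau> - 1) * (\<integral>\<^sup>+x\<in>A. ennreal_powr (ennreal_powr (h x) \<tau>) (1 / \<tau>) \<partial>M)"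
    by (rule nn_integral_power_set_le[OF _ _ r]) measurable
  then have "ennreal_powr (\<integral>\<^sup>+x\<in>A. ennreal_powr (h x) \<tau> \<partial>M) (1 / \<tau>) \<le>
      ennreal_powr (emeasure M A) (1 / \<tau> - 1) * (\<integral>\<^sup>+x\<in>A. h x \<partial>M)"
    using \<tau> by (simp add: ennreal_powr_powr)
  then have "ennreal_powr (ennreal_powr (\<integral>\<^sup>+x\<in>A. ennreal_powr (h x) \<tau> \<partial>M) (1 / \<tau>)) \<tau> \<le>
      ennreal_powr (ennreal_powr (emeasure M A) (1 / \<tau> - 1) * (\<integral>\<^sup>+x\<in>A. h x \<partial>M)) \<tau>"
    by (intro ennreal_powr_mono \<tau>)
  moreover have "(1 / \<tau> - 1) * \<tau> = 1 - \<tau>" using \<tau> by (simp add: field_simps)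
  ultimately show ?thesis
    using \<tau> by (simp add: ennreal_powr_powr ennreal_powr_mult)
qed

text \<open>Hoelder's inequality in \<open>y\<close> separates \<open>b\<close> from \<open>f\<close>; since \<open>q < \<sigma>\<close>, Jensen's inequality
  in \<open>x\<close> then reduces the factor with \<open>b\<close> to the double mean of \<open>\<bar>b x - b y\<bar>\<close> to the power
  \<open>\<sigma>\<close>.\<close>

lemma commutator_on_set:
  fixes b f :: "real ^ 'n::finite \<Rightarrow> real"
  assumes b [measurable]: "b \<in> borel_measurable borel" and f [measurable]: "f \<in> borel_measurable borel"
    and Q [measurable]: "Q \<in> sets borel" and m: "0 < m" "emeasure gauss_measure Q = ennreal m"
    and q: "1 < q" "q < \<sigma>" and s: "1 / s + 1 / \<sigma> = 1"
    and C: "0 < C" "0 < \<kappa>"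
    and osc: "(\<integral>\<^sup>+x\<in>Q. (\<integral>\<^sup>+y\<in>Q. ennreal (\<bar>b x - b y\<bar> powr \<sigma>) \<partial>gauss_measure) \<partial>gauss_measure) \<le> ennreal (C * \<kappa> powr \<sigma>) * (emeasure gauss_measure Q)\<^sup>2"
  shows "(\<integral>\<^sup>+x\<in>Q. ennreal_powr (\<integral>\<^sup>+y\<in>Q. ennreal (\<bar>b x - b y\<bar> * \<bar>f y\<bar>) \<partial>gauss_measure) q \<partial>gauss_measure)
    \<le> ennreal (C powr (q / \<sigma>) * \<kappa> powr q * m powr (1 + q / \<sigma>)) * ennreal_powr (\<integral>\<^sup>+y\<in>Q. ennreal (\<bar>f y\<bar> powr s) \<partial>gauss_measure) (q / s)"
proof -
  have s1: "1 < s"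
  proof -
    have "0 < 1 / \<sigma>" "1 / \<sigma> < 1" using q by auto
    then have "0 < 1 / s" "1 / s < 1" using s by linarith+
    then show ?thesis by (auto simp: divide_less_eq_1 zero_less_divide_iff)
  qed
  define H where "H = (\<lambda>x. \<integral>\<^sup>+y\<in>Q. ennreal (\<bar>b x - b y\<bar> powr \<sigma>) \<partial>gauss_measure)"
  define F where "F = (\<integral>\<^sup>+y\<in>Q. ennreal (\<bar>f y\<bar> powr s) \<partial>gauss_measure)"
  let ?J = "\<lambda>x. \<integral>\<^sup>+y\<in>Q. ennreal (\<bar>b x - b y\<bar> * \<bar>f y\<bar>) \<partial>gauss_measure"
  let ?H = "\<integral>\<^sup>+x\<in>Q. ennreal_powr (H x) (q / \<sigma>) \<partial>gauss_measure"
  have H [measurable]: "H \<in> borel_measurable borel"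
    unfolding H_def by (rule gauss.borel_measurable_nn_integral) measurable
  have pt: "ennreal_powr (?J x) q \<le> ennreal_powr (H x) (q / \<sigma>) * ennreal_powr F (q / s)" for x
  proof -
    have "(?J x) =
      (\<integral>\<^sup>+y. (ennreal \<bar>b x - b y\<bar> * indicator Q y) * (ennreal \<bar>f y\<bar> * indicator Q y) \<partial>gauss_measure)"
      by (intro nn_integral_cong) (auto simp: ennreal_mult indicator_def)
    also have "\<dots> \<le> ennreal_powr (\<integral>\<^sup>+y. ennreal_powr (ennreal \<bar>b x - b y\<bar> * indicator Q y) \<sigma> \<partial>gauss_measure) (1 / \<sigma>)
        * ennreal_powr (\<integral>\<^sup>+y. ennreal_powr (ennreal \<bar>f y\<bar> * indicator Q y) s \<partial>gauss_measure) (1 / s)"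
      using q s s1 by (intro nn_integral_Hoelder) auto
    also have "(\<integral>\<^sup>+y. ennreal_powr (ennreal \<bar>b x - b y\<bar> * indicator Q y) \<sigma> \<partial>gauss_measure) = H x"
      unfolding H_def by (intro nn_integral_cong) (auto simp: indicator_def ennreal_powr_ennreal)
    also have "(\<integral>\<^sup>+y. ennreal_powr (ennreal \<bar>f y\<bar> * indicator Q y) s \<partial>gauss_measure) = F"
      unfolding F_def by (intro nn_integral_cong) (auto simp: indicator_def ennreal_powr_ennreal)
    finally have "ennreal_powr (?J x) q \<le>
        ennreal_powr (ennreal_powr (H x) (1 / \<sigma>) * ennreal_powr F (1 / s)) q"
      using q by (intro ennreal_powr_mono) auto
    then show ?thesis using q by (simp add: ennreal_powr_mult ennreal_powr_powr)
  qed
  have "(\<integral>\<^sup>+x\<in>Q. ennreal_powr (?J x) q \<partial>gauss_measure)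
     \<le> (\<integral>\<^sup>+x. ennreal_powr (H x) (q / \<sigma>) * indicator Q x * ennreal_powr F (q / s) \<partial>gauss_measure)"
    using pt by (intro nn_integral_mono) (auto simp: indicator_def)
  also have "\<dots> = ?H * ennreal_powr F (q / s)"
    by (rule nn_integral_multc) measurable
  finally have 1: "(\<integral>\<^sup>+x\<in>Q. ennreal_powr (?J x) q \<partial>gauss_measure)
     \<le> ?H * ennreal_powr F (q / s)" .
  have "?H \<le>
      ennreal_powr (ennreal m) (1 - q / \<sigma>) * ennreal_powr (\<integral>\<^sup>+x\<in>Q. H x \<partial>gauss_measure) (q / \<sigma>)"
    unfolding m(2)[symmetric] using q by (intro nn_integral_small_power_set_le) auto
  moreover have "ennreal_powr (\<integral>\<^sup>+x\<in>Q. H x \<partial>gauss_measure) (q / \<sigma>) \<le> ennreal_powr (ennreal (C * \<kappa> powr \<sigma> * m\<^sup>2)) (q / \<sigma>)"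
    using osc q C m unfolding H_def
    by (intro ennreal_powr_mono) (auto simp: ennreal_mult ennreal_power)
  ultimately have "?H \<le>
      ennreal_powr (ennreal m) (1 - q / \<sigma>) * ennreal_powr (ennreal (C * \<kappa> powr \<sigma> * m\<^sup>2)) (q / \<sigma>)"
    by (meson mult_left_mono order_trans zero_le)
  also have "\<dots> = ennreal (m powr (1 - q / \<sigma>) * (C * \<kappa> powr \<sigma> * m\<^sup>2) powr (q / \<sigma>))"
    using m(1) C by (subst (1 2) ennreal_powr_ennreal) (auto intro!: ennreal_mult[symmetric])
  also have "m powr (1 - q / \<sigma>) * (C * \<kappa> powr \<sigma> * m\<^sup>2) powr (q / \<sigma>) = C powr (q / \<sigma>) * \<kappa> powr q * m powr (1 + q / \<sigma>)"
  proof -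
    have "(m\<^sup>2) powr (q / \<sigma>) = m powr (2 * (q / \<sigma>))"
      using m(1) by (simp add: powr_powr flip: powr_numeral)
    then have "(C * \<kappa> powr \<sigma> * m\<^sup>2) powr (q / \<sigma>) = C powr (q / \<sigma>) * \<kappa> powr q * m powr (2 * (q / \<sigma>))"
      using q by (simp add: powr_mult powr_powr)
    moreover have "m powr (1 - q / \<sigma>) * m powr (2 * (q / \<sigma>)) = m powr (1 + q / \<sigma>)"
      by (simp only: powr_add[symmetric]) (simp add: add.commute)
    ultimately show ?thesis by (simp add: mult_ac)
  qed
  finally have 2: "?H \<le> ennreal (C powr (q / \<sigma>) * \<kappa> powr q * m powr (1 + q / \<sigma>))" .
  show ?thesis unfolding F_def[symmetric]
    by (rule order_trans[OF 1 mult_right_mono[OF 2]]) simp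
qed

text \<open>Pointwise, the supremum over balls is dominated by the \<open>q\<close>-th root of a sum of \<open>q\<close>-th
  powers over lattice cubes. Each term is estimated by \<open>commutator_on_set\<close>, and
  \<open>fractional_embedding\<close>, applied to \<open>\<bar>f\<bar>\<close> to the power \<open>s\<close> with exponents \<open>p/s\<close> and
  \<open>q/s\<close>, sums the results.\<close>

lemma max_commutator_bound:
  fixes a \<beta> p q :: real
  assumes a: "0 < a" and \<beta>: "0 < \<beta>" "\<beta> < 1" and pq: "1 < p" "p < q" "1 / q = 1 / p - \<beta>"
  obtains C where "0 < C" "\<And>(b :: real ^ 'n::finite \<Rightarrow> real) f \<kappa>. \<lbrakk>integrable gauss_measure b; f \<in> borel_measurable borel; 0 < \<kappa>;
      \<And>B. B \<in> admissible_balls 1 \<Longrightarrow> pair_osc gauss_measure b B \<le> ennreal \<kappa> * (emeasure gauss_measure B)\<^sup>2\<rbrakk>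
    \<Longrightarrow> ennnorm q (max_commutator b a \<beta> f) \<le> ennreal (C * \<kappa>) * Lp_norm p f"
proof -
  define A where "A = 6 * a + 36 * real CARD('n) * a\<^sup>2"
  have A: "0 < A" unfolding A_def using a by (intro add_pos_nonneg) auto
  \<comment> \<open>The conjugate exponent \<open>s\<close> of \<open>\<sigma>\<close> is smaller than \<open>p\<close> exactly if \<open>\<sigma>\<close> exceeds the
    conjugate exponent of \<open>p\<close>; Jensen's inequality needs \<open>q < \<sigma>\<close>.\<close>
  define \<sigma> where "\<sigma> = max q (p / (p - 1)) + 1"
  define s where "s = \<sigma> / (\<sigma> - 1)"
  have sig: "q < \<sigma>" "p / (p - 1) < \<sigma>" by (auto simp: \<sigma>_def)
  have q1: "1 < q" using pq by simp
  have sig1: "1 < \<sigma>" using sig q1 by simp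
  have sig0: "0 < \<sigma>" using sig1 by simp
  have s1: "1 < s" using sig1 by (simp add: s_def)
  have conj: "1 / s + 1 / \<sigma> = 1" using sig1 by (simp add: s_def field_simps)
  have sp: "s < p"
  proof -
    have "p < \<sigma> * (p - 1)" using sig(2) pq(1) by (simp add: pos_divide_less_eq)
    then have "\<sigma> < p * (\<sigma> - 1)" by (simp add: algebra_simps)
    then show ?thesis using sig1 by (simp add: s_def pos_divide_less_eq)
  qed
  have P: "1 < p / s" "p / s < q / s" using sp pq s1 by (auto simp: divide_strict_right_mono)
  have PP: "(q / s) / (p / s) = q / p" using s1 by simp
  let ?e = "(q / s) / (p / s) - q / s"
  let ?Q = "\<lambda>i. lattice_cube a i :: (real ^ 'n) set"
  let ?m = "\<lambda>i. measure gauss_measure (?Q i)"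
  let ?I = "lattice_index a A :: (nat \<times> (int ^ 'n)) set"
  obtain K where K: "0 < K" "\<And>B. B \<in> admissible_balls a \<Longrightarrow> \<exists>i \<in> ?I. B \<subseteq> ?Q i \<and> ?m i \<le> K * measure gauss_measure B"
    using ball_in_lattice_cube[OF a, where 'n = 'n] unfolding A_def by blast
  obtain C1 where C1: "0 < C1"
    "\<And>(b :: real ^ 'n \<Rightarrow> real) \<kappa> u s. \<lbrakk>integrable gauss_measure b; 0 < \<kappa>;
      \<And>B. B \<in> admissible_balls 1 \<Longrightarrow> pair_osc gauss_measure b B \<le> ennreal \<kappa> * (emeasure gauss_measure B)\<^sup>2;
      local_cube A u s\<rbrakk> \<Longrightarrow>
      (\<integral>\<^sup>+x\<in>cube u s. (\<integral>\<^sup>+y\<in>cube u s. ennreal (\<bar>b x - b y\<bar> powr \<sigma>) \<partial>gauss_measure) \<partial>gauss_measure)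
        \<le> ennreal (C1 * \<kappa> powr \<sigma>) * (emeasure gauss_measure (cube u s))\<^sup>2"
  proof (rule gauss_power_oscillation[OF A sig0, where 'n = 'n], goal_cases)
    case (1 C)
    show ?case by (rule 1(1)[OF 1(2) 1(3)])
  qed
  have exps: "(q / s) / (p / s) - 1 \<noteq> 0" "1 / (p / s) - 1 \<noteq> 0" using P pq s1 sp by (auto simp: PP)
  obtain C2 where C2: "0 < C2" "\<And>(x :: real ^ 'n) \<tau>. 0 < \<tau> \<Longrightarrow>
    (\<integral>\<^sup>+i. ennreal (if x \<in> ?Q i \<and> ?m i powr ((q / s) / (p / s) - 1) \<le> \<tau> then ?m i powr ((q / s) / (p / s) - 1) else 0) \<partial>count_space ?I) \<le> ennreal (C2 * \<tau>)"
  proof (rule lattice_power_sum[OF a exps(1), where 'n = 'n and A = A], goal_cases)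
    case (1 C) show ?case by (rule 1(1)[OF 1(2) 1(3)])
  qed
  obtain C3 where C3: "0 < C3" "\<And>(x :: real ^ 'n) \<tau>. 0 < \<tau> \<Longrightarrow>
    (\<integral>\<^sup>+i. ennreal (if x \<in> ?Q i \<and> ?m i powr (1 / (p / s) - 1) \<le> \<tau> then ?m i powr (1 / (p / s) - 1) else 0) \<partial>count_space ?I) \<le> ennreal (C3 * \<tau>)"
  proof (rule lattice_power_sum[OF a exps(2), where 'n = 'n and A = A], goal_cases)
    case (1 C) show ?case by (rule 1(1)[OF 1(2) 1(3)])
  qed
  define C4 where "C4 = max C2 C3"
  have C4: "0 < C4" "C2 \<le> C4" "C3 \<le> C4" using C2(1) by (auto simp: C4_def)
  define E where "E = 2 powr (q / s) * (2 * C4)"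
  have E: "0 < E" using C4 by (simp add: E_def)
  define G where "G = K powr ((1 - \<beta>) * q) * C1 powr (q / \<sigma>) * E"
  have G: "0 < G" using K(1) C1(1) E by (simp add: G_def)
  have main: "ennnorm q (max_commutator b a \<beta> f) \<le> ennreal (G powr (1 / q) * \<kappa>) * Lp_norm p f"
    if int: "integrable gauss_measure b" and f [measurable]: "f \<in> borel_measurable borel" and \<kappa>: "0 < \<kappa>"
      and osc: "\<And>B. B \<in> admissible_balls 1 \<Longrightarrow> pair_osc gauss_measure b B \<le> ennreal \<kappa> * (emeasure gauss_measure B)\<^sup>2"
    for b f :: "real ^ 'n \<Rightarrow> real" and \<kappa>
  proof -
    have b [measurable]: "b \<in> borel_measurable borel"
      using borel_measurable_integrable[OF int] by simp
    define J where "J = (\<lambda>i x. \<integral>\<^sup>+y\<in>?Q i. ennreal (\<bar>b x - b y\<bar> * \<bar>f y\<bar>) \<partial>gauss_measure)"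
    have [measurable]: "J i \<in> borel_measurable borel" for i
      unfolding J_def by (rule borel_inner_integral_gauss) auto
    define F where "F = (\<lambda>y. \<bar>f y\<bar> powr s)"
    let ?\<Phi> = "\<lambda>i. ennreal_powr (\<integral>\<^sup>+y\<in>?Q i. ennreal (F y) \<partial>gauss_measure) (q / s)"
    let ?J = "\<lambda>B x. \<integral>\<^sup>+y\<in>B. ennreal (\<bar>b x - b y\<bar> * \<bar>f y\<bar>) \<partial>gauss_measure"
    let ?c = "K powr ((1 - \<beta>) * q) * C1 powr (q / \<sigma>) * \<kappa> powr q"
    define V where "V = (\<lambda>i x. ennreal (K powr ((1 - \<beta>) * q) * ?m i powr ((\<beta> - 1) * q)) * (ennreal_powr (J i x) q * indicator (?Q i) x))"
    have V: "V i \<in> borel_measurable gauss_measure" for i unfolding V_def by measurable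
    have mI: "0 < ?m i" "emeasure gauss_measure (?Q i) = ennreal (?m i)" if "i \<in> ?I" for i
      by (rule lattice_cube_measure[OF that])+
    have point: "ennreal_powr (max_commutator b a \<beta> f x) q \<le> (\<integral>\<^sup>+i. V i x \<partial>count_space ?I)" for x
    proof -
      have "max_commutator b a \<beta> f x \<le> ennreal_powr (\<integral>\<^sup>+i. V i x \<partial>count_space ?I) (1 / q)"
        unfolding max_commutator_def
      proof (rule SUP_least)
        fix B assume "B \<in> {B \<in> admissible_balls a. x \<in> B}"
        then have B: "B \<in> admissible_balls a" "x \<in> B" by auto
        obtain c r where cr: "B = ball c r" "0 < r" using admissible_ballsE[OF B(1) a] by metis
        let ?g = "measure gauss_measure B"
        have g: "0 < ?g" unfolding cr(1) by (rule measure_gauss_ball_pos[OF cr(2)])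
        obtain i where i: "i \<in> ?I" "B \<subseteq> ?Q i" "?m i \<le> K * ?g" using K(2)[OF B(1)] by blast
        have "1 / ?g powr (1 - \<beta>) \<le> K powr (1 - \<beta>) * ?m i powr (\<beta> - 1)"
        proof -
          have "?m i powr (1 - \<beta>) \<le> (K * ?g) powr (1 - \<beta>)"
            using i(3) \<beta> by (intro powr_mono2) auto
          also have "\<dots> = K powr (1 - \<beta>) * ?g powr (1 - \<beta>)" by (rule powr_mult)
          finally have "?m i powr (1 - \<beta>) \<le> K powr (1 - \<beta>) * ?g powr (1 - \<beta>)" .
          moreover have "0 < ?m i powr (1 - \<beta>)" "0 < ?g powr (1 - \<beta>)" using mI(1)[OF i(1)] g by auto
          moreover have "1 / Y \<le> Z * (1 / X)" if "X \<le> Z * Y" "0 < X" "0 < Y" for X Y Z :: real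
            using that by (simp add: field_simps)
          ultimately have "1 / ?g powr (1 - \<beta>) \<le> K powr (1 - \<beta>) * (1 / ?m i powr (1 - \<beta>))" by blast
          also have "1 / ?m i powr (1 - \<beta>) = ?m i powr (\<beta> - 1)"
            using powr_minus_divide[of "?m i" "1 - \<beta>"] by simp
          finally show ?thesis .
        qed
        then have "?J B x * ennreal (1 / ?g powr (1 - \<beta>)) \<le>
            J i x * ennreal (K powr (1 - \<beta>) * ?m i powr (\<beta> - 1))"
          unfolding J_def using i(2)
          by (intro mult_mono nn_integral_mono mult_left_mono ennreal_leI) (auto simp: indicator_def)
        then have le: "?J B x / ennreal (?g powr (1 - \<beta>)) \<le>
            J i x * ennreal (K powr (1 - \<beta>) * ?m i powr (\<beta> - 1))"
          using g by (subst ennreal_divide_pos) auto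
        have "ennreal_powr (J i x * ennreal (K powr (1 - \<beta>) * ?m i powr (\<beta> - 1))) q = V i x"
        proof -
          have "(K powr (1 - \<beta>) * ?m i powr (\<beta> - 1)) powr q = K powr ((1 - \<beta>) * q) * ?m i powr ((\<beta> - 1) * q)"
            by (simp only: powr_mult powr_powr)
          then show ?thesis
            using q1 i(2) B(2) unfolding V_def by (simp add: ennreal_powr_mult ennreal_powr_ennreal mult.commute subsetD)
        qed
        also have "V i x \<le> (\<integral>\<^sup>+i. V i x \<partial>count_space ?I)"
          using i(1) by (rule nn_integral_ge_point)
        finally have "ennreal_powr (ennreal_powr (J i x * ennreal (K powr (1 - \<beta>) * ?m i powr (\<beta> - 1))) q) (1 / q)
            \<le> ennreal_powr (\<integral>\<^sup>+i. V i x \<partial>count_space ?I) (1 / q)"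
          using q1 by (intro ennreal_powr_mono) auto
        then show "?J B x / ennreal (?g powr (1 - \<beta>)) \<le>
            ennreal_powr (\<integral>\<^sup>+i. V i x \<partial>count_space ?I) (1 / q)"
          using le q1 by (simp add: ennreal_powr_powr)
      qed
      then have "ennreal_powr (max_commutator b a \<beta> f x) q \<le> ennreal_powr (ennreal_powr (\<integral>\<^sup>+i. V i x \<partial>count_space ?I) (1 / q)) q"
        using q1 by (intro ennreal_powr_mono) auto
      then show ?thesis using q1 by (simp add: ennreal_powr_powr)
    qed
    have cube: "(\<integral>\<^sup>+x. V i x \<partial>gauss_measure) \<le> ennreal (?c) *
        (ennreal (?m i powr ?e) * ?\<Phi> i)" if i: "i \<in> ?I" for i
    proof -
      have g: "local_cube A (lattice_corner a i :: real ^ 'n) (lattice_side a i)" using i by (simp add: lattice_index_def)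
      have "(\<integral>\<^sup>+x\<in>?Q i. ennreal_powr (J i x) q \<partial>gauss_measure)
        \<le> ennreal (C1 powr (q / \<sigma>) * \<kappa> powr q * ?m i powr (1 + q / \<sigma>)) * ?\<Phi> i"
        unfolding J_def F_def
        by (rule commutator_on_set[OF b f _ mI[OF i] q1 sig(1) conj C1(1) \<kappa>])
          (measurable, unfold lattice_cube_def, rule C1(2)[OF int \<kappa> osc g])
      then have "(\<integral>\<^sup>+x. V i x \<partial>gauss_measure) \<le> ennreal (K powr ((1 - \<beta>) * q) * ?m i powr ((\<beta> - 1) * q)) *
          (ennreal (C1 powr (q / \<sigma>) * \<kappa> powr q * ?m i powr (1 + q / \<sigma>)) * ?\<Phi> i)"
        unfolding V_def by (subst nn_integral_cmult) (auto intro: mult_left_mono)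
      also have "\<dots> = ennreal ((K powr ((1 - \<beta>) * q) * ?m i powr ((\<beta> - 1) * q)) * (C1 powr (q / \<sigma>) * \<kappa> powr q * ?m i powr (1 + q / \<sigma>))) *
          ?\<Phi> i"
        by (simp only: mult.assoc[symmetric]) (simp only: ennreal_mult powr_ge_zero mult_nonneg_nonneg mult.assoc)
      also have "(K powr ((1 - \<beta>) * q) * ?m i powr ((\<beta> - 1) * q)) * (C1 powr (q / \<sigma>) * \<kappa> powr q * ?m i powr (1 + q / \<sigma>)) =
          (?c) * ?m i powr ?e"
      proof -
        \<comment> \<open>The exponents of the mass balance because \<open>1/q = 1/p - \<beta>\<close> and \<open>1/s + 1/\<sigma> = 1\<close>.\<close>
        have "(\<beta> - 1) * q + (1 + q / \<sigma>) = q / p - q / s"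
        proof -
          have "1 = q * (1 / q)" using q1 by simp
          also have "\<dots> = q / p - q * \<beta>" unfolding pq(3) by (simp add: right_diff_distrib)
          finally have 1: "q * \<beta> = q / p - 1" by simp
          have "q * (1 / s + 1 / \<sigma>) = q" unfolding conj by simp
          then have "q / \<sigma> = q - q / s" by (simp add: distrib_left)
          then show ?thesis using 1 by (simp add: algebra_simps)
        qed
        then have "?m i powr ((\<beta> - 1) * q) * ?m i powr (1 + q / \<sigma>) = ?m i powr ?e"
          unfolding PP by (simp add: powr_add[symmetric])
        then show ?thesis by (simp add: mult_ac)
      qed
      also have "ennreal (?c * ?m i powr ?e) =
        ennreal (?c) * ennreal (?m i powr ?e)"
        by (rule ennreal_mult) auto
      finally show ?thesis by (simp only: mult.assoc)
    qed
    have emb: "(\<integral>\<^sup>+i. ennreal (?m i powr ?e) * ?\<Phi> i \<partial>count_space ?I)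
      \<le> ennreal E * ennreal_powr (\<integral>\<^sup>+y. ennreal (F y powr (p / s)) \<partial>gauss_measure) ((q / s) / (p / s))"
      unfolding E_def
    proof (rule fractional_embedding[OF P countable_lattice_index _ _ mI _ C4(1)])
      fix e \<tau> :: real and x :: "real ^ 'n" assume e: "e \<in> {(q / s) / (p / s) - 1, 1 / (p / s) - 1}" and \<tau>: "0 < \<tau>"
      have le: "ennreal (C2 * \<tau>) \<le> ennreal (C4 * \<tau>)" "ennreal (C3 * \<tau>) \<le> ennreal (C4 * \<tau>)"
        using C4 \<tau> by (auto intro!: ennreal_leI mult_right_mono)
      from e consider "e = (q / s) / (p / s) - 1" | "e = 1 / (p / s) - 1" by blast
      then show "(\<integral>\<^sup>+i. ennreal (if x \<in> ?Q i \<and> ?m i powr e \<le> \<tau> then ?m i powr e else 0) \<partial>count_space ?I) \<le> ennreal (C4 * \<tau>)"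
      proof cases
        case 1 show ?thesis unfolding 1 by (rule order_trans[OF C2(2)[OF \<tau>] le(1)])
      next
        case 2 show ?thesis unfolding 2 by (rule order_trans[OF C3(2)[OF \<tau>] le(2)])
      qed
    qed (simp_all add: F_def)
    define N where "N = (\<integral>\<^sup>+y. ennreal_powr (ennreal \<bar>f y\<bar>) p \<partial>gauss_measure)"
    have FN: "(\<integral>\<^sup>+y. ennreal (F y powr (p / s)) \<partial>gauss_measure) = N"
      unfolding N_def F_def using s1 by (intro nn_integral_cong) (simp add: ennreal_powr_ennreal powr_powr)
    have "(\<integral>\<^sup>+x. ennreal_powr (max_commutator b a \<beta> f x) q \<partial>gauss_measure) \<le> (\<integral>\<^sup>+x. \<integral>\<^sup>+i. V i x \<partial>count_space ?I \<partial>gauss_measure)"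
      by (intro nn_integral_mono point)
    also have "\<dots> = (\<integral>\<^sup>+i. \<integral>\<^sup>+x. V i x \<partial>gauss_measure \<partial>count_space ?I)"
      by (rule nn_integral_count_space_nn_integral[OF countable_lattice_index V])
    also have "\<dots> \<le> (\<integral>\<^sup>+i. ennreal (?c) *
        (ennreal (?m i powr ?e) * ?\<Phi> i) \<partial>count_space ?I)"
      by (rule nn_integral_mono) (rule cube, simp)
    also have "\<dots> = ennreal (?c) *
        (\<integral>\<^sup>+i. ennreal (?m i powr ?e) * ?\<Phi> i \<partial>count_space ?I)"
      by (rule nn_integral_cmult) simp
    also have "\<dots> \<le> ennreal (?c) * (ennreal E * ennreal_powr N (q / p))"
      using emb unfolding FN PP by (rule mult_left_mono) simp
    also have "\<dots> = ennreal (G * \<kappa> powr q) * ennreal_powr N (q / p)"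
    proof -
      have "ennreal (?c) * ennreal E = ennreal (G * \<kappa> powr q)"
        using E by (subst ennreal_mult[symmetric]) (auto simp: G_def mult_ac)
      then show ?thesis by (simp only: mult.assoc[symmetric])
    qed
    finally have "ennnorm q (max_commutator b a \<beta> f) \<le> ennreal_powr (ennreal (G * \<kappa> powr q) * ennreal_powr N (q / p)) (1 / q)"
      unfolding ennnorm_def using q1 by (intro ennreal_powr_mono) auto
    also have "\<dots> = ennreal ((G * \<kappa> powr q) powr (1 / q)) * ennreal_powr N (1 / p)"
      using q1 G by (simp add: ennreal_powr_mult ennreal_powr_powr ennreal_powr_ennreal)
    also have "(G * \<kappa> powr q) powr (1 / q) = G powr (1 / q) * \<kappa>"
      using q1 \<kappa> by (simp add: powr_mult powr_powr)
    finally show ?thesis unfolding Lp_norm_def ennnorm_def N_def .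
  qed
  have "0 < G powr (1 / q)" using G by simp
  then show ?thesis by (rule that[OF _ main])
qed

section \<open>The seminorm, the domain and sublinearity\<close>

lemma ennreal_divide_le_iff:
  assumes "0 < m"
  shows "x / ennreal m \<le> k \<longleftrightarrow> x \<le> k * ennreal m"
proof
  assume "x / ennreal m \<le> k"
  then have "x * ennreal (1 / m) * ennreal m \<le> k * ennreal m"
    unfolding ennreal_divide_pos[OF assms] by (rule mult_right_mono) simp
  then show "x \<le> k * ennreal m" using assms by (simp add: mult.assoc ennreal_mult[symmetric])
next
  assume "x \<le> k * ennreal m"
  then have "x * ennreal (1 / m) \<le> k * ennreal m * ennreal (1 / m)"
    by (rule mult_right_mono) simp
  then show "x / ennreal m \<le> k"
    unfolding ennreal_divide_pos[OF assms] using assms by (simp add: mult.assoc ennreal_mult[symmetric])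
qed

lemma admissible_ball_measure:
  fixes B :: "(real ^ 'n::finite) set"
  assumes "B \<in> admissible_balls a" "0 < a"
  shows "B \<in> sets borel" "0 < measure gauss_measure B"
    "emeasure gauss_measure B = ennreal (measure gauss_measure B)" "bounded B"
proof -
  obtain c r where B: "B = ball c r" "0 < r" using admissible_ballsE[OF assms] by metis
  show "B \<in> sets borel" "0 < measure gauss_measure B"
    "emeasure gauss_measure B = ennreal (measure gauss_measure B)" "bounded B"
    unfolding B(1) using B(2) by (simp_all only: ball_borel measure_gauss_ball_pos emeasure_gauss_ball bounded_ball)
qed

text \<open>Compare \<open>b x\<close> and \<open>b y\<close> with the mean of \<open>b\<close> over \<open>B\<close>.\<close>

lemma pair_osc_le_bmo:
  fixes b :: "real ^ 'n::finite \<Rightarrow> real"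
  assumes b [measurable]: "b \<in> borel_measurable borel" and B: "B \<in> admissible_balls 1"
  shows "pair_osc gauss_measure b B \<le> 2 * bmo_seminorm b * (emeasure gauss_measure B)\<^sup>2"
proof -
  note mB = admissible_ball_measure[OF B zero_less_one]
  note [measurable] = mB(1)
  define v where "v = ball_average b B"
  define m where "m = measure gauss_measure B"
  have m: "0 < m" "emeasure gauss_measure B = ennreal m" using mB by (auto simp: m_def)
  define X where "X = (\<integral>\<^sup>+x\<in>B. ennreal \<bar>b x - v\<bar> \<partial>gauss_measure)"
  have "X / ennreal m \<le> bmo_seminorm b"
    unfolding bmo_seminorm_def X_def v_def m_def using B by (rule SUP_upper)
  then have X: "X \<le> bmo_seminorm b * ennreal m" using ennreal_divide_le_iff[OF m(1)] by blast
  have tri: "ennreal \<bar>b x - b y\<bar> \<le> ennreal \<bar>b x - v\<bar> + ennreal \<bar>b y - v\<bar>" for x y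
    by (simp add: ennreal_plus[symmetric] ennreal_leI del: ennreal_plus)
  have inner: "(\<integral>\<^sup>+y\<in>B. ennreal \<bar>b x - b y\<bar> \<partial>gauss_measure) \<le> ennreal \<bar>b x - v\<bar> * ennreal m + X" for x
  proof -
    have "(\<integral>\<^sup>+y\<in>B. ennreal \<bar>b x - b y\<bar> \<partial>gauss_measure) \<le> (\<integral>\<^sup>+y. ennreal \<bar>b x - v\<bar> * indicator B y + ennreal \<bar>b y - v\<bar> * indicator B y \<partial>gauss_measure)"
      using tri by (intro nn_integral_mono) (auto split: split_indicator)
    also have "\<dots> = ennreal \<bar>b x - v\<bar> * ennreal m + X"
      by (simp add: nn_integral_add nn_integral_cmult_indicator m X_def)
    finally show ?thesis .
  qed
  have "pair_osc gauss_measure b B \<le> (\<integral>\<^sup>+x. ennreal m * (ennreal \<bar>b x - v\<bar> * indicator B x) + X * indicator B x \<partial>gauss_measure)"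
    unfolding pair_osc_def using inner by (intro nn_integral_mono) (auto simp: mult.commute split: split_indicator)
  also have "\<dots> = ennreal m * X + X * ennreal m"
    by (simp add: nn_integral_add nn_integral_cmult nn_integral_cmult_indicator m X_def)
  also have "\<dots> = 2 * (X * ennreal m)" by (simp add: mult_2 mult.commute)
  also have "\<dots> \<le> 2 * (bmo_seminorm b * ennreal m * ennreal m)"
    by (intro mult_left_mono mult_right_mono X) auto
  finally show ?thesis unfolding m(2) by (simp add: power2_eq_square mult.assoc)
qed

text \<open>The counterpart of \<open>cube_avg_osc_le_pair_osc\<close> for \<open>\<gamma>\<close> and balls.\<close>

lemma bmo_le_pair_osc:
  fixes b :: "real ^ 'n::finite \<Rightarrow> real"
  assumes int: "integrable gauss_measure b"
    and osc: "\<And>B. B \<in> admissible_balls 1 \<Longrightarrow> pair_osc gauss_measure b B \<le> \<kappa> * (emeasure gauss_measure B)\<^sup>2"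
  shows "bmo_seminorm b \<le> \<kappa>"
  unfolding bmo_seminorm_def
proof (rule SUP_least)
  fix B :: "(real ^ 'n) set" assume B: "B \<in> admissible_balls 1"
  have b [measurable]: "b \<in> borel_measurable borel" using borel_measurable_integrable[OF int] by simp
  note mB = admissible_ball_measure[OF B zero_less_one]
  note [measurable] = mB(1)
  define v where "v = ball_average b B"
  define m where "m = measure gauss_measure B"
  have m: "0 < m" "emeasure gauss_measure B = ennreal m" using mB by (auto simp: m_def)
  have iB: "set_integrable gauss_measure B b"
    unfolding set_integrable_def by (rule integrable_mult_indicator[OF _ int]) simp
  have cB: "set_integrable gauss_measure B (\<lambda>y. c :: real)" for c
    unfolding set_integrable_def using m by (intro integrable_scaleR_left integrable_real_indicator) auto
  define X where "X = (\<integral>\<^sup>+x\<in>B. ennreal \<bar>b x - v\<bar> \<partial>gauss_measure)"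
  have pt: "ennreal m * ennreal \<bar>b x - v\<bar> \<le> (\<integral>\<^sup>+y\<in>B. ennreal \<bar>b x - b y\<bar> \<partial>gauss_measure)" for x
  proof -
    have di: "set_integrable gauss_measure B (\<lambda>y. b x - b y)" by (rule set_integral_diff(1)[OF cB iB])
    have "(LINT y:B|gauss_measure. b x) = b x * m"
      by (simp add: set_lebesgue_integral_def m_def)
    moreover have "(LINT y:B|gauss_measure. b y) = v * m"
      using m by (simp add: v_def ball_average_def m_def)
    ultimately have "(b x - v) * m = (LINT y:B|gauss_measure. b x - b y)"
      by (simp add: set_integral_diff(2)[OF cB iB] left_diff_distrib)
    then have "m * \<bar>b x - v\<bar> = \<bar>LINT y:B|gauss_measure. b x - b y\<bar>"
      using m(1) by (metis abs_mult abs_of_pos mult.commute)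
    also have "\<dots> \<le> (LINT y:B|gauss_measure. \<bar>b x - b y\<bar>)"
      using set_integral_norm_bound[OF di] by simp
    finally have "ennreal (m * \<bar>b x - v\<bar>) \<le> (\<integral>\<^sup>+y\<in>B. ennreal \<bar>b x - b y\<bar> \<partial>gauss_measure)"
      using set_nn_integral_eq_LINT[OF set_integrable_abs[OF di]] by (simp add: ennreal_leI)
    then show ?thesis using m(1) by (simp add: ennreal_mult)
  qed
  have "ennreal m * X = (\<integral>\<^sup>+x. ennreal m * (ennreal \<bar>b x - v\<bar> * indicator B x) \<partial>gauss_measure)"
    unfolding X_def by (rule nn_integral_cmult[symmetric]) simp
  also have "\<dots> \<le> pair_osc gauss_measure b B"
    unfolding pair_osc_def using pt by (intro nn_integral_mono) (auto split: split_indicator)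
  also have "\<dots> \<le> \<kappa> * (ennreal m)\<^sup>2" using osc[OF B] m by simp
  finally have "ennreal (1 / m) * (ennreal m * X) \<le> ennreal (1 / m) * (\<kappa> * (ennreal m)\<^sup>2)"
    by (rule mult_left_mono) simp
  moreover have "ennreal (1 / m) * (ennreal m * X) = X"
    using m(1) by (simp add: mult.assoc[symmetric] ennreal_mult[symmetric])
  moreover have "ennreal (1 / m) * (\<kappa> * (ennreal m)\<^sup>2) = \<kappa> * ennreal m"
  proof -
    have "ennreal (1 / m) * (\<kappa> * (ennreal m)\<^sup>2) = \<kappa> * (ennreal (1 / m) * ennreal m * ennreal m)"
      by (simp add: power2_eq_square mult_ac)
    also have "ennreal (1 / m) * ennreal m = 1" using m(1) by (simp add: ennreal_mult[symmetric])
    finally show ?thesis by simp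
  qed
  ultimately have "X \<le> \<kappa> * ennreal m" by simp
  then show "(\<integral>\<^sup>+x\<in>B. ennreal \<bar>b x - ball_average b B\<bar> \<partial>gauss_measure) / ennreal (measure gauss_measure B) \<le> \<kappa>"
    unfolding X_def v_def m_def[symmetric] ennreal_divide_le_iff[OF m(1)] .
qed

lemma BMO_D:
  assumes "b \<in> BMO"
  shows "integrable gauss_measure b" "b \<in> borel_measurable borel" "bmo_seminorm b < top"
  using assms borel_measurable_integrable[of gauss_measure b] by (auto simp: BMO_def Lp_space_1_eq)

lemma Lp_spaceI_Linf_c:
  fixes f :: "real ^ 'n::finite \<Rightarrow> real"
  assumes "f \<in> Linf_c" "0 < p"
  shows "f \<in> Lp_space p"
proof -
  obtain M K where f: "f \<in> borel_measurable borel" "AE x in gauss_measure. \<bar>f x\<bar> \<le> M"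
    "compact K" "AE x in gauss_measure. x \<notin> K \<longrightarrow> f x = 0"
    using assms(1) by (auto simp: Linf_c_def)
  have "(\<integral>\<^sup>+x. ennreal_powr (ennreal \<bar>f x\<bar>) p \<partial>gauss_measure) \<le> (\<integral>\<^sup>+x. ennreal (M powr p) * indicator K x \<partial>gauss_measure)"
  proof (rule nn_integral_mono_AE)
    show "AE x in gauss_measure. ennreal_powr (ennreal \<bar>f x\<bar>) p \<le> ennreal (M powr p) * indicator K x"
      using f(2,4)
    proof eventually_elim
      case (elim x)
      then show ?case using assms(2)
        by (cases "x \<in> K") (auto simp: ennreal_powr_ennreal intro!: ennreal_leI powr_mono2)
    qed
  qed
  also have "\<dots> = ennreal (M powr p) * emeasure gauss_measure K"
    using f(3) by (intro nn_integral_cmult_indicator) (simp add: borel_compact)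
  also have "\<dots> < top"
    using emeasure_gauss_bounded_finite[of K] f(3)
    by (simp add: ennreal_mult_less_top compact_imp_bounded borel_compact)
  finally show ?thesis using f(1) by (simp add: Lp_space_def Lp_norm_def ennnorm_def less_top[symmetric])
qed

lemma max_commutator_cong_AE:
  assumes "AE x in gauss_measure. f x = g x"
  shows "max_commutator b a \<beta> f x = max_commutator b a \<beta> g x"
  unfolding max_commutator_def
proof (intro SUP_cong refl arg_cong2[where f = divide] nn_integral_cong_AE)
  fix B
  show "AE y in gauss_measure. ennreal (\<bar>b x - b y\<bar> * \<bar>f y\<bar>) * indicator B y = ennreal (\<bar>b x - b y\<bar> * \<bar>g y\<bar>) * indicator B y"
    using assms by eventually_elim simp
qed

lemma max_commutator_add_le:
  fixes b f g :: "real ^ 'n::finite \<Rightarrow> real"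
  assumes a: "0 < a" and [measurable]: "b \<in> borel_measurable borel" "f \<in> borel_measurable borel" "g \<in> borel_measurable borel"
  shows "max_commutator b a \<beta> (\<lambda>y. f y + g y) x \<le> max_commutator b a \<beta> f x + max_commutator b a \<beta> g x"
  unfolding max_commutator_def[of b a \<beta> "\<lambda>y. f y + g y"]
proof (rule SUP_least)
  fix B assume "B \<in> {B \<in> admissible_balls a. x \<in> B}"
  then have B: "B \<in> admissible_balls a" "x \<in> B" by auto
  note [measurable] = admissible_ball_measure(1)[OF B(1) a]
  let ?I = "\<lambda>h. \<integral>\<^sup>+y\<in>B. ennreal (\<bar>b x - b y\<bar> * \<bar>h y\<bar>) \<partial>gauss_measure"
  let ?w = "ennreal (measure gauss_measure B powr (1 - \<beta>))"
  have "?I (\<lambda>y. f y + g y) \<le> (\<integral>\<^sup>+y. ennreal (\<bar>b x - b y\<bar> * \<bar>f y\<bar>) * indicator B y + ennreal (\<bar>b x - b y\<bar> * \<bar>g y\<bar>) * indicator B y \<partial>gauss_measure)"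
  proof (rule nn_integral_mono)
    fix y
    have "\<bar>b x - b y\<bar> * \<bar>f y + g y\<bar> \<le> \<bar>b x - b y\<bar> * \<bar>f y\<bar> + \<bar>b x - b y\<bar> * \<bar>g y\<bar>"
      unfolding distrib_left[symmetric] by (intro mult_left_mono) auto
    then have "ennreal (\<bar>b x - b y\<bar> * \<bar>f y + g y\<bar>) \<le> ennreal (\<bar>b x - b y\<bar> * \<bar>f y\<bar>) + ennreal (\<bar>b x - b y\<bar> * \<bar>g y\<bar>)"
      by (simp add: ennreal_plus[symmetric] ennreal_leI del: ennreal_plus)
    then show "ennreal (\<bar>b x - b y\<bar> * \<bar>f y + g y\<bar>) * indicator B y \<le> ennreal (\<bar>b x - b y\<bar> * \<bar>f y\<bar>) * indicator B y + ennreal (\<bar>b x - b y\<bar> * \<bar>g y\<bar>) * indicator B y"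
      by (simp split: split_indicator)
  qed
  also have "\<dots> = ?I f + ?I g" by (rule nn_integral_add) measurable
  finally have "?I (\<lambda>y. f y + g y) / ?w \<le> ?I f / ?w + ?I g / ?w"
    unfolding divide_ennreal_def distrib_right[symmetric] by (rule mult_right_mono) simp
  also have "\<dots> \<le> max_commutator b a \<beta> f x + max_commutator b a \<beta> g x"
    unfolding max_commutator_def using B by (intro add_mono SUP_upper2[of B]) auto
  finally show "?I (\<lambda>y. f y + g y) / ?w \<le> max_commutator b a \<beta> f x + max_commutator b a \<beta> g x" .
qed

lemma max_commutator_cmult:
  fixes b f :: "real ^ 'n::finite \<Rightarrow> real"
  assumes a: "0 < a" and [measurable]: "b \<in> borel_measurable borel" "f \<in> borel_measurable borel"
  shows "max_commutator b a \<beta> (\<lambda>y. c * f y) x = ennreal \<bar>c\<bar> * max_commutator b a \<beta> f x"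
proof -
  let ?I = "\<lambda>B h. \<integral>\<^sup>+y\<in>B. ennreal (\<bar>b x - b y\<bar> * \<bar>h y\<bar>) \<partial>gauss_measure"
  let ?w = "\<lambda>B. ennreal (measure gauss_measure B powr (1 - \<beta>))"
  have "?I B (\<lambda>y. c * f y) / ?w B = ennreal \<bar>c\<bar> * (?I B f / ?w B)" if "B \<in> admissible_balls a" for B
  proof -
    note [measurable] = admissible_ball_measure(1)[OF that a]
    have "?I B (\<lambda>y. c * f y) = (\<integral>\<^sup>+y. ennreal \<bar>c\<bar> * (ennreal (\<bar>b x - b y\<bar> * \<bar>f y\<bar>) * indicator B y) \<partial>gauss_measure)"
      by (intro nn_integral_cong) (simp add: ennreal_mult[symmetric] abs_mult mult_ac split: split_indicator)
    also have "\<dots> = ennreal \<bar>c\<bar> * ?I B f" by (rule nn_integral_cmult) measurable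
    finally show ?thesis by (simp add: divide_ennreal_def mult.assoc)
  qed
  then show ?thesis
    unfolding max_commutator_def by (subst SUP_mult_left_ennreal) (auto intro!: SUP_cong)
qed

lemma sublinear_max_commutator:
  fixes b :: "real ^ 'n::finite \<Rightarrow> real"
  assumes "0 < a" "b \<in> borel_measurable borel"
  shows "sublinear_op_on (Lp_space p) (max_commutator b a \<beta>)"
  unfolding sublinear_op_on_def
  using assms max_commutator_cong_AE[where b = b] max_commutator_add_le[where b = b] max_commutator_cmult[where b = b]
  by (auto simp: Lp_space_def intro!: AE_I2)

section \<open>Uniqueness of the extension\<close>

lemma ennreal_le_zero_if_scaled:
  fixes x :: ennreal
  assumes "\<And>e. 0 < e \<Longrightarrow> x \<le> ennreal (L * e)" "0 \<le> L"
  shows "x = 0"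
proof -
  have "x \<le> ennreal L" using assms(1)[of 1] by simp
  then obtain t where t: "x = ennreal t" "0 \<le> t" by (cases x) (auto simp: top_unique)
  have "t \<le> d" if "0 < d" for d
  proof -
    have "x \<le> ennreal (L * (d / (L + 1)))" using assms that by (intro assms(1)) auto
    also have "\<dots> \<le> ennreal d" using assms(2) that by (intro ennreal_leI) (simp add: field_simps)
    finally show ?thesis using t that by simp
  qed
  then have "t \<le> 0" by (rule field_le_epsilon) simp
  then show ?thesis using t by simp
qed

text \<open>The bound \<open>max_commutator_bound\<close> is stated for positive \<open>\<kappa>\<close>. If the seminorm vanishes,
  let \<open>\<kappa>\<close> tend to \<open>0\<close>; this uses that the norm of \<open>f\<close> is finite.\<close>

lemma commutator_norm_le:
  fixes a \<beta> p q :: real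
  assumes a: "0 < a" and \<beta>: "0 < \<beta>" "\<beta> < 1" and pq: "1 < p" "p < q" "1 / q = 1 / p - \<beta>"
  obtains C where "0 < C" "\<And>(b :: real ^ 'n::finite \<Rightarrow> real) f. b \<in> BMO \<Longrightarrow> f \<in> Lp_space p \<Longrightarrow>
      ennnorm q (max_commutator b a \<beta> f) \<le> ennreal C * bmo_seminorm b * Lp_norm p f"
proof (rule max_commutator_bound[OF a \<beta> pq, where 'n = 'n], goal_cases)
  case (1 C)
  note C = 1(3)
  have main: "ennnorm q (max_commutator b a \<beta> f) \<le> ennreal (2 * C) * bmo_seminorm b * Lp_norm p f"
    if b: "b \<in> BMO" and f: "f \<in> Lp_space p" for b f :: "real ^ 'n \<Rightarrow> real"
  proof -
    note bd = BMO_D[OF b]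
    have f': "f \<in> borel_measurable borel" "Lp_norm p f < top" using f by (auto simp: Lp_space_def)
    obtain k where k: "bmo_seminorm b = ennreal k" "0 \<le> k" using bd(3) by (cases "bmo_seminorm b") auto
    obtain l where l: "Lp_norm p f = ennreal l" "0 \<le> l" using f'(2) by (cases "Lp_norm p f") auto
    have bound: "ennnorm q (max_commutator b a \<beta> f) \<le> ennreal (C * \<kappa> * l)" if \<kappa>: "0 < \<kappa>" "2 * k \<le> \<kappa>" for \<kappa>
    proof -
      have "ennnorm q (max_commutator b a \<beta> f) \<le> ennreal (C * \<kappa>) * Lp_norm p f"
      proof (rule C[OF bd(1) f'(1) \<kappa>(1)])
        fix B :: "(real ^ 'n) set" assume B: "B \<in> admissible_balls 1"
        have "2 * bmo_seminorm b = ennreal (2 * k)" using k by (simp add: ennreal_mult)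
        also have "\<dots> \<le> ennreal \<kappa>" using \<kappa>(2) by (rule ennreal_leI)
        finally have "2 * bmo_seminorm b * (emeasure gauss_measure B)\<^sup>2 \<le> ennreal \<kappa> * (emeasure gauss_measure B)\<^sup>2"
          by (rule mult_right_mono) simp
        then show "pair_osc gauss_measure b B \<le> ennreal \<kappa> * (emeasure gauss_measure B)\<^sup>2"
          by (rule order_trans[OF pair_osc_le_bmo[OF bd(2) B]])
      qed
      then show ?thesis using l 1(2) \<kappa> by (simp add: ennreal_mult)
    qed
    show ?thesis
    proof (cases "k = 0")
      case False
      then have "ennnorm q (max_commutator b a \<beta> f) \<le> ennreal (C * (2 * k) * l)" using k(2) by (intro bound) auto
      also have "\<dots> = ennreal (2 * C) * bmo_seminorm b * Lp_norm p f"
        unfolding k(1) l(1) using 1(2) k(2) l(2) by (simp add: ennreal_mult[symmetric] mult_ac)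
      finally show ?thesis .
    next
      case True
      have "ennnorm q (max_commutator b a \<beta> f) = 0"
      proof (rule ennreal_le_zero_if_scaled)
        fix e :: real assume "0 < e"
        then show "ennnorm q (max_commutator b a \<beta> f) \<le> ennreal (C * l * e)"
          using bound[of e] True by (simp add: mult_ac)
      qed (use 1(2) l(2) in simp)
      then show ?thesis by simp
    qed
  qed
  show ?case by (rule 1(1)[OF _ main]) (use 1(2) in simp)
qed

definition truncation :: "(real ^ 'n::finite \<Rightarrow> real) \<Rightarrow> nat \<Rightarrow> real ^ 'n \<Rightarrow> real" where
  "truncation f k x = (if \<bar>f x\<bar> \<le> real k \<and> norm x \<le> real k then f x else 0)"

lemma truncation_borel [measurable]:
  assumes [measurable]: "f \<in> borel_measurable borel"
  shows "truncation f k \<in> borel_measurable borel"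
  unfolding truncation_def by measurable

lemma truncation_Linf_c:
  assumes "f \<in> borel_measurable borel"
  shows "truncation f k \<in> Linf_c"
  unfolding Linf_c_def
proof (intro CollectI conjI exI)
  show "truncation f k \<in> borel_measurable gauss_measure" using truncation_borel[OF assms] by simp
  show "AE x in gauss_measure. \<bar>truncation f k x\<bar> \<le> real k" by (intro AE_I2) (simp add: truncation_def)
  show "compact (cball (0::real ^ 'a) (real k))" by simp
  show "AE x in gauss_measure. x \<notin> cball 0 (real k) \<longrightarrow> truncation f k x = 0" by (intro AE_I2) (simp add: truncation_def)
qed

lemma truncation_tendsto_Lp:
  fixes f :: "real ^ 'n::finite \<Rightarrow> real"
  assumes f: "f \<in> Lp_space p" and p: "0 < p"
  shows "(\<lambda>k. \<integral>\<^sup>+x. ennreal_powr (ennreal \<bar>f x - truncation f k x\<bar>) p \<partial>gauss_measure) \<longlonglongrightarrow> 0"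
proof -
  have [measurable]: "f \<in> borel_measurable borel" using f by (simp add: Lp_space_def)
  have fin: "(\<integral>\<^sup>+x. ennreal_powr (ennreal \<bar>f x\<bar>) p \<partial>gauss_measure) < \<infinity>"
    using f by (simp add: Lp_space_def Lp_norm_def ennnorm_def less_top[symmetric])
  have "(\<lambda>k. \<integral>\<^sup>+x. ennreal_powr (ennreal \<bar>f x - truncation f k x\<bar>) p \<partial>gauss_measure) \<longlonglongrightarrow> (\<integral>\<^sup>+x. 0 \<partial>(gauss_measure :: (real ^ 'n) measure))"
  proof (rule nn_integral_dominated_convergence[where w = "\<lambda>x. ennreal_powr (ennreal \<bar>f x\<bar>) p"])
    show "AE x in gauss_measure. ennreal_powr (ennreal \<bar>f x - truncation f k x\<bar>) p \<le> ennreal_powr (ennreal \<bar>f x\<bar>) p" for k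
      using p by (intro AE_I2 ennreal_powr_mono ennreal_leI) (auto simp: truncation_def)
    show "AE x in gauss_measure. (\<lambda>k. ennreal_powr (ennreal \<bar>f x - truncation f k x\<bar>) p) \<longlonglongrightarrow> 0"
    proof (intro AE_I2 tendsto_eventually)
      fix x
      obtain K where K: "\<bar>f x\<bar> + norm x \<le> real K" using real_arch_simple by blast
      show "eventually (\<lambda>k. ennreal_powr (ennreal \<bar>f x - truncation f k x\<bar>) p = 0) sequentially"
      proof (rule eventually_sequentiallyI[of K])
        fix k assume "K \<le> k"
        then have "real K \<le> real k" by simp
        then have "\<bar>f x\<bar> \<le> real k" "norm x \<le> real k"
          using K norm_ge_zero[of x] abs_ge_zero[of "f x"] by linarith+
        then show "ennreal_powr (ennreal \<bar>f x - truncation f k x\<bar>) p = 0"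
          by (simp add: truncation_def)
      qed
    qed
  qed (use fin in auto)
  then show ?thesis by simp
qed

text \<open>Boundedness with the roots taken out of both norms: if the \<open>p\<close>-th power of the norm of
  \<open>h\<close> is at most \<open>e\<close> to the power \<open>p/q\<close>, then the \<open>q\<close>-th power of the norm of \<open>S h\<close> is of
  order \<open>e\<close>.\<close>

lemma bounded_op_small:
  assumes S: "bounded_op_on (Lp_space p) p q S" and "0 < p" "0 < q"
  obtains L where "0 \<le> L" "\<And>h e. h \<in> Lp_space p \<Longrightarrow> 0 < e \<Longrightarrow>
    (\<integral>\<^sup>+x. ennreal_powr (ennreal \<bar>h x\<bar>) p \<partial>gauss_measure) \<le> ennreal (e powr (p / q)) \<Longrightarrow>
    (\<integral>\<^sup>+x. ennreal_powr (S h x) q \<partial>gauss_measure) \<le> ennreal (L * e)"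
proof -
  obtain C where C: "0 \<le> C" "\<And>h. h \<in> Lp_space p \<Longrightarrow> ennnorm q (S h) \<le> ennreal C * Lp_norm p h"
    using S by (auto simp: bounded_op_on_def)
  have main: "(\<integral>\<^sup>+x. ennreal_powr (S h x) q \<partial>gauss_measure) \<le> ennreal (C powr q * e)"
    if "h \<in> Lp_space p" "0 < e" "(\<integral>\<^sup>+x. ennreal_powr (ennreal \<bar>h x\<bar>) p \<partial>gauss_measure) \<le> ennreal (e powr (p / q))" for h e
  proof -
    have "Lp_norm p h \<le> ennreal_powr (ennreal (e powr (p / q))) (1 / p)"
      unfolding Lp_norm_def ennnorm_def using that assms by (intro ennreal_powr_mono) auto
    also have "\<dots> = ennreal (e powr (1 / q))"
      using assms by (simp add: ennreal_powr_ennreal powr_powr)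
    finally have "ennnorm q (S h) \<le> ennreal C * ennreal (e powr (1 / q))"
      using C(2)[OF that(1)] by (meson mult_left_mono order_trans zero_le)
    then have "ennreal_powr (ennnorm q (S h)) q \<le> ennreal_powr (ennreal C * ennreal (e powr (1 / q))) q"
      using assms by (intro ennreal_powr_mono) auto
    moreover have "ennreal_powr (ennnorm q (S h)) q = (\<integral>\<^sup>+x. ennreal_powr (S h x) q \<partial>gauss_measure)"
      using assms by (simp add: ennnorm_def ennreal_powr_powr)
    moreover have "ennreal_powr (ennreal C * ennreal (e powr (1 / q))) q = ennreal (C powr q * e)"
      using assms C(1) that(2) by (simp add: ennreal_powr_mult ennreal_powr_ennreal powr_powr ennreal_mult)
    ultimately show ?thesis by simp
  qed
  show ?thesis by (rule that[of "C powr q", OF _ main]) simp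
qed

text \<open>Let \<open>t k\<close> be the truncations of \<open>f\<close>. Sublinearity of both extensions gives
  \<open>S' f \<le> S' (t k) + S' (f - t k)\<close> and \<open>S (t k) \<le> S f + S (t k - f)\<close>, and the extensions
  agree on \<open>t k\<close>. Hence \<open>S' f \<le> S f + h k\<close> almost everywhere, with \<open>h k\<close> tending to \<open>0\<close> in
  \<open>L\<^sup>q\<close>, so that the infimum of the \<open>h k\<close> vanishes almost everywhere. Exchanging the
  extensions gives equality.\<close>

lemma bounded_extension_le:
  fixes S S' :: "(real ^ 'n::finite \<Rightarrow> real) \<Rightarrow> real ^ 'n \<Rightarrow> ennreal"
  assumes S: "bounded_extension p q T S" and S': "bounded_extension p q T S'"
    and pq: "0 < p" "0 < q" and f: "f \<in> Lp_space p"
  shows "AE x in gauss_measure. S' f x \<le> S f x"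
proof -
  have fb [measurable]: "f \<in> borel_measurable borel" using f by (simp add: Lp_space_def)
  define t where "t = truncation f"
  define d where "d = (\<lambda>k x. f x - t k x)"
  define d' where "d' = (\<lambda>k x. - 1 * d k x)"
  have tb [measurable]: "t k \<in> borel_measurable borel" for k unfolding t_def by (rule truncation_borel[OF fb])
  have tL: "t k \<in> Linf_c" for k unfolding t_def by (rule truncation_Linf_c[OF fb])
  have tp: "t k \<in> Lp_space p" for k by (rule Lp_spaceI_Linf_c[OF tL pq(1)])
  have Nf: "(\<integral>\<^sup>+x. ennreal_powr (ennreal \<bar>f x\<bar>) p \<partial>gauss_measure) < top"
    using f by (simp add: Lp_space_def Lp_norm_def ennnorm_def less_top[symmetric])
  have dp: "d k \<in> Lp_space p" "d' k \<in> Lp_space p" for k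
  proof -
    have "(\<integral>\<^sup>+x. ennreal_powr (ennreal \<bar>d k x\<bar>) p \<partial>gauss_measure) \<le> (\<integral>\<^sup>+x. ennreal_powr (ennreal \<bar>f x\<bar>) p \<partial>gauss_measure)"
      using pq by (intro nn_integral_mono ennreal_powr_mono ennreal_leI) (auto simp: d_def t_def truncation_def)
    then have "(\<integral>\<^sup>+x. ennreal_powr (ennreal \<bar>d k x\<bar>) p \<partial>gauss_measure) < top" using Nf by (rule order.strict_trans1)
    then show "d k \<in> Lp_space p" "d' k \<in> Lp_space p"
      unfolding d'_def by (auto simp: Lp_space_def Lp_norm_def ennnorm_def less_top[symmetric] d_def abs_minus_commute)
  qed
  define h where "h = (\<lambda>k x. S (d' k) x + S' (d k) x)"
  have sub: "AE x in gauss_measure. R (\<lambda>y. g y + g' y) x \<le> R g x + R g' x"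
    if "bounded_extension p q T R" "g \<in> Lp_space p" "g' \<in> Lp_space p" for R g g'
    using that by (simp add: bounded_extension_def sublinear_op_on_def)
  have ext: "AE x in gauss_measure. R (t k) x = T (t k) x" if "bounded_extension p q T R" for R k
    using that tL by (simp add: bounded_extension_def)
  have le_k: "AE x in gauss_measure. S' f x \<le> S f x + h k x" for k
  proof -
    have f_eq: "f = (\<lambda>y. t k y + d k y)" and t_eq: "t k = (\<lambda>y. f y + d' k y)"
      by (auto simp: d_def d'_def fun_eq_iff)
    have "AE x in gauss_measure. S' (\<lambda>y. t k y + d k y) x \<le> S' (t k) x + S' (d k) x"
      by (rule sub[OF S' tp dp(1)])
    moreover have "AE x in gauss_measure. S (\<lambda>y. f y + d' k y) x \<le> S f x + S (d' k) x"
      by (rule sub[OF S f dp(2)])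
    ultimately show ?thesis
      unfolding f_eq[symmetric] t_eq[symmetric]
      using ext[OF S, of k] ext[OF S', of k]
    proof eventually_elim
      case (elim x)
      have "S' f x \<le> S (t k) x + S' (d k) x" using elim by simp
      also have "\<dots> \<le> (S f x + S (d' k) x) + S' (d k) x" using elim by (intro add_right_mono) simp
      finally show ?case by (simp add: h_def add.assoc)
    qed
  qed
  have SB: "bounded_op_on (Lp_space p) p q S" "bounded_op_on (Lp_space p) p q S'"
    using S S' by (auto simp: bounded_extension_def)
  have meas [measurable]: "S g \<in> borel_measurable borel" "S' g \<in> borel_measurable borel" if "g \<in> Lp_space p" for g
    using SB that by (auto simp: bounded_op_on_def)
  have hm [measurable]: "h k \<in> borel_measurable gauss_measure" for k
    unfolding h_def using meas(1)[OF dp(2)[of k]] meas(2)[OF dp(1)[of k]] by simp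
  obtain L where L: "0 \<le> L" "\<And>h e. h \<in> Lp_space p \<Longrightarrow> 0 < e \<Longrightarrow>
    (\<integral>\<^sup>+x. ennreal_powr (ennreal \<bar>h x\<bar>) p \<partial>gauss_measure) \<le> ennreal (e powr (p / q)) \<Longrightarrow>
    (\<integral>\<^sup>+x. ennreal_powr (S h x) q \<partial>gauss_measure) \<le> ennreal (L * e)"
  proof (rule bounded_op_small[OF SB(1) pq], goal_cases)
    case (1 L) show ?case by (rule 1(1)[OF 1(2) 1(3)])
  qed
  obtain L' where L': "0 \<le> L'" "\<And>h e. h \<in> Lp_space p \<Longrightarrow> 0 < e \<Longrightarrow>
    (\<integral>\<^sup>+x. ennreal_powr (ennreal \<bar>h x\<bar>) p \<partial>gauss_measure) \<le> ennreal (e powr (p / q)) \<Longrightarrow>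
    (\<integral>\<^sup>+x. ennreal_powr (S' h x) q \<partial>gauss_measure) \<le> ennreal (L' * e)"
  proof (rule bounded_op_small[OF SB(2) pq], goal_cases)
    case (1 L) show ?case by (rule 1(1)[OF 1(2) 1(3)])
  qed
  have "(\<integral>\<^sup>+x. ennreal_powr (INF k. h k x) q \<partial>gauss_measure) = 0"
  proof (rule ennreal_le_zero_if_scaled)
    fix e :: real assume e: "0 < e"
    have "eventually (\<lambda>k. (\<integral>\<^sup>+x. ennreal_powr (ennreal \<bar>f x - truncation f k x\<bar>) p \<partial>gauss_measure) < ennreal (e powr (p / q))) sequentially"
      using e by (intro order_tendstoD(2)[OF truncation_tendsto_Lp[OF f pq(1)]]) simp
    then obtain k where k: "(\<integral>\<^sup>+x. ennreal_powr (ennreal \<bar>d k x\<bar>) p \<partial>gauss_measure) \<le> ennreal (e powr (p / q))"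
      unfolding d_def t_def by (auto simp: eventually_sequentially intro: less_imp_le)
    then have k': "(\<integral>\<^sup>+x. ennreal_powr (ennreal \<bar>d' k x\<bar>) p \<partial>gauss_measure) \<le> ennreal (e powr (p / q))"
      by (simp add: d'_def)
    have "(\<integral>\<^sup>+x. ennreal_powr (INF k. h k x) q \<partial>gauss_measure) \<le>
        (\<integral>\<^sup>+x. ennreal (2 powr q) * (ennreal_powr (S (d' k) x) q + ennreal_powr (S' (d k) x) q) \<partial>gauss_measure)"
    proof (rule nn_integral_mono)
      fix x
      have "ennreal_powr (INF k. h k x) q \<le> ennreal_powr (h k x) q"
        using pq by (intro ennreal_powr_mono INF_lower) auto
      also have "\<dots> \<le> ennreal (2 powr q) * (ennreal_powr (S (d' k) x) q + ennreal_powr (S' (d k) x) q)"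
        unfolding h_def by (rule ennreal_powr_sum_le[OF pq(2)])
      finally show "ennreal_powr (INF k. h k x) q \<le> ennreal (2 powr q) * (ennreal_powr (S (d' k) x) q + ennreal_powr (S' (d k) x) q)" .
    qed
    also have "\<dots> = ennreal (2 powr q) * ((\<integral>\<^sup>+x. ennreal_powr (S (d' k) x) q \<partial>gauss_measure) + (\<integral>\<^sup>+x. ennreal_powr (S' (d k) x) q \<partial>gauss_measure))"
      using meas(1)[OF dp(2)[of k]] meas(2)[OF dp(1)[of k]] by (simp add: nn_integral_cmult nn_integral_add)
    also have "\<dots> \<le> ennreal (2 powr q) * (ennreal (L * e) + ennreal (L' * e))"
      by (intro mult_left_mono add_mono L(2)[OF dp(2) e k'] L'(2)[OF dp(1) e k]) simp
    also have "\<dots> = ennreal (2 powr q * (L + L') * e)"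
      using L(1) L'(1) e by (simp add: ennreal_mult[symmetric] ennreal_plus[symmetric] algebra_simps del: ennreal_plus)
    finally show "(\<integral>\<^sup>+x. ennreal_powr (INF k. h k x) q \<partial>gauss_measure) \<le> ennreal (2 powr q * (L + L') * e)" .
  qed (use L(1) L'(1) in simp)
  then have inf0: "AE x in gauss_measure. (INF k. h k x) = 0"
    by (subst (asm) nn_integral_0_iff_AE) auto
  have "AE x in gauss_measure. \<forall>k. S' f x \<le> S f x + h k x"
    using le_k by (simp add: AE_all_countable)
  then show ?thesis using inf0
  proof eventually_elim
    case (elim x)
    have "S' f x \<le> (INF k. S f x + h k x)" using elim(1) by (intro INF_greatest) simp
    also have "\<dots> = S f x + (INF k. h k x)" by (rule INF_ennreal_const_add)
    finally show ?case using elim(2) by simp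
  qed
qed

text \<open>The test function is the indicator of \<open>B\<close>, normalized in \<open>L\<^sup>p\<close>. For \<open>x \<in> B\<close> the ball
  \<open>B\<close> itself competes in the supremum at \<open>x\<close>; integrating over \<open>x \<in> B\<close> with Hoelder's
  inequality, the mass appears to the power \<open>(1 - \<beta>) + 1/p + (1 - 1/q) = 2\<close>.\<close>

lemma pair_osc_le_op_norm:
  fixes b :: "real ^ 'n::finite \<Rightarrow> real"
  assumes a: "0 < a" and pq: "1 < p" "1 < q" "1 / q = 1 / p - \<beta>"
    and b [measurable]: "b \<in> borel_measurable borel" and B: "B \<in> admissible_balls a"
  shows "pair_osc gauss_measure b B \<le> op_norm_on Linf_c p q (max_commutator b a \<beta>) * (emeasure gauss_measure B)\<^sup>2"
proof -
  let ?T = "max_commutator b a \<beta>"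
  note mB = admissible_ball_measure[OF B a]
  note [measurable] = mB(1)
  define m where "m = measure gauss_measure B"
  have m: "0 < m" "emeasure gauss_measure B = ennreal m" using mB by (auto simp: m_def)
  define c where "c = m powr (- 1 / p)"
  have c: "0 < c" using m by (simp add: c_def)
  define f where "f = (\<lambda>y. c * indicator B y)"
  have f [measurable]: "f \<in> borel_measurable borel" unfolding f_def by measurable
  have fL: "f \<in> Linf_c"
    unfolding Linf_c_def
  proof (intro CollectI conjI exI)
    show "f \<in> borel_measurable gauss_measure" using f by simp
    show "AE x in gauss_measure. \<bar>f x\<bar> \<le> c" using c by (intro AE_I2) (simp add: f_def indicator_def)
    show "compact (closure B)" using mB(4) by simp
    show "AE x in gauss_measure. x \<notin> closure B \<longrightarrow> f x = 0"
      using closure_subset[of B] by (intro AE_I2) (auto simp: f_def indicator_def)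
  qed
  have "(\<integral>\<^sup>+x. ennreal_powr (ennreal \<bar>f x\<bar>) p \<partial>gauss_measure) = (\<integral>\<^sup>+x. ennreal (c powr p) * indicator B x \<partial>gauss_measure)"
    using c by (intro nn_integral_cong) (simp add: f_def ennreal_powr_ennreal indicator_def)
  also have "\<dots> = ennreal (c powr p * m)"
    using m by (simp add: nn_integral_cmult_indicator ennreal_mult)
  also have "c powr p * m = 1"
  proof -
    have "c powr p = m powr (- 1 / p * p)" by (simp only: c_def powr_powr)
    also have "- 1 / p * p = - 1" using pq by simp
    finally show ?thesis using m(1) by (simp add: powr_minus)
  qed
  finally have norm1: "Lp_norm p f = 1" by (simp add: Lp_norm_def ennnorm_def)
  have TN: "ennnorm q (?T f) \<le> op_norm_on Linf_c p q ?T"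
    unfolding op_norm_on_def using fL norm1 by (intro SUP_upper) simp
  have Tm [measurable]: "?T f \<in> borel_measurable borel" by (rule borel_measurable_max_commutator[OF b f])
  let ?I = "\<lambda>x. \<integral>\<^sup>+y\<in>B. ennreal \<bar>b x - b y\<bar> \<partial>gauss_measure"
  have lower: "?I x \<le> ennreal (m powr (1 - \<beta>) / c) * ?T f x" if x: "x \<in> B" for x
  proof -
    have "(\<integral>\<^sup>+y\<in>B. ennreal (\<bar>b x - b y\<bar> * \<bar>f y\<bar>) \<partial>gauss_measure) = (\<integral>\<^sup>+y. ennreal c * (ennreal \<bar>b x - b y\<bar> * indicator B y) \<partial>gauss_measure)"
      using c by (intro nn_integral_cong) (auto simp: f_def ennreal_mult indicator_def mult.commute)
    also have "\<dots> = ennreal c * ?I x" by (rule nn_integral_cmult) simp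
    finally have "ennreal c * ?I x / ennreal (m powr (1 - \<beta>)) \<le> ?T f x"
      unfolding max_commutator_def m_def using B x by (intro SUP_upper2[of B]) auto
    then have "ennreal c * ?I x \<le> ?T f x * ennreal (m powr (1 - \<beta>))"
      using m(1) by (subst (asm) ennreal_divide_le_iff) auto
    then have "ennreal (1 / c) * (ennreal c * ?I x) \<le> ennreal (1 / c) * (?T f x * ennreal (m powr (1 - \<beta>)))"
      by (rule mult_left_mono) simp
    moreover have "ennreal (1 / c) * (ennreal c * ?I x) = ?I x"
      using c by (simp add: mult.assoc[symmetric] ennreal_mult[symmetric])
    moreover have "ennreal (1 / c) * (?T f x * ennreal (m powr (1 - \<beta>))) = ennreal (m powr (1 - \<beta>) / c) * ?T f x"
    proof -
      have "ennreal (1 / c) * ennreal (m powr (1 - \<beta>)) = ennreal (m powr (1 - \<beta>) / c)"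
        using c by (simp add: ennreal_mult[symmetric])
      then show ?thesis by (metis mult.assoc mult.commute)
    qed
    ultimately show ?thesis by simp
  qed
  have "pair_osc gauss_measure b B \<le> (\<integral>\<^sup>+x. ennreal (m powr (1 - \<beta>) / c) * (?T f x * indicator B x) \<partial>gauss_measure)"
    unfolding pair_osc_def using lower by (intro nn_integral_mono) (auto simp: indicator_def)
  also have "\<dots> = ennreal (m powr (1 - \<beta>) / c) * (\<integral>\<^sup>+x. ?T f x * indicator B x \<partial>gauss_measure)"
    by (rule nn_integral_cmult) simp
  also have "(\<integral>\<^sup>+x. ?T f x * indicator B x \<partial>gauss_measure) \<le> ennnorm q (?T f) * ennreal (m powr (1 - 1 / q))"
  proof -
    define r where "r = q / (q - 1)"
    have r: "1 < r" "1 / q + 1 / r = 1" "1 / r = 1 - 1 / q" using pq by (auto simp: r_def field_simps)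
    have "(\<integral>\<^sup>+x. ennreal_powr (indicator B x) r \<partial>gauss_measure) = ennreal m"
    proof -
      have "(\<integral>\<^sup>+x. ennreal_powr (indicator B x) r \<partial>gauss_measure) = (\<integral>\<^sup>+x. indicator B x \<partial>gauss_measure)"
        by (intro nn_integral_cong) (auto simp: indicator_def)
      then show ?thesis using m by simp
    qed
    then show ?thesis
      using nn_integral_Hoelder[of "?T f" gauss_measure "indicator B" q r] pq r m(1)
      by (simp add: ennnorm_def ennreal_powr_ennreal)
  qed
  also have "ennnorm q (?T f) * ennreal (m powr (1 - 1 / q)) \<le> op_norm_on Linf_c p q ?T * ennreal (m powr (1 - 1 / q))"
    by (rule mult_right_mono[OF TN]) simp
  also have "ennreal (m powr (1 - \<beta>) / c) * (op_norm_on Linf_c p q ?T * ennreal (m powr (1 - 1 / q))) =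
      op_norm_on Linf_c p q ?T * (ennreal m)\<^sup>2"
  proof -
    have "m powr (1 - \<beta>) / c * m powr (1 - 1 / q) = m powr (1 - \<beta> + 1 / p + (1 - 1 / q))"
    proof -
      have "m powr (1 - \<beta>) / c = m powr (1 - \<beta>) * m powr (1 / p)"
        by (simp add: c_def powr_minus divide_inverse)
      then show ?thesis by (simp only: powr_add)
    qed
    also have "1 - \<beta> + 1 / p + (1 - 1 / q) = 2" using pq(3) by simp
    finally have "ennreal (m powr (1 - \<beta>) / c) * ennreal (m powr (1 - 1 / q)) = (ennreal m)\<^sup>2"
      using m(1) c by (simp add: ennreal_mult[symmetric] ennreal_power)
    then show ?thesis by (metis mult.assoc mult.commute)
  qed
  finally show ?thesis unfolding m(2) by (simp add: mult_left_mono)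
qed

section \<open>The characterization of BMO\<close>

theorem theorem1p2:
  fixes a \<beta> p q :: real
  assumes "0 < a" and "0 < \<beta>" and "\<beta> < 1" and "1 < p" and "p < q" and "1 / q = 1 / p - \<beta>"
  shows "\<exists>C>0.
    (\<forall>b \<in> (BMO :: (real ^ 'n::finite \<Rightarrow> real) set).
       (\<forall>f\<in>Linf_c. max_commutator b a \<beta> f \<in> borel_measurable gauss_measure \<and>
          ennnorm q (max_commutator b a \<beta> f) \<le> ennreal C * bmo_seminorm b * Lp_norm p f) \<and>
       (\<exists>S. bounded_extension p q (max_commutator b a \<beta>) S \<and>
          op_norm_on (Lp_space p) p q S \<le> ennreal C * bmo_seminorm b \<and>
          (\<forall>S'. bounded_extension p q (max_commutator b a \<beta>) S' \<longrightarrow>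
             (\<forall>f\<in>Lp_space p. AE x in gauss_measure. S' f x = S f x)))) \<and>
    (\<forall>b \<in> (Lp_space 1 :: (real ^ 'n \<Rightarrow> real) set).
       bounded_op_on Linf_c p q (max_commutator b a \<beta>) \<longrightarrow>
       b \<in> BMO \<and>
       BMO_norm b \<le> Lp_norm 1 b +
         ennreal C * op_norm_on Linf_c p q (max_commutator b a \<beta>))"
proof -
  have pq: "1 < q" "0 < p" "0 < q" using assms by auto
  obtain C1 where C1: "0 < C1" "\<And>(b :: real ^ 'n \<Rightarrow> real) f. b \<in> BMO \<Longrightarrow> f \<in> Lp_space p \<Longrightarrow>
      ennnorm q (max_commutator b a \<beta> f) \<le> ennreal C1 * bmo_seminorm b * Lp_norm p f"
  proof (rule commutator_norm_le[OF assms, where 'n = 'n], goal_cases)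
    case (1 C) show ?case by (rule 1(1)[OF 1(2) 1(3)])
  qed
  obtain C2 where C2: "0 < C2"
    "\<And>(b :: real ^ 'n \<Rightarrow> real) \<kappa> B. \<lbrakk>b \<in> borel_measurable borel;
      \<And>B. B \<in> admissible_balls a \<Longrightarrow> pair_osc gauss_measure b B \<le> \<kappa> * (emeasure gauss_measure B)\<^sup>2;
      B \<in> admissible_balls 1\<rbrakk> \<Longrightarrow> pair_osc gauss_measure b B \<le> ennreal C2 * \<kappa> * (emeasure gauss_measure B)\<^sup>2"
  proof (rule pair_osc_change_aperture[OF assms(1) zero_less_one, where 'n = 'n], goal_cases)
    case (1 C) show ?case by (rule 1(1)[OF 1(2) 1(3)])
  qed
  define C where "C = max C1 C2"
  have C: "0 < C" "C1 \<le> C" "C2 \<le> C" using C1(1) by (auto simp: C_def)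
  have measT: "max_commutator b a \<beta> f \<in> borel_measurable gauss_measure"
    if "b \<in> BMO" "f \<in> Lp_space p" for b f :: "real ^ 'n \<Rightarrow> real"
    using borel_measurable_max_commutator[OF BMO_D(2)[OF that(1)], of f] that(2) by (simp add: Lp_space_def)
  have bound: "ennnorm q (max_commutator b a \<beta> f) \<le> ennreal C * bmo_seminorm b * Lp_norm p f"
    if "b \<in> BMO" "f \<in> Lp_space p" for b f :: "real ^ 'n \<Rightarrow> real"
    by (rule order_trans[OF C1(2)[OF that]]) (intro mult_right_mono ennreal_leI C(2); simp)
  have ext: "bounded_extension p q (max_commutator b a \<beta>) (max_commutator b a \<beta>)"
    if b: "b \<in> BMO" for b :: "real ^ 'n \<Rightarrow> real"
    unfolding bounded_extension_def
  proof (intro conjI)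
    show "sublinear_op_on (Lp_space p) (max_commutator b a \<beta>)"
      by (rule sublinear_max_commutator[OF assms(1) BMO_D(2)[OF b]])
    obtain k where k: "bmo_seminorm b = ennreal k" "0 \<le> k"
      using BMO_D(3)[OF b] by (cases "bmo_seminorm b") auto
    show "bounded_op_on (Lp_space p) p q (max_commutator b a \<beta>)"
      unfolding bounded_op_on_def
    proof (intro exI[of _ "C * k"] conjI ballI)
      fix f :: "real ^ 'n \<Rightarrow> real" assume f: "f \<in> Lp_space p"
      show "max_commutator b a \<beta> f \<in> borel_measurable gauss_measure" by (rule measT[OF b f])
      show "ennnorm q (max_commutator b a \<beta> f) \<le> ennreal (C * k) * Lp_norm p f"
        using bound[OF b f] k C(1) by (simp add: ennreal_mult)
    qed (use k C(1) in simp)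
    show "\<forall>f\<in>Linf_c. AE x in gauss_measure. max_commutator b a \<beta> f x = max_commutator b a \<beta> f x"
      by simp
  qed
  have part_i: "(\<forall>f\<in>Linf_c. max_commutator b a \<beta> f \<in> borel_measurable gauss_measure \<and>
          ennnorm q (max_commutator b a \<beta> f) \<le> ennreal C * bmo_seminorm b * Lp_norm p f) \<and>
       (\<exists>S. bounded_extension p q (max_commutator b a \<beta>) S \<and>
          op_norm_on (Lp_space p) p q S \<le> ennreal C * bmo_seminorm b \<and>
          (\<forall>S'. bounded_extension p q (max_commutator b a \<beta>) S' \<longrightarrow>
             (\<forall>f\<in>Lp_space p. AE x in gauss_measure. S' f x = S f x)))"
    if b: "b \<in> BMO" for b :: "real ^ 'n \<Rightarrow> real"
  proof (intro conjI ballI exI[of _ "max_commutator b a \<beta>"] allI impI)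
    fix f :: "real ^ 'n \<Rightarrow> real" assume "f \<in> Linf_c"
    then have f: "f \<in> Lp_space p" using Lp_spaceI_Linf_c pq(2) by blast
    show "max_commutator b a \<beta> f \<in> borel_measurable gauss_measure" by (rule measT[OF b f])
    show "ennnorm q (max_commutator b a \<beta> f) \<le> ennreal C * bmo_seminorm b * Lp_norm p f"
      by (rule bound[OF b f])
  next
    show "bounded_extension p q (max_commutator b a \<beta>) (max_commutator b a \<beta>)" by (rule ext[OF b])
    show "op_norm_on (Lp_space p) p q (max_commutator b a \<beta>) \<le> ennreal C * bmo_seminorm b"
      unfolding op_norm_on_def
    proof (rule SUP_least)
      fix f :: "real ^ 'n \<Rightarrow> real" assume f: "f \<in> {f \<in> Lp_space p. Lp_norm p f = 1}"
      show "ennnorm q (max_commutator b a \<beta> f) \<le> ennreal C * bmo_seminorm b"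
        using bound[OF b, of f] f by simp
    qed
  next
    fix S' and f :: "real ^ 'n \<Rightarrow> real"
    assume S': "bounded_extension p q (max_commutator b a \<beta>) S'" and f: "f \<in> Lp_space p"
    show "AE x in gauss_measure. S' f x = max_commutator b a \<beta> f x"
      using bounded_extension_le[OF ext[OF b] S' pq(2,3) f] bounded_extension_le[OF S' ext[OF b] pq(2,3) f]
      by eventually_elim (rule antisym)
  qed
  have part_ii: "b \<in> BMO \<and> BMO_norm b \<le> Lp_norm 1 b +
         ennreal C * op_norm_on Linf_c p q (max_commutator b a \<beta>)"
    if b: "b \<in> Lp_space 1" and bd: "bounded_op_on Linf_c p q (max_commutator b a \<beta>)" for b :: "real ^ 'n \<Rightarrow> real"
  proof -
    let ?N = "op_norm_on Linf_c p q (max_commutator b a \<beta>)"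
    have int: "integrable gauss_measure b" using b by (simp add: Lp_space_1_eq)
    have bm: "b \<in> borel_measurable borel" using b by (simp add: Lp_space_def)
    obtain K where K: "\<And>f. f \<in> Linf_c \<Longrightarrow> ennnorm q (max_commutator b a \<beta> f) \<le> ennreal K * Lp_norm p f"
      using bd by (auto simp: bounded_op_on_def)
    have "?N \<le> ennreal K"
      unfolding op_norm_on_def
    proof (rule SUP_least)
      fix f :: "real ^ 'n \<Rightarrow> real" assume "f \<in> {f \<in> Linf_c. Lp_norm p f = 1}"
      then show "ennnorm q (max_commutator b a \<beta> f) \<le> ennreal K" using K[of f] by simp
    qed
    then have N: "?N < top" by (rule order.strict_trans1) simp
    have "bmo_seminorm b \<le> ennreal C2 * ?N"
      by (rule bmo_le_pair_osc[OF int])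
        (rule C2(2)[OF bm pair_osc_le_op_norm[OF assms(1,4) pq(1) assms(6) bm]])
    also have "\<dots> \<le> ennreal C * ?N"
      by (intro mult_right_mono ennreal_leI C(3)) simp
    finally have le: "bmo_seminorm b \<le> ennreal C * ?N" .
    also have "\<dots> < top" using N by (simp add: ennreal_mult_less_top)
    finally have "b \<in> BMO" using b by (simp add: BMO_def)
    moreover have "BMO_norm b \<le> Lp_norm 1 b + ennreal C * ?N"
      unfolding BMO_norm_def using le by (simp add: add.commute add_left_mono)
    ultimately show ?thesis by blast
  qed
  show ?thesis
    by (rule exI[of _ C], intro conjI ballI impI C(1)) (use part_i part_ii in blast)+
qed

end
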